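(* If $\beta>1$, then the operator $T_\beta$ is bounded from $L^\infty\times L^2$ to $L^2$; that is, there is a constant $C$ (independent of $f$ and $g$) such that $$\|T_\beta(f,g)\|_2\le C\,\|f\|_\infty\,\|g\|_2$$ for all $f\in L^\infty$ and $g\in L^2$.
   Context: For $\beta>0$, $T_\beta$ is the bilinear oscillatory integral along a parabola, acting on functions $f,g$ on the real line $\mathbb{R}$, given by $$T_\beta(f,g)(x)=\int_{-1}^{1} f(x-t)\,g(x-t^2)\,e^{i|t|^{-\beta}}\,\frac{dt}{|t|},\qquad x\in\mathbb{R}.$$ Here $L^p$ denotes $L^p(\mathbb{R})$ and $\|\cdot\|_p$ its norm. *)

theory Defs
  imports "HOL-Analysis.Analysis" "HOL-Probability.Essential_Supremum"
begin

definition L2_space :: "(real \<Rightarrow> complex) set" where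
  "L2_space = {f. f \<in> borel_measurable lebesgue \<and> integrable lebesgue (\<lambda>x. (cmod (f x))\<^sup>2)}"

definition norm_L2 :: "(real \<Rightarrow> complex) \<Rightarrow> real" where
  "norm_L2 f = sqrt (LINT x|lebesgue. (cmod (f x))\<^sup>2)"

definition Linf_space :: "(real \<Rightarrow> complex) set" where
  "Linf_space = {f. f \<in> borel_measurable lebesgue
                    \<and> esssup lebesgue (\<lambda>x. ereal (cmod (f x))) < \<infinity>}"

definition norm_Linf :: "(real \<Rightarrow> complex) \<Rightarrow> real" where
  "norm_Linf f = real_of_ereal (esssup lebesgue (\<lambda>x. ereal (cmod (f x))))"

(* For f in Linf_space, g in L2_space and e > 0 the integrand below is integrable over
   e <= |t| <= 1 for every x, because g(x - t^2) is locally integrable in t away from 0. *)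
definition T_trunc ::
    "real \<Rightarrow> real \<Rightarrow> (real \<Rightarrow> complex) \<Rightarrow> (real \<Rightarrow> complex) \<Rightarrow> real \<Rightarrow> complex" where
  "T_trunc \<beta> e f g x =
     (LINT t:{t. e \<le> \<bar>t\<bar> \<and> \<bar>t\<bar> \<le> 1}|lebesgue.
        f (x - t) * g (x - t\<^sup>2) * exp (\<i> * complex_of_real (\<bar>t\<bar> powr (- \<beta>))) / complex_of_real \<bar>t\<bar>)"

(* The factor 1/|t| is not integrable at 0, so the integral over [-1,1] converges only
   conditionally in general; it is the limit of the truncated integrals. Where the limit does not
   exist, the value of T_op is unspecified; T_exists records the existence. *)
definition T_exists ::
    "real \<Rightarrow> (real \<Rightarrow> complex) \<Rightarrow> (real \<Rightarrow> complex) \<Rightarrow> real \<Rightarrow> bool" where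
  "T_exists \<beta> f g x \<longleftrightarrow> (\<exists>L. ((\<lambda>e. T_trunc \<beta> e f g x) \<longlongrightarrow> L) (at_right 0))"

definition T_op ::
    "real \<Rightarrow> (real \<Rightarrow> complex) \<Rightarrow> (real \<Rightarrow> complex) \<Rightarrow> real \<Rightarrow> complex" where
  "T_op \<beta> f g x = Lim (at_right 0) (\<lambda>e. T_trunc \<beta> e f g x)"

end

theory Submission imports Defs "HOL-Probability.Probability" begin

text \<open>
  The part of the integral over \<open>r1 \<le> |t| \<le> r2 \<le> 2 r1\<close> gains a power of \<open>r2\<close>. Rescaled to unit size it reads
  \<open>\<integral> f (\<epsilon> x - t) g (x - t\<^sup>2) exp (i \<lambda> t powr (-\<beta>)) dt/t\<close> with \<open>\<lambda> |\<epsilon>|\<close> large because \<open>\<beta> > 1\<close>. With \<open>u = \<epsilon> x - t\<close> as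
  variable this is linear in \<open>f\<close>, and the TT* method with Cauchy--Schwarz eliminates the bounded function \<open>f\<close>. What remains is a
  quadrilinear form in \<open>g\<close>, and in suitable coordinates its inner integral is a Fourier multiplier whose symbol is
  an oscillatory integral with nondegenerate phase. Van der Corput's estimate bounds the symbol by
  \<open>(\<lambda> |\<epsilon>| |e| p) powr (-1/2)\<close>, which is integrable in the two remaining parameters \<open>p\<close>, \<open>e\<close>. This treats bounded \<open>g\<close>;
  truncation of \<open>g\<close> and localization to unit intervals give \<open>L\<^sup>2\<close> bounds, which sum over the scales. The weights in that
  summation also yield almost everywhere convergence.
\<close>

text \<open>Under \<open>t -> r t\<close>, \<open>x -> r\<^sup>2 x\<close> the argument of
  \<open>g\<close> keeps its form, while that of \<open>f\<close> becomes a multiple of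
  \<open>\<epsilon> x - t\<close> with \<open>|\<epsilon>| = r\<close>: at unit scale
  \<open>f\<close> hardly sees \<open>x\<close>. A merely bounded \<open>f\<close> offers no decay,
  and only the slow drift \<open>\<epsilon> x\<close> lets an integration in \<open>x\<close> detect
  the oscillation; hence the gain is measured by
  \<open>\<lambda> |\<epsilon>| = r powr (1 - \<beta>)\<close>. The obstacle is degeneration. The
  four points of the quadrilinear form differ by amounts comparable to \<open>\<epsilon> e\<close>
  and \<open>p\<close>, so for small \<open>p\<close> or \<open>e\<close> the phase is nearly flat,
  and so is the translation of \<open>g\<close> that it accompanies. A derivative test on the phase
  alone would not be uniform in the frequency; instead the two derivatives are divided by each
  other, and this quotient is strictly monotone with slope proportional to \<open>\<lambda>\<close>.
  The form is of size \<open>(\<lambda> |\<epsilon>|) powr (-1/2)\<close>. The Cauchy--Schwarz step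
  and the truncation of \<open>g\<close> each cost a square root, which leaves
  \<open>r powr ((\<beta> - 1) / 8)\<close> for the squared norm of a piece; any positive power is
  enough for the summation.\<close>

lemma measurable_cnj[measurable]: "cnj \<in> borel_measurable borel"
  by (intro borel_measurable_continuous_onI continuous_intros)
lemma measurable_cis[measurable]: "cis \<in> borel_measurable borel"
  by (intro borel_measurable_continuous_onI continuous_intros)

section \<open>Plancherel comparison\<close>

lemma integrable_bounded_supp:
  fixes F :: "'a \<Rightarrow> 'b::{banach,second_countable_topology}"
  assumes "F \<in> borel_measurable M" "A \<in> sets M" "emeasure M A < \<infinity>"
    "\<And>x. norm (F x) \<le> B" "\<And>x. F x \<noteq> 0 \<Longrightarrow> x \<in> A"
  shows "integrable M F"
  by (rule integrableI_bounded_set[of A M F B]) (use assms in auto)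

lemma integrable_lborel_bounded_supp:
  fixes F :: "real \<Rightarrow> 'b::{banach,second_countable_topology}"
  assumes "F \<in> borel_measurable borel" "\<And>x. norm (F x) \<le> B" "\<And>x. F x \<noteq> 0 \<Longrightarrow> \<bar>x\<bar> \<le> R"
  shows "integrable lborel F"
  by (rule integrable_bounded_supp[of F lborel "{-R..R}" B]) (use assms in \<open>auto simp: emeasure_lborel_Icc_eq\<close>, fastforce+)

lemma integrable_pair_bounded_supp:
  fixes F :: "real \<Rightarrow> real \<Rightarrow> 'b::{banach,second_countable_topology}"
  assumes "case_prod F \<in> borel_measurable (borel \<Otimes>\<^sub>M borel)" "\<And>x y. norm (F x y) \<le> B"
    "\<And>x y. F x y \<noteq> 0 \<Longrightarrow> \<bar>x\<bar> \<le> R" "\<And>x y. F x y \<noteq> 0 \<Longrightarrow> \<bar>y\<bar> \<le> R"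
  shows "integrable (lborel \<Otimes>\<^sub>M lborel) (case_prod F)"
proof (rule integrable_bounded_supp[of _ _ "{-R..R} \<times> {-R..R}" B])
  show "emeasure (lborel \<Otimes>\<^sub>M lborel) ({- R..R} \<times> {- R..R}) < \<infinity>"
    by (subst lborel.emeasure_pair_measure_Times) (auto simp: emeasure_lborel_Icc_eq ennreal_mult_less_top)
  show "\<And>x. case_prod F x \<noteq> 0 \<Longrightarrow> x \<in> {- R..R} \<times> {- R..R}"
    using assms(3,4) by (fastforce simp: abs_le_iff)
qed (use assms in auto)

lemma swap_bounded_supp:
  fixes F :: "real \<Rightarrow> real \<Rightarrow> 'b::{banach,second_countable_topology}"
  assumes "case_prod F \<in> borel_measurable (borel \<Otimes>\<^sub>M borel)" "\<And>x y. norm (F x y) \<le> B"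
    "\<And>x y. F x y \<noteq> 0 \<Longrightarrow> \<bar>x\<bar> \<le> R" "\<And>x y. F x y \<noteq> 0 \<Longrightarrow> \<bar>y\<bar> \<le> R"
  shows "(LINT x|lborel. LINT y|lborel. F x y) = (LINT y|lborel. LINT x|lborel. F x y)"
  by (rule lborel_pair.Fubini_integral[symmetric]) (rule integrable_pair_bounded_supp[OF assms])

section \<open>Fourier transforms against a Gaussian weight\<close>

definition fourier :: "(real \<Rightarrow> complex) \<Rightarrow> real \<Rightarrow> complex" where
  "fourier F \<xi> = (LINT x|lborel. F x * cis (- \<xi> * x))"

abbreviation "gauss \<equiv> std_normal_distribution"

lemma integral_gauss:
  fixes F :: "real \<Rightarrow> complex"
  assumes [measurable]: "F \<in> borel_measurable borel"
  shows "(LINT z|gauss. F z) = (LINT z|lborel. std_normal_density z * F z)"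
  by (subst integral_density) (auto simp: scaleR_conv_of_real)

text \<open>The characteristic function of the normal law, the one explicit transform on which the
  Plancherel comparison rests.\<close>

lemma gauss_cis: "(LINT \<xi>|gauss. cis (t * \<xi>)) = complex_of_real (exp (- (t^2) / 2))"
  using char_std_normal_distribution unfolding char_def cis_conv_exp by (metis (no_types, lifting))

interpretation gauss: prob_space gauss
  by (rule prob_space_normal_density) simp
interpretation GL: pair_sigma_finite gauss lborel ..

lemma integrable_gauss_pair_bounded_supp:
  fixes F :: "real \<Rightarrow> real \<Rightarrow> 'b::{banach,second_countable_topology}"
  assumes [measurable]: "case_prod F \<in> borel_measurable (borel \<Otimes>\<^sub>M borel)" and "\<And>x y. norm (F x y) \<le> B"
    "\<And>x y. F x y \<noteq> 0 \<Longrightarrow> \<bar>y\<bar> \<le> R"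
  shows "integrable (gauss \<Otimes>\<^sub>M lborel) (case_prod F)"
proof (rule integrable_bounded_supp[of _ _ "UNIV \<times> {-R..R}" B])
  show "emeasure (gauss \<Otimes>\<^sub>M lborel) (UNIV \<times> {- R..R}) < \<infinity>"
    using gauss.emeasure_space_1
    by (subst lborel.emeasure_pair_measure_Times) (auto simp: emeasure_lborel_Icc_eq ennreal_mult_less_top)
  show "\<And>x. case_prod F x \<noteq> 0 \<Longrightarrow> x \<in> UNIV \<times> {- R..R}"
    using assms(3) by (fastforce simp: abs_le_iff)
qed (use assms in \<open>auto cong: measurable_cong_sets\<close>)

lemma fourier_bound:
  assumes "F \<in> borel_measurable borel" "\<And>x. norm (F x) \<le> B" "\<And>x. F x \<noteq> 0 \<Longrightarrow> \<bar>x\<bar> \<le> R"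
  shows "norm (fourier F \<xi>) \<le> (LINT x|lborel. norm (F x))"
proof -
  have "norm (fourier F \<xi>) \<le> (LINT x|lborel. norm (F x * cis (- \<xi> * x)))"
    unfolding fourier_def by (rule integral_norm_bound)
  then show ?thesis by (simp add: norm_mult)
qed

lemma fourier_measurable[measurable]:
  assumes [measurable]: "F \<in> borel_measurable borel"
  shows "fourier F \<in> borel_measurable borel"
proof -
  show ?thesis unfolding fourier_def by measurable
qed

text \<open>Gaussian averages of \<open>|fourier F|\<^sup>2\<close> turn into correlations of \<open>F\<close>, so that
  Plancherel comparisons need no inversion theorem.\<close>

lemma gauss_fourier_sq:
  assumes F[measurable]: "F \<in> borel_measurable borel" and B: "\<And>x. norm (F x) \<le> B" and R: "\<And>x. F x \<noteq> 0 \<Longrightarrow> \<bar>x\<bar> \<le> R"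
    and n: "n > 0"
  shows "complex_of_real (LINT \<xi>|gauss. (norm (fourier F (n * \<xi>)))\<^sup>2) =
     of_real (sqrt (2 * pi) / n) * (LINT x|lborel. LINT z|gauss. F x * cnj (F (x + z / n)))"
proof -
  define I where "I = (LINT x|lborel. norm (F x))"
  have ftb: "norm (fourier F \<xi>) \<le> I" for \<xi> unfolding I_def by (rule fourier_bound[OF F B R])
  have B0: "0 \<le> B" using B[of 0] norm_ge_zero[of "F 0"] by linarith
  \<comment> \<open>Integrating the characters in \<xi> leaves a Gaussian in \<open>y - x\<close> of
    width \<open>1 / n\<close>. The substitution \<open>y = x + z / n\<close> turns it back into an
    average over the normal law; the Jacobian and the missing normalization of the density combine
    to \<open>sqrt (2 * pi) / n\<close>.\<close>
  have inner: "(LINT \<xi>|gauss. cis (- n * \<xi> * x) * cnj (fourier F (n * \<xi>))) =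
      of_real (sqrt (2 * pi) / n) * (LINT z|gauss. cnj (F (x + z / n)))" for x
  proof -
    have "cis (- n * \<xi> * x) * cnj (fourier F (n * \<xi>)) = (LINT y|lborel. cnj (F y) * cis (n * (y - x) * \<xi>))" for \<xi>
    proof -
      have "cnj (fourier F (n * \<xi>)) = (LINT y|lborel. cnj (F y * cis (- (n * \<xi>) * y)))"
        unfolding fourier_def by (rule Bochner_Integration.integral_cnj[symmetric])
      also have "cis (- n * \<xi> * x) * \<dots> = (LINT y|lborel. cis (- n * \<xi> * x) * cnj (F y * cis (- (n * \<xi>) * y)))"
        by (rule integral_mult_right_zero[symmetric])
      also have "\<dots> = (LINT y|lborel. cnj (F y) * cis (n * (y - x) * \<xi>))"
        by (intro Bochner_Integration.integral_cong refl)
          (simp add: cis_cnj cis_mult mult.left_commute[of "cis _" "cnj _"] , simp add: algebra_simps)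
      finally show ?thesis .
    qed
    then have "(LINT \<xi>|gauss. cis (- n * \<xi> * x) * cnj (fourier F (n * \<xi>))) =
       (LINT \<xi>|gauss. LINT y|lborel. cnj (F y) * cis (n * (y - x) * \<xi>))" by simp
    also have "\<dots> = (LINT y|lborel. LINT \<xi>|gauss. cnj (F y) * cis (n * (y - x) * \<xi>))"
      by (rule GL.Fubini_integral[symmetric], rule integrable_gauss_pair_bounded_supp[of _ B R])
        (use B R in \<open>auto simp: norm_mult\<close>)
    also have "\<dots> = (LINT y|lborel. cnj (F y) * complex_of_real (exp (- ((n * (y - x))^2) / 2)))"
      by (simp add: gauss_cis)
    also have "\<dots> = \<bar>1/n\<bar> *\<^sub>R (LINT z|lborel. cnj (F (x + (1/n) * z)) * complex_of_real (exp (- ((n * (x + (1/n)*z - x))^2) / 2)))"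
      by (rule lborel_integral_real_affine) (use n in auto)
    also have "\<dots> = \<bar>1/n\<bar> *\<^sub>R (LINT z|lborel. sqrt (2*pi) * (std_normal_density z * cnj (F (x + z/n))))"
      using n by (intro arg_cong2[where f=scaleR] refl Bochner_Integration.integral_cong) (auto simp: std_normal_density_def)
    also have "\<dots> = of_real (sqrt (2 * pi) / n) * (LINT z|gauss. cnj (F (x + z / n)))"
      using n by (subst integral_gauss) (auto simp: scaleR_conv_of_real)
    finally show ?thesis .
  qed
  have "complex_of_real (LINT \<xi>|gauss. (norm (fourier F (n * \<xi>)))\<^sup>2) = (LINT \<xi>|gauss. of_real ((norm (fourier F (n * \<xi>)))\<^sup>2))"
    by (rule integral_complex_of_real[symmetric])
  also have "\<dots> = (LINT \<xi>|gauss. LINT x|lborel. F x * (cis (- n * \<xi> * x) * cnj (fourier F (n * \<xi>))))"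
  proof (intro Bochner_Integration.integral_cong refl)
    fix \<xi>
    have "complex_of_real ((norm (fourier F (n * \<xi>)))\<^sup>2) = fourier F (n * \<xi>) * cnj (fourier F (n * \<xi>))"
      by (rule complex_norm_square)
    also have "\<dots> = (LINT x|lborel. F x * cis (- (n * \<xi>) * x) * cnj (fourier F (n * \<xi>)))"
      unfolding fourier_def[of F "n * \<xi>"] by (rule integral_mult_left_zero[symmetric])
    finally show "complex_of_real ((norm (fourier F (n * \<xi>)))\<^sup>2) = (LINT x|lborel. F x * (cis (- n * \<xi> * x) * cnj (fourier F (n * \<xi>))))"
      by (simp add: mult.assoc)
  qed
  also have "\<dots> = (LINT x|lborel. LINT \<xi>|gauss. F x * (cis (- n * \<xi> * x) * cnj (fourier F (n * \<xi>))))"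
  proof (rule GL.Fubini_integral[symmetric], rule integrable_gauss_pair_bounded_supp[of _ "B * I" R])
    show "norm (F y * (cis (- n * \<xi> * y) * cnj (fourier F (n * \<xi>)))) \<le> B * I" for \<xi> y
      unfolding norm_mult using B[of y] ftb[of "n*\<xi>"] B0 by (auto intro!: mult_mono)
  qed (use R in auto)
  also have "\<dots> = (LINT x|lborel. F x * (of_real (sqrt (2 * pi) / n) * (LINT z|gauss. cnj (F (x + z / n)))))"
    by (simp only: integral_mult_right_zero inner)
  also have "\<dots> = of_real (sqrt (2 * pi) / n) * (LINT x|lborel. LINT z|gauss. F x * cnj (F (x + z / n)))"
    by (simp only: integral_mult_right_zero mult.left_commute[of "F _" "of_real _"])
  finally show ?thesis .
qed

text \<open>For each fixed shift the correlation is at most the squared norm, by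
  \<open>2 a b \<le> a\<^sup>2 + b\<^sup>2\<close> and translation invariance, and averaging over a
  probability measure keeps this. The bound is uniform in \<open>n\<close>, so no limit has to be
  taken for the dominating function.\<close>

lemma gauss_corr_bound:
  assumes F[measurable]: "F \<in> borel_measurable borel" and B: "\<And>x. norm (F x) \<le> B" and R: "\<And>x. F x \<noteq> 0 \<Longrightarrow> \<bar>x\<bar> \<le> R"
  shows "norm (LINT x|lborel. LINT z|gauss. F x * cnj (F (x + z / n))) \<le> (LINT x|lborel. (norm (F x))\<^sup>2)"
proof -
  have B0: "0 \<le> B" using B[of 0] norm_ge_zero[of "F 0"] by linarith
  have sq: "(norm (F x))\<^sup>2 \<le> B\<^sup>2" for x using B[of x] by (simp add: power_mono)
  have i1: "integrable (gauss \<Otimes>\<^sub>M lborel) (\<lambda>(z,x). F x * cnj (F (x + z / n)))"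
    by (rule integrable_gauss_pair_bounded_supp[of _ "B*B" R])
       (use B R B0 in \<open>auto simp: norm_mult intro!: mult_mono\<close>)
  have Fs: "integrable lborel (\<lambda>x. (norm (F x))\<^sup>2)"
    by (rule integrable_lborel_bounded_supp[of _ "B\<^sup>2" R]) (use R sq in auto)
  have "(LINT x|lborel. LINT z|gauss. F x * cnj (F (x + z / n))) = (LINT z|gauss. LINT x|lborel. F x * cnj (F (x + z / n)))"
    by (rule GL.Fubini_integral[OF i1])
  also have "norm \<dots> \<le> (LINT z|gauss. (LINT x|lborel. (norm (F x))\<^sup>2))"
  proof (rule Bochner_Integration.integral_norm_bound_integral[where f="\<lambda>z. LINT x|lborel. F x * cnj (F (x + z / n))" and g="\<lambda>z. LINT x|lborel. (norm (F x))\<^sup>2"])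
    show "integrable gauss (\<lambda>z. LINT x|lborel. F x * cnj (F (x + z / n)))"
      using GL.integrable_fst[OF i1] by simp
    show "norm (LINT x|lborel. F x * cnj (F (x + z / n))) \<le> (LINT x|lborel. (norm (F x))\<^sup>2)" for z
    proof -
      have i2: "integrable lborel (\<lambda>x. (norm (F (x + z / n)))\<^sup>2)"
        using lborel_integrable_real_affine[OF Fs, of 1 "z/n"] by (simp add: add.commute)
      have e2: "(LINT x|lborel. (norm (F (x + z / n)))\<^sup>2) = (LINT x|lborel. (norm (F x))\<^sup>2)"
        using lborel_integral_real_affine[of 1 "\<lambda>x. (norm (F x))\<^sup>2" "z/n"] by (simp add: add.commute)
      have "norm (LINT x|lborel. F x * cnj (F (x + z / n))) \<le> (LINT x|lborel. ((norm (F x))\<^sup>2 + (norm (F (x + z / n)))\<^sup>2) / 2)"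
      proof (rule Bochner_Integration.integral_norm_bound_integral)
        show "integrable lborel (\<lambda>x. F x * cnj (F (x + z / n)))"
          by (rule integrable_lborel_bounded_supp[of _ "B*B" R])
             (use B R B0 in \<open>auto simp: norm_mult intro!: mult_mono\<close>)
        show "norm (F x * cnj (F (x + z / n))) \<le> ((norm (F x))\<^sup>2 + (norm (F (x + z / n)))\<^sup>2) / 2" for x
          using sum_squares_bound[of "norm (F x)" "norm (F (x+z/n))"] by (simp add: norm_mult)
      qed (use Fs i2 in auto)
      also have "\<dots> = (LINT x|lborel. (norm (F x))\<^sup>2)"
        using Fs i2 e2 by simp
      finally show ?thesis .
    qed
  qed auto
  also have "\<dots> = (LINT x|lborel. (norm (F x))\<^sup>2)" using gauss.prob_space by simp
  finally show ?thesis .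
qed

text \<open>As the shift \<open>z / n\<close> shrinks, continuity makes the correlation collapse to
  the squared norm. Dominated convergence is applied first in \<open>z\<close> and then in
  \<open>x\<close>, both times with the majorant \<open>norm (F x) * B\<close>.\<close>

lemma gauss_corr_tendsto:
  assumes F: "continuous_on UNIV F" and B: "\<And>x. norm (F x) \<le> B" and R: "\<And>x. F x \<noteq> 0 \<Longrightarrow> \<bar>x\<bar> \<le> R"
  shows "(\<lambda>k. LINT x|lborel. LINT z|gauss. F x * cnj (F (x + z / real (Suc k))))
    \<longlonglongrightarrow> complex_of_real (LINT x|lborel. (norm (F x))\<^sup>2)"
proof -
  have [measurable]: "F \<in> borel_measurable borel" by (rule borel_measurable_continuous_onI[OF F])
  have B0: "0 \<le> B" using B[of 0] norm_ge_zero[of "F 0"] by linarith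
  have bd: "norm (F x * cnj (F y)) \<le> norm (F x) * B" for x y
    using B by (simp add: norm_mult mult_left_mono)
  have Fi: "integrable lborel (\<lambda>x. norm (F x) * B)"
    by (rule integrable_lborel_bounded_supp[of _ "B*B" R]) (use B R B0 in \<open>auto simp: abs_mult intro!: mult_right_mono\<close>)
  have "(\<lambda>k. LINT x|lborel. LINT z|gauss. F x * cnj (F (x + z / real (Suc k))))
    \<longlonglongrightarrow> (LINT x|lborel. F x * cnj (F x))"
  proof (rule integral_dominated_convergence[where w="\<lambda>x. norm (F x) * B"])
    show "AE x in lborel. (\<lambda>k. LINT z|gauss. F x * cnj (F (x + z / real (Suc k)))) \<longlonglongrightarrow> F x * cnj (F x)"
    proof (rule AE_I2)
      fix x
      have "(\<lambda>k. LINT z|gauss. F x * cnj (F (x + z / real (Suc k)))) \<longlonglongrightarrow> (LINT z|gauss. F x * cnj (F x))"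
      proof (rule integral_dominated_convergence[where w="\<lambda>z. norm (F x) * B"])
        show "AE z in gauss. (\<lambda>k. F x * cnj (F (x + z / real (Suc k)))) \<longlonglongrightarrow> F x * cnj (F x)"
        proof (rule AE_I2)
          fix z
          have "(\<lambda>k. x + z * (1 / real (Suc k))) \<longlonglongrightarrow> x + z * 0"
            by (intro tendsto_intros LIMSEQ_Suc[OF lim_1_over_n])
          then have "(\<lambda>k. x + z / real (Suc k)) \<longlonglongrightarrow> x" by simp
          then have "(\<lambda>k. F (x + z / real (Suc k))) \<longlonglongrightarrow> F x"
            using continuous_on_tendsto_compose[OF F] by (simp add: comp_def)
          then show "(\<lambda>k. F x * cnj (F (x + z / real (Suc k)))) \<longlonglongrightarrow> F x * cnj (F x)"
            by (intro tendsto_intros)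
        qed
      qed (use bd in auto)
      then show "(\<lambda>k. LINT z|gauss. F x * cnj (F (x + z / real (Suc k)))) \<longlonglongrightarrow> F x * cnj (F x)"
        using gauss.prob_space by simp
    qed
    show "AE x in lborel. norm (LINT z|gauss. F x * cnj (F (x + z / real (Suc k)))) \<le> norm (F x) * B" for k
    proof (rule AE_I2)
      fix x
      have "norm (LINT z|gauss. F x * cnj (F (x + z / real (Suc k)))) \<le> (LINT z|gauss. norm (F x) * B)"
        by (rule Bochner_Integration.integral_norm_bound_integral) (use bd in \<open>auto intro!: gauss.integrable_const_bound[where B="norm (F x) * B"]\<close>)
      then show "norm (LINT z|gauss. F x * cnj (F (x + z / real (Suc k)))) \<le> norm (F x) * B"
        using gauss.prob_space by simp
    qed
  qed (use Fi in auto)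
  also have "(LINT x|lborel. F x * cnj (F x)) = complex_of_real (LINT x|lborel. (norm (F x))\<^sup>2)"
    by (subst integral_complex_of_real[symmetric]) (simp add: complex_norm_square[symmetric])
  finally show ?thesis .
qed

text \<open>The pointwise inequality between the transforms survives Gaussian averaging at every
  dilation \<open>n\<close>. Both averages turn into correlations with the same positive factor,
  which cancels; then \<open>n\<close> tends to infinity on the side of \<open>F\<close>, while the
  side of \<open>G\<close> is bounded for each \<open>n\<close>.\<close>

lemma plancherel_dom_continuous:
  assumes F: "continuous_on UNIV F" and BF: "\<And>x. norm (F x) \<le> B" and RF: "\<And>x. F x \<noteq> 0 \<Longrightarrow> \<bar>x\<bar> \<le> R"
    and G[measurable]: "G \<in> borel_measurable borel" and BG: "\<And>x. norm (G x) \<le> B'" and RG: "\<And>x. G x \<noteq> 0 \<Longrightarrow> \<bar>x\<bar> \<le> R'"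
    and M: "\<And>\<xi>. norm (fourier F \<xi>) \<le> M * norm (fourier G \<xi>)"
  shows "(LINT x|lborel. (norm (F x))\<^sup>2) \<le> M\<^sup>2 * (LINT x|lborel. (norm (G x))\<^sup>2)"
proof -
  have Fm[measurable]: "F \<in> borel_measurable borel" by (rule borel_measurable_continuous_onI[OF F])
  define PF where "PF n = (LINT x|lborel. LINT z|gauss. F x * cnj (F (x + z / n)))" for n
  define PG where "PG n = (LINT x|lborel. LINT z|gauss. G x * cnj (G (x + z / n)))" for n
  have "Re (PF n) \<le> M\<^sup>2 * (LINT x|lborel. (norm (G x))\<^sup>2)" if n: "n > 0" for n
  proof -
    define c where "c = sqrt (2*pi) / n"
    have c: "c > 0" using n by (simp add: c_def)
    have eF: "(LINT \<xi>|gauss. (norm (fourier F (n * \<xi>)))\<^sup>2) = c * Re (PF n)"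
      using arg_cong[OF gauss_fourier_sq[OF Fm BF RF n], of Re] unfolding PF_def[symmetric] c_def[symmetric] by simp
    have eG: "(LINT \<xi>|gauss. (norm (fourier G (n * \<xi>)))\<^sup>2) = c * Re (PG n)"
      using arg_cong[OF gauss_fourier_sq[OF G BG RG n], of Re] unfolding PG_def[symmetric] c_def[symmetric] by simp
    have int: "integrable gauss (\<lambda>\<xi>. (norm (fourier H (n * \<xi>)))\<^sup>2)"
      if [measurable]: "H \<in> borel_measurable borel" and b: "\<And>x. norm (H x) \<le> b" "\<And>x. H x \<noteq> 0 \<Longrightarrow> \<bar>x\<bar> \<le> r" for H b r
      using fourier_bound[OF that] by (intro gauss.integrable_const_bound[where B="(LINT x|lborel. norm (H x))\<^sup>2"]) (auto intro!: power_mono)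
    have "c * Re (PF n) \<le> (LINT \<xi>|gauss. M\<^sup>2 * (norm (fourier G (n * \<xi>)))\<^sup>2)"
      unfolding eF[symmetric]
    proof (rule integral_mono)
      show "(norm (fourier F (n * \<xi>)))\<^sup>2 \<le> M\<^sup>2 * (norm (fourier G (n * \<xi>)))\<^sup>2" for \<xi>
        using power_mono[OF M[of "n*\<xi>"], of 2] by (simp add: power_mult_distrib)
    qed (use int[OF Fm BF RF] int[OF G BG RG] in auto)
    also have "\<dots> = c * (M\<^sup>2 * Re (PG n))" using eG by simp
    finally have "Re (PF n) \<le> M\<^sup>2 * Re (PG n)" using c by simp
    also have "\<dots> \<le> M\<^sup>2 * norm (PG n)" by (intro mult_left_mono complex_Re_le_cmod) auto
    also have "\<dots> \<le> M\<^sup>2 * (LINT x|lborel. (norm (G x))\<^sup>2)"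
      unfolding PG_def by (intro mult_left_mono gauss_corr_bound[OF G BG RG]) auto
    finally show ?thesis .
  qed
  then have "Re (PF (real (Suc k))) \<le> M\<^sup>2 * (LINT x|lborel. (norm (G x))\<^sup>2)" for k by simp
  moreover have "(\<lambda>k. Re (PF (real (Suc k)))) \<longlonglongrightarrow> (LINT x|lborel. (norm (F x))\<^sup>2)"
    using tendsto_Re[OF gauss_corr_tendsto[OF F BF RF]] unfolding PF_def by simp
  ultimately show ?thesis by (intro LIMSEQ_le_const2) auto
qed

section \<open>From continuous to measurable functions\<close>

definition avg :: "(real \<Rightarrow> complex) \<Rightarrow> real \<Rightarrow> real \<Rightarrow> complex" where
  "avg F h x = (LINT r|lborel. of_real (indicator {0..h} r / h) * F (x + r))"

text \<open>A translation by \<open>r\<close> multiplies the transform by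
  \<open>cis (\<xi> * r)\<close>, so averaging over translations multiplies it by a number of
  modulus at most 1 and preserves any domination of transforms. The last clause is the form in which
  the Lebesgue differentiation theorem applies.\<close>

lemma avg_props:
  assumes F[measurable]: "F \<in> borel_measurable borel" and B: "\<And>x. norm (F x) \<le> B" and R: "\<And>x. F x \<noteq> 0 \<Longrightarrow> \<bar>x\<bar> \<le> R"
    and h: "h > 0"
  shows "continuous_on UNIV (avg F h)" "norm (avg F h x) \<le> B" "avg F h x \<noteq> 0 \<Longrightarrow> \<bar>x\<bar> \<le> R + h"
    "norm (fourier (avg F h) \<xi>) \<le> norm (fourier F \<xi>)" "avg F h x = integral {x..x+h} F /\<^sub>R h"
proof -
  have B0: "0 \<le> B" using B[of 0] norm_ge_zero[of "F 0"] by linarith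
  have Fi: "integrable lborel F" by (rule integrable_lborel_bounded_supp[OF F B R])
  have Fs: "integrable lborel (\<lambda>y. indicator {a..b} y *\<^sub>R F y)" for a b
    using Fi by (rule integrable_mult_indicator[rotated]) auto
  have avg2: "avg F h x = (1/h) *\<^sub>R (LINT y|lborel. indicator {x..x+h} y *\<^sub>R F y)" for x
  proof -
    have "avg F h x = (LINT r|lborel. (1/h) *\<^sub>R (indicator {x..x+h} (x+r) *\<^sub>R F (x + r)))"
      unfolding avg_def by (intro Bochner_Integration.integral_cong) (auto simp: indicator_def scaleR_conv_of_real)
    also have "\<dots> = (1/h) *\<^sub>R (LINT r|lborel. indicator {x..x+h} (x+1*r) *\<^sub>R F (x + 1*r))"
      by (simp only: Bochner_Integration.integral_scaleR_right mult_1_left)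
    also have "(LINT r|lborel. indicator {x..x+h} (x+1*r) *\<^sub>R F (x + 1*r)) = (LINT y|lborel. indicator {x..x+h} y *\<^sub>R F y)"
      using lborel_integral_real_affine[of 1 "\<lambda>y. indicator {x..x+h} y *\<^sub>R F y" x] by simp
    finally show ?thesis .
  qed
  show eq: "avg F h x = integral {x..x+h} F /\<^sub>R h" for x
    using set_borel_integral_eq_integral(2)[of "{x..x+h}" F] Fs[of x "x+h"]
    by (simp add: avg2 set_lebesgue_integral_def set_integrable_def divide_inverse_commute)
  have ii: "F integrable_on {a..b}" for a b
    using set_borel_integral_eq_integral(1)[of "{a..b}" F] Fs[of a b] by (simp add: set_integrable_def)
  \<comment> \<open>Sliding the window from \<open>x\<close> to \<open>y\<close> changes the
    integral only by two end pieces of length \<open>y - x\<close>.\<close>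
  have lip: "norm (avg F h x - avg F h y) \<le> 2 * B / h * \<bar>x - y\<bar>" if "x \<le> y" for x y
  proof -
    have ib: "norm (integral {a..b} F) \<le> B * (b - a)" if "a \<le> b" for a b
      using Henstock_Kurzweil_Integration.integral_norm_bound_integral[OF ii[of a b], of "\<lambda>_. B"] B that integrable_const_ivl[of B a b] by (simp add: mult.commute)
    define m where "m = max y (x + h)"
    have "integral {x..y} F + integral {y..y+h} F = integral {x..y+h} F"
      by (rule Henstock_Kurzweil_Integration.integral_combine) (use that h ii in auto)
    moreover have "integral {x..x+h} F + integral {x+h..y+h} F = integral {x..y+h} F"
      by (rule Henstock_Kurzweil_Integration.integral_combine) (use that h ii in auto)
    ultimately have "integral {x..x+h} F - integral {y..y+h} F = integral {x..y} F - integral {x+h..y+h} F"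
      by (simp add: algebra_simps)
    then have "norm (integral {x..x+h} F - integral {y..y+h} F) \<le> norm (integral {x..y} F) + norm (integral {x+h..y+h} F)"
      by (metis norm_triangle_ineq4)
    also have "\<dots> \<le> 2 * B * (y - x)"
      using ib[of x y] ib[of "x+h" "y+h"] that by (simp add: algebra_simps)
    finally show ?thesis using h that
      by (simp add: eq scaleR_diff_right[symmetric] divide_simps abs_if split: if_splits)
  qed
  have "(2 * B / h)-lipschitz_on UNIV (avg F h)"
  proof (rule lipschitz_onI)
    show "dist (avg F h x) (avg F h y) \<le> 2 * B / h * dist x y" for x y
      using lip[of x y] lip[of y x] by (cases "x \<le> y") (auto simp: dist_norm norm_minus_commute abs_minus_commute)
  qed (use B0 h in auto)
  then show cont: "continuous_on UNIV (avg F h)" by (rule lipschitz_on_continuous_on)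
  have ind1: "(LINT r|lborel. indicator {0..h} r / h) = (1::real)" using h by simp
  have indi: "integrable lborel (\<lambda>r. indicator {0..h} r / h :: real)"
    by (rule integrable_lborel_bounded_supp[of _ "1/h" h]) (use h in \<open>auto simp: indicator_def split: if_splits\<close>)
  have indiB: "integrable lborel (\<lambda>r. indicator {0..h} r / h * c)" for c :: real
    by (rule integrable_mult_left) (rule indi)
  show "norm (avg F h x) \<le> B" for x
  proof -
    have "norm (avg F h x) \<le> (LINT r|lborel. indicator {0..h} r / h * B)"
      unfolding avg_def
    proof (rule Bochner_Integration.integral_norm_bound_integral)
      show "integrable lborel (\<lambda>r. complex_of_real (indicator {0..h} r / h) * F (x + r))"
        by (rule integrable_lborel_bounded_supp[of _ "1/h*B" h])
          (use h B B0 in \<open>auto simp: norm_mult norm_divide indicator_def intro!: divide_right_mono split: if_splits\<close>)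
    next
      show "integrable lborel (\<lambda>r. indicator {0..h} r / h * B)" by (rule indiB)
    qed (use B h in \<open>auto simp: norm_mult norm_divide indicator_def divide_simps\<close>)
    also have "\<dots> = B" by (simp only: integral_mult_left_zero ind1 mult_1_left)
    finally show ?thesis .
  qed
  show "avg F h x \<noteq> 0 \<Longrightarrow> \<bar>x\<bar> \<le> R + h" for x
  proof (rule ccontr)
    assume a: "avg F h x \<noteq> 0" "\<not> \<bar>x\<bar> \<le> R + h"
    then have z: "complex_of_real (indicator {0..h} r / h) * F (x + r) = 0" for r
      using R[of "x+r"] h by (cases "F (x+r) = 0"; cases "r \<in> {0..h}") (auto simp: indicator_def)
    have "avg F h x = (LINT (r::real)|lborel. 0)" unfolding avg_def by (simp only: z)
    then show False using a by simp
  qed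
  show "norm (fourier (avg F h) \<xi>) \<le> norm (fourier F \<xi>)"
  proof -
    have "fourier (avg F h) \<xi> = (LINT x|lborel. LINT r|lborel. of_real (indicator {0..h} r / h) * F (x + r) * cis (-\<xi> * x))"
      unfolding fourier_def avg_def by (simp only: integral_mult_left_zero)
    also have "\<dots> = (LINT r|lborel. LINT x|lborel. of_real (indicator {0..h} r / h) * F (x + r) * cis (-\<xi> * x))"
      by (rule swap_bounded_supp[of _ "1/h * B" "\<bar>R\<bar>+h"])
        (use h B B0 R in \<open>force simp: norm_mult norm_divide indicator_def intro!: divide_right_mono split: if_splits\<close>)+
    also have "\<dots> = (LINT r|lborel. of_real (indicator {0..h} r / h) * (cis (\<xi> * r) * fourier F \<xi>))"
    proof (intro Bochner_Integration.integral_cong refl)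
      fix r
      have "(LINT x|lborel. F (x + r) * cis (-\<xi> * x)) = (LINT x|lborel. F (-r + 1 * x + r) * cis (-\<xi> * (-r + 1 * x)))"
        using lborel_integral_real_affine[of 1 "\<lambda>x. F (x + r) * cis (-\<xi> * x)" "-r"] by simp
      also have "\<dots> = (LINT x|lborel. cis (\<xi> * r) * (F x * cis (- \<xi> * x)))"
        by (intro Bochner_Integration.integral_cong) (auto simp: cis_mult algebra_simps)
      also have "\<dots> = cis (\<xi> * r) * fourier F \<xi>" unfolding fourier_def by simp
      finally show "(LINT x|lborel. of_real (indicator {0..h} r / h) * F (x + r) * cis (-\<xi> * x)) =
         of_real (indicator {0..h} r / h) * (cis (\<xi> * r) * fourier F \<xi>)"
        by (simp only: mult.assoc integral_mult_right_zero)
    qed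
    also have "norm \<dots> \<le> (LINT r|lborel. indicator {0..h} r / h * norm (fourier F \<xi>))"
    proof (rule Bochner_Integration.integral_norm_bound_integral)
      show "integrable lborel (\<lambda>r. complex_of_real (indicator {0..h} r / h) * (cis (\<xi> * r) * fourier F \<xi>))"
        by (rule integrable_lborel_bounded_supp[of _ "1/h*norm (fourier F \<xi>)" h])
          (use h in \<open>auto simp: norm_mult norm_divide indicator_def intro!: divide_right_mono split: if_splits\<close>)
    next
      show "integrable lborel (\<lambda>r. indicator {0..h} r / h * norm (fourier F \<xi>))" by (rule indiB)
    qed (use h in \<open>auto simp: norm_mult norm_divide indicator_def divide_simps\<close>)
    also have "\<dots> = norm (fourier F \<xi>)" by (simp only: integral_mult_left_zero ind1 mult_1_left)
    finally show ?thesis .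
  qed
qed

text \<open>The averages of \<open>F\<close> satisfy the continuous version with the same
  \<open>M\<close>. By Lebesgue differentiation they converge to \<open>F\<close> almost everywhere
  as the window shrinks, and boundedness with common bounded support gives convergence of the
  squared norms.\<close>

lemma plancherel_dom:
  assumes F[measurable]: "F \<in> borel_measurable borel" and BF: "\<And>x. norm (F x) \<le> B" and RF: "\<And>x. F x \<noteq> 0 \<Longrightarrow> \<bar>x\<bar> \<le> R"
    and G[measurable]: "G \<in> borel_measurable borel" and BG: "\<And>x. norm (G x) \<le> B'" and RG: "\<And>x. G x \<noteq> 0 \<Longrightarrow> \<bar>x\<bar> \<le> R'"
    and M: "\<And>\<xi>. norm (fourier F \<xi>) \<le> M * norm (fourier G \<xi>)"
  shows "(LINT x|lborel. (norm (F x))\<^sup>2) \<le> M\<^sup>2 * (LINT x|lborel. (norm (G x))\<^sup>2)"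
proof -
  define h where "h k = 1 / real (Suc k)" for k
  have h: "h k > 0" "h k \<le> 1" for k by (auto simp: h_def)
  note av = avg_props[OF F BF RF h(1)]
  have [measurable]: "avg F (h k) \<in> borel_measurable borel" for k
    by (rule borel_measurable_continuous_onI[OF av(1)])
  have Fi: "integrable lborel F" by (rule integrable_lborel_bounded_supp[OF F BF RF])
  have ii: "F integrable_on cbox a b" for a b
    using integrable_on_lborel[OF Fi] integrable_on_subcbox[of F UNIV a b] by auto
  obtain N where N: "negligible N" and lim: "\<And>x e. \<lbrakk>x \<notin> N; 0 < e\<rbrakk> \<Longrightarrow>
      \<exists>d>0. \<forall>h. 0 < h \<and> h < d \<longrightarrow> norm(integral (cbox x (x + h *\<^sub>R One)) F /\<^sub>R h ^ DIM(real) - F x) < e"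
    using integrable_ccontinuous_explicit[OF ii] by (metis (no_types, lifting))
  have "AE x in lebesgue. x \<notin> N"
    using N by (simp add: negligible_iff_null_sets AE_not_in)
  then have AEN: "AE x in lborel. x \<notin> N" by (simp add: AE_completion_iff)
  have conv: "(\<lambda>k. avg F (h k) x) \<longlonglongrightarrow> F x" if xN: "x \<notin> N" for x
  proof (rule LIMSEQ_I)
    fix e :: real assume "0 < e"
    then obtain d where d: "d > 0" "\<And>h. 0 < h \<Longrightarrow> h < d \<Longrightarrow> norm (avg F h x - F x) < e"

    proof -
      assume *: "\<And>d. d > 0 \<Longrightarrow> (\<And>h. 0 < h \<Longrightarrow> h < d \<Longrightarrow> norm (avg F h x - F x) < e) \<Longrightarrow> thesis"
      obtain d where "d > 0" and d: "\<And>h. 0 < h \<Longrightarrow> h < d \<Longrightarrow> norm(integral (cbox x (x + h *\<^sub>R One)) F /\<^sub>R h ^ DIM(real) - F x) < e"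
        using lim[of x e] xN \<open>0 < e\<close> by blast
      show thesis by (rule *[OF \<open>d > 0\<close>]) (use d avg_props(5)[OF F BF RF, of _ x] in simp)
    qed
    obtain k0 where k0: "inverse (real (Suc k0)) < d" using reals_Archimedean[OF d(1)] by blast
    have "norm (avg F (h k) x - F x) < e" if "k \<ge> k0" for k
    proof (rule d(2)[OF h(1)])
      have "h k \<le> inverse (real (Suc k0))" using that by (simp add: h_def divide_simps)
      then show "h k < d" using k0 by simp
    qed
    then show "\<exists>no. \<forall>n\<ge>no. norm (avg F (h n) x - F x) < e" by blast
  qed
  have "(\<lambda>k. LINT x|lborel. (norm (avg F (h k) x))\<^sup>2) \<longlonglongrightarrow> (LINT x|lborel. (norm (F x))\<^sup>2)"
  proof (rule integral_dominated_convergence[where w="\<lambda>x. indicator {-(\<bar>R\<bar>+1)..\<bar>R\<bar>+1} x * B\<^sup>2"])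
    show "AE x in lborel. (\<lambda>k. (norm (avg F (h k) x))\<^sup>2) \<longlonglongrightarrow> (norm (F x))\<^sup>2"
      using AEN by eventually_elim (intro tendsto_intros conv)
    show "AE x in lborel. norm ((norm (avg F (h k) x))\<^sup>2) \<le> indicator {-(\<bar>R\<bar>+1)..\<bar>R\<bar>+1} x * B\<^sup>2" for k
    proof (rule AE_I2)
      fix x show "norm ((norm (avg F (h k) x))\<^sup>2) \<le> indicator {-(\<bar>R\<bar>+1)..\<bar>R\<bar>+1} x * B\<^sup>2"
      proof (cases "avg F (h k) x = 0")
        case False
        then have "\<bar>x\<bar> \<le> \<bar>R\<bar> + 1" using av(3)[of k x] h(2)[of k] by linarith
        then show ?thesis using av(2)[of k x] by (auto simp: indicator_def intro!: power_mono)
      qed auto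
    qed
    show "integrable lborel (\<lambda>x. indicator {-(\<bar>R\<bar>+1)..\<bar>R\<bar>+1} x * B\<^sup>2)"
      by (rule integrable_lborel_bounded_supp[of _ "B\<^sup>2" "\<bar>R\<bar>+1"]) (auto simp: indicator_def split: if_splits)
  qed auto
  moreover have "(LINT x|lborel. (norm (avg F (h k) x))\<^sup>2) \<le> M\<^sup>2 * (LINT x|lborel. (norm (G x))\<^sup>2)" for k
    by (rule plancherel_dom_continuous[OF av(1) av(2) av(3) G BG RG]) (use av(4) M order_trans in blast)+
  ultimately show ?thesis by (intro LIMSEQ_le_const2) auto
qed

section \<open>Van der Corput estimate\<close>

text \<open>A bound over all subintervals is what the second mean value theorem consumes, and it
  returns a bound of the same kind. The estimate can therefore be iterated over several monotone
  factors.\<close>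

definition subintegrals_le :: "(real \<Rightarrow> real) \<Rightarrow> real \<Rightarrow> real \<Rightarrow> real \<Rightarrow> bool" where
  "subintegrals_le f a b Q \<longleftrightarrow> f integrable_on {a..b} \<and> (\<forall>c d. a \<le> c \<longrightarrow> c \<le> d \<longrightarrow> d \<le> b \<longrightarrow> \<bar>integral {c..d} f\<bar> \<le> Q)"

text \<open>The second mean value theorem cuts the interval at one point and replaces
  \<open>g\<close> by its two end values on the parts; each part contributes at most
  \<open>G * Q\<close>.\<close>

lemma subintegrals_le_mult_mono:
  assumes f: "subintegrals_le f a b Q" and ab: "a \<le> b"
    and g: "\<And>x y. a \<le> x \<Longrightarrow> x \<le> y \<Longrightarrow> y \<le> b \<Longrightarrow> g x \<le> g y"
    and G: "\<And>x. a \<le> x \<Longrightarrow> x \<le> b \<Longrightarrow> \<bar>g x\<bar> \<le> G"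
  shows "subintegrals_le (\<lambda>x. g x * f x) a b (2 * G * Q)"
proof -
  have fi: "f integrable_on {c..d}" if "a \<le> c" "d \<le> b" for c d
    using f that unfolding subintegrals_le_def by (metis atLeastatMost_subset_iff integrable_on_subinterval)
  have key: "(\<lambda>x. g x * f x) integrable_on {c..d} \<and> \<bar>integral {c..d} (\<lambda>x. g x * f x)\<bar> \<le> 2 * G * Q"
    if cd: "a \<le> c" "c \<le> d" "d \<le> b" for c d
  proof -
    have gm: "g x \<le> g y" if "c \<le> x" "x \<le> y" "y \<le> d" for x y
      using g[of x y] that cd by linarith
    obtain e where e: "e \<in> {c..d}" and
      i: "((\<lambda>x. g x * f x) has_integral (g c * integral {c..e} f + g d * integral {e..d} f)) {c..d}"
      by (rule second_mean_value_theorem_full[OF fi[OF cd(1,3)] cd(2) gm])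
    have q: "\<bar>integral {c..e} f\<bar> \<le> Q" "\<bar>integral {e..d} f\<bar> \<le> Q"
      using f e cd unfolding subintegrals_le_def by auto
    have "\<bar>g c * integral {c..e} f + g d * integral {e..d} f\<bar> \<le> \<bar>g c\<bar> * \<bar>integral {c..e} f\<bar> + \<bar>g d\<bar> * \<bar>integral {e..d} f\<bar>"
      by (metis abs_mult abs_triangle_ineq)
    also have "\<dots> \<le> G * Q + G * Q"
      using G[of c] G[of d] q cd by (intro add_mono mult_mono) auto
    finally show ?thesis using i by (auto simp: has_integral_integral integral_unique)
  qed
  then show ?thesis unfolding subintegrals_le_def using ab by blast
qed

lemma subintegrals_le_uminus: "subintegrals_le f a b Q \<Longrightarrow> subintegrals_le (\<lambda>x. - f x) a b Q"
  unfolding subintegrals_le_def by (simp add: integrable_neg)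

lemma subintegrals_le_mult_antimono:
  assumes f: "subintegrals_le f a b Q" and ab: "a \<le> b"
    and g: "\<And>x y. a \<le> x \<Longrightarrow> x \<le> y \<Longrightarrow> y \<le> b \<Longrightarrow> g y \<le> g x"
    and G: "\<And>x. a \<le> x \<Longrightarrow> x \<le> b \<Longrightarrow> \<bar>g x\<bar> \<le> G"
  shows "subintegrals_le (\<lambda>x. g x * f x) a b (2 * G * Q)"
  using subintegrals_le_uminus[OF subintegrals_le_mult_mono[OF f ab, of "\<lambda>x. - g x" G]] g G by simp

lemma subintegrals_le_cong: "subintegrals_le f a b Q \<Longrightarrow> (\<And>x. a \<le> x \<Longrightarrow> x \<le> b \<Longrightarrow> f x = g x) \<Longrightarrow> subintegrals_le g a b Q"
proof -
  assume f: "subintegrals_le f a b Q" and eq: "\<And>x. a \<le> x \<Longrightarrow> x \<le> b \<Longrightarrow> f x = g x"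
  have "integral {c..d} g = integral {c..d} f" if "a \<le> c" "d \<le> b" for c d
    by (rule Henstock_Kurzweil_Integration.integral_cong) (use that eq in auto)
  moreover have "f integrable_on {a..b} \<longleftrightarrow> g integrable_on {a..b}"
    by (rule integrable_cong) (use eq in auto)
  ultimately show "subintegrals_le g a b Q" using f unfolding subintegrals_le_def by auto
qed

text \<open>A neighbourhood of length \<open>2 sqrt (bm/\<mu>)\<close> of the point where \<open>R\<close> crosses \<open>\<xi>\<close> is estimated trivially.
  Elsewhere the integrand is the derivative of \<open>F\<close> times the monotone factors \<open>1/(R - \<xi>)\<close>, \<open>b\<close> and \<open>w\<close>,
  which three applications of the second mean value theorem remove.\<close>

lemma van_der_corput_real:
  fixes F f0 w a b Ed R :: "real \<Rightarrow> real"
  assumes ab: "\<alpha> \<le> \<beta>"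
    and dF: "\<And>t. \<alpha> \<le> t \<Longrightarrow> t \<le> \<beta> \<Longrightarrow> (F has_real_derivative Ed t * (R t - \<xi>) * f0 t) (at t within {\<alpha>..\<beta>})"
    and F1: "\<And>t. \<bar>F t\<bar> \<le> 1" and f1: "\<And>t. \<bar>f0 t\<bar> \<le> 1"
    and \<mu>: "\<mu> > 0" and R: "\<And>s t. \<alpha> \<le> s \<Longrightarrow> s \<le> t \<Longrightarrow> t \<le> \<beta> \<Longrightarrow> R s - R t \<ge> \<mu> * (t - s)"
    and b: "\<And>s t. \<alpha> \<le> s \<Longrightarrow> s \<le> t \<Longrightarrow> t \<le> \<beta> \<Longrightarrow> b s \<le> b t"
    and bm: "bm > 0" "\<And>t. \<alpha> \<le> t \<Longrightarrow> t \<le> \<beta> \<Longrightarrow> 0 \<le> b t \<and> b t \<le> bm"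
    and w: "\<And>s t. \<alpha> \<le> s \<Longrightarrow> s \<le> t \<Longrightarrow> t \<le> \<beta> \<Longrightarrow> w t \<le> w s"
    and wm: "\<And>t. \<alpha> \<le> t \<Longrightarrow> t \<le> \<beta> \<Longrightarrow> 0 \<le> w t \<and> w t \<le> wm"
    and a: "\<And>t. \<alpha> \<le> t \<Longrightarrow> t \<le> \<beta> \<Longrightarrow> a t = b t * Ed t" "\<And>t. \<alpha> \<le> t \<Longrightarrow> t \<le> \<beta> \<Longrightarrow> \<bar>a t\<bar> \<le> am"
    and int: "(\<lambda>t. w t * a t * f0 t) integrable_on {\<alpha>..\<beta>}"
  shows "\<bar>integral {\<alpha>..\<beta>} (\<lambda>t. w t * a t * f0 t)\<bar> \<le> (64 + 2 * am) * wm * sqrt (bm / \<mu>)"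
proof -
  define f where "f t = Ed t * (R t - \<xi>) * f0 t" for t
  define h where "h t = w t * a t * f0 t" for t
  \<comment> \<open>Within distance \<eta> of the crossing the trivial bound is of order
    \<open>am * wm * \<eta>\<close>; outside, the oscillation gives order
    \<open>bm * wm / (\<mu> * \<eta>)\<close>. Both depend on \<eta> alike when
    \<open>\<eta>\<^sup>2 = bm / \<mu>\<close>.\<close>
  define \<eta> where "\<eta> = sqrt (bm / \<mu>)"
  have \<eta>: "\<eta> > 0" "\<eta> * \<eta> = bm / \<mu>" using bm \<mu> by (auto simp: \<eta>_def)
  have wm0: "0 \<le> wm" and am0: "0 \<le> am" using wm[of \<alpha>] a(2)[of \<alpha>] ab by auto
  have osc_f: "subintegrals_le f c d 2" if cd: "\<alpha> \<le> c" "c \<le> d" "d \<le> \<beta>" for c d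
  proof -
    have hi: "(f has_integral (F y - F x)) {x..y}" if "c \<le> x" "x \<le> y" "y \<le> d" for x y
    proof (rule fundamental_theorem_of_calculus)
      show "(F has_vector_derivative f t) (at t within {x..y})" if "t \<in> {x..y}" for t
        unfolding has_real_derivative_iff_has_vector_derivative[symmetric] f_def
        by (rule has_field_derivative_subset[OF dF]) (use that cd \<open>c \<le> x\<close> \<open>y \<le> d\<close> in auto)
    qed fact
    have "\<bar>F y - F x\<bar> \<le> 2" for x y using F1[of x] F1[of y] by linarith
    then show ?thesis unfolding subintegrals_le_def using hi[of c d] integral_unique[OF hi] cd by (auto intro: has_integral_integrable)
  qed
  \<comment> \<open>On either side of the crossing \<open>1 / (R - \<xi>)\<close> is increasing and
    at most \<open>2 / (\<mu> * \<eta>)\<close> in modulus. The constant 32 consists of a factor 2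
    for each of the three monotone factors, the bound 2 for the integrals of \<open>f\<close>, and
    the 2 in that quotient.\<close>
  have piece: "\<bar>integral {c..d} h\<bar> \<le> 32 * bm * wm / (\<mu> * \<eta>)"
    if cd: "\<alpha> \<le> c" "c \<le> d" "d \<le> \<beta>"
      and far: "(\<forall>t. c \<le> t \<and> t \<le> d \<longrightarrow> R t - \<xi> \<ge> \<mu> * \<eta> / 2) \<or> (\<forall>t. c \<le> t \<and> t \<le> d \<longrightarrow> \<xi> - R t \<ge> \<mu> * \<eta> / 2)" for c d
  proof -
    define q where "q t = 1 / (R t - \<xi>)" for t
    have pos: "\<mu> * \<eta> / 2 > 0" using \<mu> \<eta>(1) by simp
    have Rm: "R t \<le> R s" if "c \<le> s" "s \<le> t" "t \<le> d" for s t
    proof -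
      have "0 \<le> \<mu> * (t - s)" using \<mu> that by simp
      then show ?thesis using R[of s t] that cd by linarith
    qed
    have q1: "\<bar>q t\<bar> \<le> 2 / (\<mu> * \<eta>)" if "c \<le> t" "t \<le> d" for t
    proof -
      have "R t - \<xi> \<ge> \<mu> * \<eta> / 2 \<or> \<xi> - R t \<ge> \<mu> * \<eta> / 2" using far that by blast
      then have "\<mu> * \<eta> / 2 \<le> \<bar>R t - \<xi>\<bar>" by linarith
      then have "1 / \<bar>R t - \<xi>\<bar> \<le> 1 / (\<mu> * \<eta> / 2)" using pos
        by (intro divide_left_mono mult_pos_pos) linarith+
      then show ?thesis by (simp add: q_def)
    qed
    have q2: "q s \<le> q t" if "c \<le> s" "s \<le> t" "t \<le> d" for s t
      using far
    proof
      assume "\<forall>t. c \<le> t \<and> t \<le> d \<longrightarrow> R t - \<xi> \<ge> \<mu> * \<eta> / 2"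
      then have "R s - \<xi> \<ge> \<mu> * \<eta> / 2" "R t - \<xi> \<ge> \<mu> * \<eta> / 2" using that by auto
      then have "R s - \<xi> > 0" "R t - \<xi> > 0" using pos by linarith+
      then show ?thesis using Rm[OF that] unfolding q_def by (intro divide_left_mono) auto
    next
      assume "\<forall>t. c \<le> t \<and> t \<le> d \<longrightarrow> \<xi> - R t \<ge> \<mu> * \<eta> / 2"
      then have "\<xi> - R s \<ge> \<mu> * \<eta> / 2" "\<xi> - R t \<ge> \<mu> * \<eta> / 2" using that by auto
      then have "R s - \<xi> < 0" "R t - \<xi> < 0" using pos by linarith+
      then show ?thesis using Rm[OF that] unfolding q_def by (intro divide_left_mono) (auto simp: mult_neg_neg)
    qed
    have "subintegrals_le (\<lambda>t. q t * f t) c d (2 * (2 / (\<mu> * \<eta>)) * 2)"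
      by (rule subintegrals_le_mult_mono[OF osc_f[OF cd] cd(2) q2 q1])
    then have "subintegrals_le (\<lambda>t. b t * (q t * f t)) c d (2 * bm * (2 * (2 / (\<mu> * \<eta>)) * 2))"
      by (rule subintegrals_le_mult_mono) (use cd b bm in auto)
    then have "subintegrals_le (\<lambda>t. w t * (b t * (q t * f t))) c d (2 * wm * (2 * bm * (2 * (2 / (\<mu> * \<eta>)) * 2)))"
      by (rule subintegrals_le_mult_antimono) (use cd w wm in auto)
    then have "subintegrals_le h c d (2 * wm * (2 * bm * (2 * (2 / (\<mu> * \<eta>)) * 2)))"
    proof (rule subintegrals_le_cong)
      fix t assume t: "c \<le> t" "t \<le> d"
      then have "R t - \<xi> \<ge> \<mu> * \<eta> / 2 \<or> \<xi> - R t \<ge> \<mu> * \<eta> / 2" using far by blast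
      then have "R t - \<xi> \<noteq> 0" using pos by linarith
      then have "q t * f t = Ed t * f0 t" by (simp add: q_def f_def)
      then show "w t * (b t * (q t * f t)) = h t" using a(1)[of t] t cd by (simp add: h_def)
    qed
    then have "\<bar>integral {c..d} h\<bar> \<le> 2 * wm * (2 * bm * (2 * (2 / (\<mu> * \<eta>)) * 2))"
      using cd unfolding subintegrals_le_def by blast
    also have "\<dots> = 32 * bm * wm / (\<mu> * \<eta>)" by simp
    finally show ?thesis .
  qed
  \<comment> \<open>\<open>R\<close> is decreasing but not assumed continuous, so the crossing is
    located by a supremum. Inserting \<alpha> keeps the set nonempty when \<open>R\<close> lies
    below \<xi> throughout.\<close>
  define A where "A = insert \<alpha> {t. \<alpha> \<le> t \<and> t \<le> \<beta> \<and> R t \<ge> \<xi>}"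
  define ts where "ts = Sup A"
  have bA: "bdd_above A" unfolding A_def using ab by (auto intro!: bdd_aboveI[of _ \<beta>])
  have tsA: "t \<le> ts" if "t \<in> A" for t unfolding ts_def using that bA by (rule cSup_upper)
  have ts: "\<alpha> \<le> ts" by (rule tsA) (simp add: A_def)
  have ts2: "ts \<le> \<beta>" unfolding ts_def by (rule cSup_least) (use ab in \<open>auto simp: A_def\<close>)
  note ts = ts ts2
  define l where "l = max \<alpha> (ts - \<eta>)"
  define r where "r = min \<beta> (ts + \<eta>)"
  have lr: "\<alpha> \<le> l" "l \<le> r" "r \<le> \<beta>" "r - l \<le> 2 * \<eta>" using ts \<eta>(1) by (auto simp: l_def r_def)
  have K0: "0 \<le> 32 * bm * wm / (\<mu> * \<eta>)" using bm(1) wm0 \<mu> \<eta>(1) by simp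
  have left: "\<bar>integral {\<alpha>..l} h\<bar> \<le> 32 * bm * wm / (\<mu> * \<eta>)"
  proof (cases "l = \<alpha>")
    case False
    then have l: "l = ts - \<eta>" by (auto simp: l_def)
    \<comment> \<open>The inequality \<open>R \<ge> \<xi>\<close> may fail at the supremum itself. A
      point of \<open>A\<close> within \<open>\<eta> / 2\<close> of it is used instead, which costs
      half of the distance and explains \<open>\<mu> * \<eta> / 2\<close>.\<close>
    obtain t1 where t1: "t1 \<in> A" "t1 > ts - \<eta> / 2"
      using less_cSupD[of A "ts - \<eta>/2"] \<eta>(1) unfolding ts_def[symmetric] by (auto simp: A_def)
    have t1': "\<alpha> \<le> t1" "t1 \<le> \<beta>" "R t1 \<ge> \<xi>" using t1 l lr(1) False \<eta>(1) by (auto simp: A_def)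
    show ?thesis
    proof (rule piece)
      have "R t - \<xi> \<ge> \<mu> * \<eta> / 2" if "\<alpha> \<le> t" "t \<le> l" for t
      proof -
        have "\<eta> / 2 \<le> t1 - t" "t \<le> t1" using t1 that l \<eta>(1) by linarith+
        then have "\<mu> * (\<eta> / 2) \<le> \<mu> * (t1 - t)" using \<mu> by (intro mult_left_mono) auto
        then show ?thesis using R[of t t1] that \<open>t \<le> t1\<close> t1' by simp
      qed
      then show "(\<forall>t. \<alpha> \<le> t \<and> t \<le> l \<longrightarrow> R t - \<xi> \<ge> \<mu> * \<eta> / 2) \<or> (\<forall>t. \<alpha> \<le> t \<and> t \<le> l \<longrightarrow> \<xi> - R t \<ge> \<mu> * \<eta> / 2)" by blast
    qed (use lr in auto)
  qed (use K0 in auto)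
  have right: "\<bar>integral {r..\<beta>} h\<bar> \<le> 32 * bm * wm / (\<mu> * \<eta>)"
  proof (cases "r = \<beta>")
    case False
    then have r: "r = ts + \<eta>" by (auto simp: r_def)
    define t0 where "t0 = ts + \<eta> / 2"
    have "t0 \<notin> A" using tsA[of t0] \<eta>(1) unfolding t0_def by linarith
    then have t0: "R t0 < \<xi>" "\<alpha> \<le> t0" "t0 \<le> \<beta>" using ts r lr(3) \<eta>(1) by (auto simp: A_def t0_def)
    show ?thesis
    proof (rule piece)
      have "\<xi> - R t \<ge> \<mu> * \<eta> / 2" if "r \<le> t" "t \<le> \<beta>" for t
      proof -
        have "\<eta> / 2 \<le> t - t0" "t0 \<le> t" using that r \<eta>(1) unfolding t0_def by linarith+
        then have "\<mu> * (\<eta> / 2) \<le> \<mu> * (t - t0)" using \<mu> by (intro mult_left_mono) auto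
        then show ?thesis using R[of t0 t] that \<open>t0 \<le> t\<close> t0 by simp
      qed
      then show "(\<forall>t. r \<le> t \<and> t \<le> \<beta> \<longrightarrow> R t - \<xi> \<ge> \<mu> * \<eta> / 2) \<or> (\<forall>t. r \<le> t \<and> t \<le> \<beta> \<longrightarrow> \<xi> - R t \<ge> \<mu> * \<eta> / 2)" by blast
    qed (use lr in auto)
  qed (use K0 in auto)
  have hint: "h integrable_on {\<alpha>..\<beta>}" using int unfolding h_def .
  have hint': "h integrable_on {c..d}" if "\<alpha> \<le> c" "d \<le> \<beta>" for c d
    using hint that by (metis atLeastatMost_subset_iff integrable_on_subinterval)
  have mid: "\<bar>integral {l..r} h\<bar> \<le> 2 * \<eta> * (am * wm)"
  proof -
    have "norm (integral {l..r} h) \<le> integral {l..r} (\<lambda>_. am * wm)"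
    proof (rule Henstock_Kurzweil_Integration.integral_norm_bound_integral)
      show "norm (h t) \<le> am * wm" if "t \<in> {l..r}" for t
      proof -
        have "\<bar>w t\<bar> * \<bar>a t\<bar> * \<bar>f0 t\<bar> \<le> wm * am * 1"
          using wm[of t] a(2)[of t] f1[of t] that lr wm0 am0 by (intro mult_mono) auto
        then show ?thesis by (simp add: h_def abs_mult mult.commute)
      qed
    qed (use hint' lr integrable_const_ivl in auto)
    also have "\<dots> = (r - l) * (am * wm)" using lr by simp
    also have "\<dots> \<le> 2 * \<eta> * (am * wm)" using lr wm0 am0 by (intro mult_right_mono) auto
    finally show ?thesis by simp
  qed
  have "integral {\<alpha>..\<beta>} h = integral {\<alpha>..l} h + integral {l..r} h + integral {r..\<beta>} h"
    using Henstock_Kurzweil_Integration.integral_combine[of \<alpha> l \<beta> h] Henstock_Kurzweil_Integration.integral_combine[of l r \<beta> h]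
      lr hint hint'[of l \<beta>] by simp
  then have "\<bar>integral {\<alpha>..\<beta>} h\<bar> \<le> 2 * (32 * bm * wm / (\<mu> * \<eta>)) + 2 * \<eta> * (am * wm)"
    using left right mid by linarith
  also have "2 * (32 * bm * wm / (\<mu> * \<eta>)) + 2 * \<eta> * (am * wm) = (64 + 2 * am) * wm * \<eta>"
  proof -
    have "\<eta> * (\<mu> * \<eta>) = bm" using \<eta>(2) \<mu> by (simp add: field_simps)
    then have "bm / (\<mu> * \<eta>) = \<eta>" using \<eta>(1) \<mu> by (simp add: divide_eq_eq)
    moreover have "32 * bm * wm / (\<mu> * \<eta>) = 32 * wm * (bm / (\<mu> * \<eta>))" by simp
    ultimately show ?thesis by (simp add: algebra_simps)
  qed
  finally show ?thesis unfolding h_def \<eta>_def .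
qed

text \<open>The real and imaginary parts are the real version with \<open>F\<close> equal to
  \<open>sin \<theta>\<close> and to \<open>- cos \<theta>\<close>, the chain rule producing the
  factor \<open>Ed * (R - \<xi>)\<close>; adding the two bounds gives the factor 2.\<close>

lemma van_der_corput:
  fixes \<theta> w a b Ed R :: "real \<Rightarrow> real"
  assumes ab: "\<alpha> \<le> \<beta>"
    and d\<theta>: "\<And>t. \<alpha> \<le> t \<Longrightarrow> t \<le> \<beta> \<Longrightarrow> (\<theta> has_real_derivative Ed t * (R t - \<xi>)) (at t within {\<alpha>..\<beta>})"
    and \<mu>: "\<mu> > 0" and R: "\<And>s t. \<alpha> \<le> s \<Longrightarrow> s \<le> t \<Longrightarrow> t \<le> \<beta> \<Longrightarrow> R s - R t \<ge> \<mu> * (t - s)"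
    and b: "\<And>s t. \<alpha> \<le> s \<Longrightarrow> s \<le> t \<Longrightarrow> t \<le> \<beta> \<Longrightarrow> b s \<le> b t"
    and bm: "bm > 0" "\<And>t. \<alpha> \<le> t \<Longrightarrow> t \<le> \<beta> \<Longrightarrow> 0 \<le> b t \<and> b t \<le> bm"
    and w: "\<And>s t. \<alpha> \<le> s \<Longrightarrow> s \<le> t \<Longrightarrow> t \<le> \<beta> \<Longrightarrow> w t \<le> w s"
    and wm: "\<And>t. \<alpha> \<le> t \<Longrightarrow> t \<le> \<beta> \<Longrightarrow> 0 \<le> w t \<and> w t \<le> wm"
    and a: "\<And>t. \<alpha> \<le> t \<Longrightarrow> t \<le> \<beta> \<Longrightarrow> a t = b t * Ed t" "\<And>t. \<alpha> \<le> t \<Longrightarrow> t \<le> \<beta> \<Longrightarrow> \<bar>a t\<bar> \<le> am"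
    and int: "continuous_on {\<alpha>..\<beta>} w" "continuous_on {\<alpha>..\<beta>} a"
  shows "norm (integral {\<alpha>..\<beta>} (\<lambda>t. of_real (w t * a t) * cis (\<theta> t))) \<le> 2 * ((64 + 2 * am) * wm * sqrt (bm / \<mu>))"
proof -
  have c\<theta>: "continuous_on {\<alpha>..\<beta>} \<theta>"
    by (rule DERIV_continuous_on) (use d\<theta> in auto)
  have i: "(\<lambda>t. w t * a t * cos (\<theta> t)) integrable_on {\<alpha>..\<beta>}" "(\<lambda>t. w t * a t * sin (\<theta> t)) integrable_on {\<alpha>..\<beta>}"
    by (intro integrable_continuous_real continuous_intros int c\<theta>)+
  have ic: "(\<lambda>t. of_real (w t * a t) * cis (\<theta> t)) integrable_on {\<alpha>..\<beta>}"
    unfolding cis_conv_exp by (intro integrable_continuous_real continuous_intros int c\<theta>)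
  have 1: "\<bar>integral {\<alpha>..\<beta>} (\<lambda>t. w t * a t * cos (\<theta> t))\<bar> \<le> (64 + 2 * am) * wm * sqrt (bm / \<mu>)"
  proof (rule van_der_corput_real[OF ab _ _ _ \<mu> R b bm w wm a, where F="\<lambda>t. sin (\<theta> t)"])
    fix t assume t: "\<alpha> \<le> t" "t \<le> \<beta>"
    show "((\<lambda>t. sin (\<theta> t)) has_real_derivative Ed t * (R t - \<xi>) * cos (\<theta> t)) (at t within {\<alpha>..\<beta>})"
      by (rule DERIV_cong[OF DERIV_chain2[OF DERIV_sin d\<theta>[OF t]]]) simp
  next
    show "(\<lambda>t. w t * a t * cos (\<theta> t)) integrable_on {\<alpha>..\<beta>}" by (rule i)
  qed auto
  have 2: "\<bar>integral {\<alpha>..\<beta>} (\<lambda>t. w t * a t * sin (\<theta> t))\<bar> \<le> (64 + 2 * am) * wm * sqrt (bm / \<mu>)"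
  proof (rule van_der_corput_real[OF ab _ _ _ \<mu> R b bm w wm a, where F="\<lambda>t. - cos (\<theta> t)"])
    fix t assume t: "\<alpha> \<le> t" "t \<le> \<beta>"
    show "((\<lambda>t. - cos (\<theta> t)) has_real_derivative Ed t * (R t - \<xi>) * sin (\<theta> t)) (at t within {\<alpha>..\<beta>})"
      by (rule DERIV_cong[OF DERIV_minus[OF DERIV_chain2[OF DERIV_cos d\<theta>[OF t]]]]) simp
  next
    show "(\<lambda>t. w t * a t * sin (\<theta> t)) integrable_on {\<alpha>..\<beta>}" by (rule i)
  qed auto
  have re: "Re (integral {\<alpha>..\<beta>} (\<lambda>t. of_real (w t * a t) * cis (\<theta> t))) = integral {\<alpha>..\<beta>} (\<lambda>t. w t * a t * cos (\<theta> t))"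
    using integral_linear[OF ic bounded_linear_Re] by (simp add: comp_def)
  have im: "Im (integral {\<alpha>..\<beta>} (\<lambda>t. of_real (w t * a t) * cis (\<theta> t))) = integral {\<alpha>..\<beta>} (\<lambda>t. w t * a t * sin (\<theta> t))"
    using integral_linear[OF ic bounded_linear_Im] by (simp add: comp_def)
  show ?thesis
    using cmod_le[of "integral {\<alpha>..\<beta>} (\<lambda>t. of_real (w t * a t) * cis (\<theta> t))"] 1 2 unfolding re im by linarith
qed

section \<open>The phase of the reduced multiplier\<close>

locale phase =
  fixes \<phi> \<phi>1 \<phi>2 \<phi>3 \<phi>4 :: "real \<Rightarrow> real" and C c :: real
  assumes d0: "\<And>t. t > 0 \<Longrightarrow> (\<phi> has_real_derivative \<phi>1 t) (at t)"
    and d1: "\<And>t. t > 0 \<Longrightarrow> (\<phi>1 has_real_derivative \<phi>2 t) (at t)"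
    and d2: "\<And>t. t > 0 \<Longrightarrow> (\<phi>2 has_real_derivative \<phi>3 t) (at t)"
    and d3: "\<And>t. t > 0 \<Longrightarrow> (\<phi>3 has_real_derivative \<phi>4 t) (at t)"
    and bd2: "\<And>t. 1/2 \<le> t \<Longrightarrow> t \<le> 1 \<Longrightarrow> \<bar>\<phi>2 t\<bar> \<le> C"
    and bd3: "\<And>t. 1/2 \<le> t \<Longrightarrow> t \<le> 1 \<Longrightarrow> \<bar>\<phi>3 t\<bar> \<le> C"
    and bd4: "\<And>t. 1/2 \<le> t \<Longrightarrow> t \<le> 1 \<Longrightarrow> c \<le> \<phi>4 t"
    and c: "c > 0" and C: "C > 0"

text \<open>With \<open>t = \<epsilon> x\<^sub>1 - u\<^sub>1\<close>, \<open>tp = \<epsilon> x\<^sub>1 - u\<^sub>2\<close>, \<open>s = \<epsilon> x\<^sub>2 - u\<^sub>1\<close>, \<open>sp = \<epsilon> x\<^sub>2 - u\<^sub>2\<close>, the parameters are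
  \<open>p = tp\<^sup>2 - t\<^sup>2\<close> and \<open>e = (x\<^sub>1 - t\<^sup>2) - (x\<^sub>2 - s\<^sup>2)\<close>, and \<open>Ef = (x\<^sub>1 - tp\<^sup>2) - (x\<^sub>2 - sp\<^sup>2)\<close>.\<close>

locale phase_curve = phase +
  fixes \<epsilon> p e lm \<alpha> \<beta> :: real and tp S s h \<Delta> sp \<kappa> Ef \<Psi> :: "real \<Rightarrow> real"
  assumes eps: "\<epsilon> \<noteq> 0" "\<bar>\<epsilon>\<bar> \<le> 1/100" "\<bar>\<epsilon>\<bar> \<le> c / (1200 * C)" and lam: "lm > 0"
    and p: "p > 0" and e: "e \<noteq> 0" "\<bar>e\<bar> \<le> 2"
  defines "tp t \<equiv> sqrt (t\<^sup>2 + p)"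
    and "S t \<equiv> sqrt ((1 - 2 * \<epsilon> * t)\<^sup>2 + 4 * \<epsilon>\<^sup>2 * e)"
    and "s t \<equiv> (1 - S t) / (2 * \<epsilon>)"
    and "h t \<equiv> t - s t"
    and "\<Delta> t \<equiv> tp t - t"
    and "sp t \<equiv> tp t - h t"
    and "\<kappa> t \<equiv> 2 * \<epsilon> * tp t / S t"
    and "Ef t \<equiv> e - 2 * h t * \<Delta> t"
    and "\<Psi> t \<equiv> lm * (\<phi> t - \<phi> (s t) - \<phi> (tp t) + \<phi> (sp t))"
  assumes dom: "\<And>t. \<alpha> \<le> t \<Longrightarrow> t \<le> \<beta> \<Longrightarrow> 1/2 \<le> t \<and> t \<le> 1 \<and> 1/2 \<le> s t \<and> s t \<le> 1 \<and> tp t \<le> 1 \<and> 1/2 \<le> sp t \<and> sp t \<le> 1"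
    and ab: "\<alpha> \<le> \<beta>"
begin

definition "hdot u = 2 * \<epsilon> * h u / S u"

definition "\<kappa>d u = 2 * \<epsilon> * ((u / tp u) / S u + tp u * (2 * \<epsilon> * (1 - 2 * \<epsilon> * u)) / (S u)^3)"

text \<open>The derivative of \<open>Ef\<close>, factored so that its degeneration in
  \<open>h\<close> and \<Delta> is visible; the remaining factor is comparable to
  \<open>1 / tp\<close>.\<close>

definition "Ed u = 2 * h u * \<Delta> u * ((1 - \<kappa> u) / tp u)"

section \<open>Sizes and derivatives along the curve\<close>

context
  fixes t assumes t: "\<alpha> \<le> t" "t \<le> \<beta>"
begin

lemma t1: "1/2 \<le> t" "t \<le> 1" "1/2 \<le> s t" "s t \<le> 1" "tp t \<le> 1" "1/2 \<le> sp t" "sp t \<le> 1"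
  using dom[OF t] by auto

lemma eps_t: "x \<le> 1 \<Longrightarrow> -1 \<le> x \<Longrightarrow> \<bar>\<epsilon> * x\<bar> \<le> 1/100"
  using eps(2) mult_mono[of "\<bar>\<epsilon>\<bar>" "1/100" "\<bar>x\<bar>" 1] by (simp add: abs_mult)

lemma tp_sq: "(tp t)\<^sup>2 = t\<^sup>2 + p" using p by (simp add: tp_def)

lemma tp_gt: "t < tp t" using p t1(1) unfolding tp_def by (intro real_less_rsqrt) auto

lemma \<Delta>_pos: "0 < \<Delta> t" "\<Delta> t \<le> 1/2" using tp_gt t1 by (auto simp: \<Delta>_def)

lemma \<Delta>_ge: "\<Delta> t \<ge> p / 2"
proof -
  have "p = \<Delta> t * (tp t + t)" using tp_sq by (simp add: \<Delta>_def power2_eq_square algebra_simps)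
  also have "\<dots> \<le> \<Delta> t * 2" using \<Delta>_pos t1 by (intro mult_left_mono) auto
  finally show ?thesis by simp
qed

lemma eps_e: "\<bar>4 * \<epsilon>\<^sup>2 * e\<bar> \<le> 8/10000"
proof -
  have "\<epsilon>\<^sup>2 \<le> (1/100)\<^sup>2" using power_mono[OF eps(2), of 2] by simp
  then have "\<epsilon>\<^sup>2 * \<bar>e\<bar> \<le> (1/100)\<^sup>2 * 2" using e by (intro mult_mono) auto
  then show ?thesis by (simp add: abs_mult power2_eq_square)
qed

lemma a_t: "98/100 \<le> 1 - 2 * \<epsilon> * t" "1 - 2 * \<epsilon> * t \<le> 102/100"
  using eps_t[of t] t1 by (auto simp: abs_le_iff)

lemma rad_pos: "(1 - 2 * \<epsilon> * t)\<^sup>2 + 4 * \<epsilon>\<^sup>2 * e \<ge> 95/100" "(1 - 2 * \<epsilon> * t)\<^sup>2 + 4 * \<epsilon>\<^sup>2 * e \<le> 105/100"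
  using eps_e power_mono[OF a_t(1), of 2] power_mono[OF a_t(2), of 2] a_t by (auto simp: abs_le_iff power2_eq_square)

lemma S_sq: "(S t)\<^sup>2 = (1 - 2 * \<epsilon> * t)\<^sup>2 + 4 * \<epsilon>\<^sup>2 * e" using rad_pos by (simp add: S_def)

lemma S_eq: "S t = 1 - 2 * \<epsilon> * s t" using eps by (simp add: s_def)

lemma S_bd: "98/100 \<le> S t" "S t \<le> 102/100"
  using eps_t[of "s t"] t1 by (auto simp: abs_le_iff S_eq)

lemma h_eq: "2 * \<epsilon> * h t = S t - (1 - 2 * \<epsilon> * t)" by (simp add: h_def S_eq algebra_simps)

text \<open>This is the definition of \<open>e\<close> in disguise: since
  \<open>t - s = \<epsilon> (x\<^sub>1 - x\<^sub>2)\<close>, one has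
  \<open>e = h / \<epsilon> - (t\<^sup>2 - s\<^sup>2)\<close>. It makes \<open>h\<close> comparable
  to \<open>\<epsilon> * e\<close>, with the same sign.\<close>

lemma h_eq2: "h t * (1 - \<epsilon> * (t + s t)) = \<epsilon> * e"
proof -
  have "(S t - (1 - 2 * \<epsilon> * t)) * (S t + (1 - 2 * \<epsilon> * t)) = 4 * \<epsilon>\<^sup>2 * e"
    using S_sq by (simp add: power2_eq_square algebra_simps)
  moreover have "S t + (1 - 2 * \<epsilon> * t) = 2 * (1 - \<epsilon> * (t + s t))" by (simp add: S_eq algebra_simps)
  ultimately have "2 * \<epsilon> * h t * (2 * (1 - \<epsilon> * (t + s t))) = 4 * \<epsilon>\<^sup>2 * e" by (simp only: h_eq)
  then have "\<epsilon> * (4 * (h t * (1 - \<epsilon> * (t + s t)))) = \<epsilon> * (4 * (\<epsilon> * e))"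
    by (simp add: power2_eq_square mult_ac)
  then show ?thesis using eps by simp
qed

lemma P_bd: "98/100 \<le> 1 - \<epsilon> * (t + s t)" "1 - \<epsilon> * (t + s t) \<le> 102/100"
  using eps_t[of "(t + s t)/2"] t1 by (auto simp: abs_le_iff)

lemma h_abs: "\<bar>h t\<bar> * (1 - \<epsilon> * (t + s t)) = \<bar>\<epsilon>\<bar> * \<bar>e\<bar>"
  using arg_cong[OF h_eq2, of abs] P_bd by (simp add: abs_mult)

lemma h_bd: "\<bar>h t\<bar> \<le> 3 * \<bar>\<epsilon>\<bar>" "\<bar>h t\<bar> \<ge> \<bar>\<epsilon>\<bar> * \<bar>e\<bar> * (98/100)"
proof -
  have "\<bar>h t\<bar> * (98/100) \<le> \<bar>h t\<bar> * (1 - \<epsilon> * (t + s t))" using P_bd by (intro mult_left_mono) auto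
  also have "\<dots> \<le> \<bar>\<epsilon>\<bar> * 2" unfolding h_abs using e by (intro mult_left_mono) auto
  finally show "\<bar>h t\<bar> \<le> 3 * \<bar>\<epsilon>\<bar>" by simp
  have "\<bar>\<epsilon>\<bar> * \<bar>e\<bar> \<le> \<bar>h t\<bar> * (102/100)" unfolding h_abs[symmetric] using P_bd by (intro mult_left_mono) auto
  then show "\<bar>h t\<bar> \<ge> \<bar>\<epsilon>\<bar> * \<bar>e\<bar> * (98/100)" by simp
qed

lemma hd_bd: "\<bar>hdot t\<bar> \<le> \<bar>\<epsilon>\<bar> / 10"
proof -
  have "\<bar>2 * \<epsilon> * h t\<bar> \<le> 2 * \<bar>\<epsilon>\<bar> * (3/100)"
    unfolding abs_mult using h_bd eps(2) by (intro mult_mono) auto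
  also have "\<dots> \<le> \<bar>\<epsilon>\<bar> / 10 * S t" using S_bd mult_left_mono[of "98/100" "S t" "\<bar>\<epsilon>\<bar>"] by simp
  finally show ?thesis using S_bd by (simp add: hdot_def abs_mult divide_le_eq)
qed

lemma hd_bd': "\<bar>hdot t\<bar> \<le> 1/100" using hd_bd eps(2) by linarith

lemma dS: "(S has_real_derivative - 2 * \<epsilon> * (1 - 2 * \<epsilon> * t) / S t) (at t)"
proof -
  have "((\<lambda>t. sqrt ((1 - 2 * \<epsilon> * t)\<^sup>2 + 4 * \<epsilon>\<^sup>2 * e)) has_real_derivative - 2 * \<epsilon> * (1 - 2 * \<epsilon> * t) / S t) (at t)"
    using rad_pos by (auto intro!: derivative_eq_intros simp: S_def divide_simps)
  then show ?thesis by (simp add: S_def[abs_def])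
qed

lemma ds: "(s has_real_derivative 1 - hdot t) (at t)"
proof -
  have "((\<lambda>t. (1 - S t) / (2 * \<epsilon>)) has_real_derivative (0 - (- 2 * \<epsilon> * (1 - 2 * \<epsilon> * t) / S t)) / (2 * \<epsilon>)) (at t)"
    by (intro DERIV_cdivide DERIV_diff DERIV_const dS)
  moreover have "(0 - (- 2 * \<epsilon> * (1 - 2 * \<epsilon> * t) / S t)) / (2 * \<epsilon>) = 1 - hdot t"
    unfolding hdot_def h_eq using eps(1) S_bd by (simp add: field_simps)
  ultimately show ?thesis by (simp add: s_def[abs_def])
qed

lemma dh: "(h has_real_derivative hdot t) (at t)"
proof -
  have "((\<lambda>t. t - s t) has_real_derivative 1 - (1 - hdot t)) (at t)"
    by (intro DERIV_diff DERIV_ident ds)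
  then show ?thesis by (simp add: h_def[abs_def])
qed

lemma dtp: "(tp has_real_derivative t / tp t) (at t)"
proof -
  have "t\<^sup>2 + p > 0" using p by (simp add: add_nonneg_pos)
  then have "((\<lambda>t. sqrt (t\<^sup>2 + p)) has_real_derivative t / tp t) (at t)"
    by (auto intro!: derivative_eq_intros simp: tp_def divide_simps)
  then show ?thesis by (simp add: tp_def[abs_def])
qed

lemma d\<Delta>: "(\<Delta> has_real_derivative t / tp t - 1) (at t)"
proof -
  have "((\<lambda>t. tp t - t) has_real_derivative t / tp t - 1) (at t)"
    by (intro DERIV_diff DERIV_ident dtp)
  then show ?thesis by (simp add: \<Delta>_def[abs_def])
qed

lemma dsp: "(sp has_real_derivative t / tp t - hdot t) (at t)"
proof -
  have "((\<lambda>t. tp t - h t) has_real_derivative t / tp t - hdot t) (at t)"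
    by (intro DERIV_diff dh dtp)
  then show ?thesis by (simp add: sp_def[abs_def])
qed

lemma ratio: "1/2 \<le> t / tp t" "t / tp t \<le> 1" "t / tp t - 1 = - (\<Delta> t / tp t)"
  using tp_gt t1 by (auto simp: divide_simps \<Delta>_def)

lemma \<kappa>_bd: "\<bar>\<kappa> t\<bar> \<le> 3 * \<bar>\<epsilon>\<bar>"
proof -
  have "\<bar>2 * \<epsilon> * tp t\<bar> \<le> 2 * \<bar>\<epsilon>\<bar>" using tp_gt t1 mult_left_le[of "tp t" "2*\<bar>\<epsilon>\<bar>"] by (simp add: abs_mult)
  also have "\<dots> \<le> 3 * \<bar>\<epsilon>\<bar> * S t" using S_bd mult_left_mono[of "98/100" "S t" "3*\<bar>\<epsilon>\<bar>"] by simp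
  finally show ?thesis using S_bd by (simp add: \<kappa>_def abs_mult divide_le_eq)
qed

lemma \<kappa>_bd': "\<bar>\<kappa> t\<bar> \<le> 3/100" using \<kappa>_bd eps(2) by linarith

lemma d\<kappa>: "(\<kappa> has_real_derivative \<kappa>d t) (at t)"
proof -
  have "((\<lambda>t. 2 * \<epsilon> * tp t / S t) has_real_derivative
     ((2 * \<epsilon> * (t / tp t)) * S t - 2 * \<epsilon> * tp t * (- 2 * \<epsilon> * (1 - 2 * \<epsilon> * t) / S t)) / (S t * S t)) (at t)"
    by (intro DERIV_divide DERIV_cmult dtp dS) (use S_bd in auto)
  moreover have "((2 * \<epsilon> * (t / tp t)) * S t - 2 * \<epsilon> * tp t * (- 2 * \<epsilon> * (1 - 2 * \<epsilon> * t) / S t)) / (S t * S t) = \<kappa>d t"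
    unfolding \<kappa>d_def using S_bd by (simp add: field_simps power3_eq_cube)
  ultimately show ?thesis by (simp add: \<kappa>_def[abs_def])
qed

lemma \<kappa>d_bd: "\<bar>\<kappa>d t\<bar> \<le> 3 * \<bar>\<epsilon>\<bar>"
proof -
  have S3: "(98/100)^3 \<le> (S t)^3" using S_bd by (intro power_mono) auto
  have "\<bar>(t / tp t) / S t\<bar> \<le> 1 / (98/100)"
    unfolding abs_divide using ratio S_bd t1 tp_gt by (intro frac_le) (auto simp: abs_divide)
  moreover have "\<bar>tp t * (2 * \<epsilon> * (1 - 2 * \<epsilon> * t)) / (S t)^3\<bar> \<le> (1 * ((2/100) * (102/100))) / (98/100)^3"
    unfolding abs_divide abs_mult using S3 S_bd t1 tp_gt a_t eps(2)
    by (intro frac_le mult_mono) auto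
  ultimately have "\<bar>(t / tp t) / S t + tp t * (2 * \<epsilon> * (1 - 2 * \<epsilon> * t)) / (S t)^3\<bar> \<le> 1 / (98/100) + (1 * ((2/100) * (102/100))) / (98/100)^3"
    by (intro order_trans[OF abs_triangle_ineq] add_mono)
  also have "\<dots> \<le> 3/2" by (simp add: power3_eq_cube)
  finally have "\<bar>2 * \<epsilon>\<bar> * \<bar>(t / tp t) / S t + tp t * (2 * \<epsilon> * (1 - 2 * \<epsilon> * t)) / (S t)^3\<bar> \<le> \<bar>2 * \<epsilon>\<bar> * (3/2)"
    by (intro mult_left_mono) auto
  then show ?thesis unfolding \<kappa>d_def abs_mult[of "2 * \<epsilon>"] by simp
qed

text \<open>In the product rule the derivative of \<open>h\<close> is \<open>h\<close> times
  \<open>2 * \<epsilon> / S\<close> and that of \<Delta> is \<Delta> times \<open>- 1 / tp\<close>.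
  The common factor \<open>h * \<Delta>\<close> comes out, and \<kappa> is the ratio of the two
  rates.\<close>

lemma dEf: "(Ef has_real_derivative Ed t) (at t)"
proof -
  have "((\<lambda>t. e - 2 * h t * \<Delta> t) has_real_derivative 0 - ((2 * hdot t) * \<Delta> t + (t / tp t - 1) * (2 * h t))) (at t)"
    by (intro DERIV_diff DERIV_mult DERIV_const DERIV_cmult dh d\<Delta>)
  moreover have "0 - ((2 * hdot t) * \<Delta> t + (t / tp t - 1) * (2 * h t)) = Ed t"
    unfolding ratio Ed_def hdot_def \<kappa>_def using S_bd t1 tp_gt by (simp add: field_simps)
  ultimately show ?thesis by (simp add: Ef_def[abs_def])
qed

text \<open>Each argument is a convex combination of two of the four points \<open>t\<close>,
  \<open>s\<close>, \<open>tp\<close>, \<open>sp\<close>, so the bounds on the derivatives of \<phi>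
  are available wherever they are needed.\<close>

lemma y_bd:
  assumes "0 \<le> \<theta>" "\<theta> \<le> 1"
  shows "1/2 \<le> s t + \<theta> * h t" "s t + \<theta> * h t \<le> 1" "1/2 \<le> s t + \<theta> * h t + \<Delta> t" "s t + \<theta> * h t + \<Delta> t \<le> 1"
    "1/2 \<le> s t + \<theta> * \<Delta> t" "s t + \<theta> * \<Delta> t \<le> 1"
proof -
  have conv: "x + \<theta> * (y - x) \<ge> 1/2" "x + \<theta> * (y - x) \<le> 1" if "1/2 \<le> x" "x \<le> 1" "1/2 \<le> y" "y \<le> 1" for x y
  proof -
    have "x + \<theta> * (y - x) = (1 - \<theta>) * x + \<theta> * y" by (simp add: algebra_simps)
    then show "x + \<theta> * (y - x) \<ge> 1/2" "x + \<theta> * (y - x) \<le> 1"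
      using convex_bound_le[of x 1 y "1 - \<theta>" \<theta>] convex_bound_le[of "-x" "-1/2" "-y" "1 - \<theta>" \<theta>] assms that by auto
  qed
  show "1/2 \<le> s t + \<theta> * h t" "s t + \<theta> * h t \<le> 1" using conv[of "s t" t] t1 by (auto simp: h_def)
  show "1/2 \<le> s t + \<theta> * h t + \<Delta> t" "s t + \<theta> * h t + \<Delta> t \<le> 1"
    using conv[of "sp t" "tp t"] t1 tp_gt by (auto simp: h_def sp_def \<Delta>_def)
  show "1/2 \<le> s t + \<theta> * \<Delta> t" "s t + \<theta> * \<Delta> t \<le> 1" using conv[of "s t" "sp t"] t1 by (auto simp: h_def sp_def \<Delta>_def)
qed

end

text \<open>The quotient \<open>R = \<Psi>' / Ef'\<close> is regular although both derivatives degenerate as \<open>h\<close> or \<open>\<Delta>\<close>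
  tend to 0; its main part is the mean over \<open>\<theta>\<close> of \<open>\<tau> \<theta>\<close>, which is strictly decreasing because the fourth derivative of \<open>\<phi>\<close> is positive.\<close>

definition "\<tau> \<theta> t = \<phi>2 (s t + \<theta> * h t) - t * ((\<phi>2 (s t + \<theta> * h t + \<Delta> t) - \<phi>2 (s t + \<theta> * h t)) / \<Delta> t)"

text \<open>For \<Delta> tending to 0 the function is \<open>\<phi>2 y - t * \<phi>3 y\<close>; if
  moreover \<open>y\<close> moves with unit speed, the terms in \<open>\<phi>3\<close> cancel in the
  derivative and \<open>- t * \<phi>4 y\<close> remains. For positive \<Delta> the same cancellation
  is replaced by monotonicity of \<open>\<phi>3\<close>, and the deviation of the speed from 1 is of
  order \<epsilon>.\<close>

lemma \<tau>_deriv: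
  assumes t: "\<alpha> \<le> t" "t \<le> \<beta>" and \<theta>: "0 \<le> \<theta>" "\<theta> \<le> 1"
  shows "\<exists>D. (\<tau> \<theta> has_real_derivative D) (at t) \<and> D \<le> - c / 16"
proof -
  note t1 = t1[OF t] and \<Delta>p = \<Delta>_pos[OF t] and yb = y_bd[OF t \<theta>] and ra = ratio[OF t] and hdb = hd_bd[OF t] hd_bd'[OF t]
  define y where "y = s t + \<theta> * h t"
  define yd where "yd = 1 - (1 - \<theta>) * hdot t"
  define Dd where "Dd = t / tp t - 1"
  have dy: "((\<lambda>t. s t + \<theta> * h t) has_real_derivative yd) (at t)"
    by (rule DERIV_cong[OF DERIV_add[OF ds[OF t] DERIV_cmult[OF dh[OF t]]]]) (simp add: yd_def algebra_simps)
  have dyD: "((\<lambda>t. s t + \<theta> * h t + \<Delta> t) has_real_derivative yd + Dd) (at t)"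
    unfolding Dd_def by (rule DERIV_add[OF dy d\<Delta>[OF t]])
  have y0: "y > 0" "y + \<Delta> t > 0" using yb \<Delta>p by (auto simp: y_def)
  have d2y: "((\<lambda>t. \<phi>2 (s t + \<theta> * h t)) has_real_derivative \<phi>3 y * yd) (at t)"
    by (rule DERIV_chain2[OF _ dy]) (use d2[of y] y0 in \<open>simp add: y_def\<close>)
  have d2yD: "((\<lambda>t. \<phi>2 (s t + \<theta> * h t + \<Delta> t)) has_real_derivative \<phi>3 (y + \<Delta> t) * (yd + Dd)) (at t)"
    by (rule DERIV_chain2[OF _ dyD]) (use d2[of "y + \<Delta> t"] y0 in \<open>simp add: y_def\<close>)
  define DD where "DD = (\<phi>2 (y + \<Delta> t) - \<phi>2 y) / \<Delta> t"
  define D where "D = \<phi>3 y * yd - (1 * DD +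
     (((\<phi>3 (y + \<Delta> t) * (yd + Dd) - \<phi>3 y * yd) * \<Delta> t - (\<phi>2 (y + \<Delta> t) - \<phi>2 y) * Dd) / (\<Delta> t * \<Delta> t)) * t)"
  have "(\<tau> \<theta> has_real_derivative D) (at t)"
    unfolding \<tau>_def[abs_def] D_def DD_def y_def
    by (intro DERIV_diff DERIV_mult DERIV_ident DERIV_divide d2y[unfolded y_def] d2yD[unfolded y_def] d\<Delta>[OF t, folded Dd_def])
       (use \<Delta>p in auto)
  moreover have "D \<le> - c / 16"
  proof -
    have mono3: "\<phi>3 b - \<phi>3 a \<ge> c * (b - a)" if "a \<le> b" "1/2 \<le> a" "b \<le> 1" for a b
    proof (cases "a = b")
      case False
      have "\<exists>z>a. z < b \<and> \<phi>3 b - \<phi>3 a = (b - a) * \<phi>4 z"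
        by (rule MVT2) (use False that d3 in auto)
      then obtain z where z: "a < z" "z < b" "\<phi>3 b - \<phi>3 a = (b - a) * \<phi>4 z" by blast
      then show ?thesis using bd4[of z] that mult_left_mono[of c "\<phi>4 z" "b - a"] by (simp add: mult.commute)
    qed auto
    have "\<exists>z>y. z < y + \<Delta> t \<and> \<phi>2 (y + \<Delta> t) - \<phi>2 y = (y + \<Delta> t - y) * \<phi>3 z"
      by (rule MVT2) (use d2 \<Delta>p y0 in auto)
    then obtain z where z: "y < z" "z < y + \<Delta> t" "\<phi>2 (y + \<Delta> t) - \<phi>2 y = (y + \<Delta> t - y) * \<phi>3 z" by blast
    have DDz: "DD = \<phi>3 z" using z \<Delta>p by (simp add: DD_def)
    have yb': "1/2 \<le> y" "y + \<Delta> t \<le> 1" using yb by (auto simp: y_def)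
    have "0 \<le> c * (z - y)" "0 \<le> c * (y + \<Delta> t - z)" using z c by auto
    then have DD1: "\<phi>3 y \<le> DD" "DD \<le> \<phi>3 (y + \<Delta> t)"
      using mono3[of y z] mono3[of z "y + \<Delta> t"] z yb' unfolding DDz by linarith+
    have hth: "\<bar>(1 - \<theta>) * hdot t\<bar> \<le> \<bar>hdot t\<bar>" using \<theta> by (simp add: abs_mult mult_left_le_one_le)
    have yd1: "\<bar>yd - 1\<bar> \<le> \<bar>\<epsilon>\<bar> / 10" "\<bar>yd - 1\<bar> \<le> 1/100" using hth hdb by (auto simp: yd_def)
    have Dd: "Dd \<le> 0" "yd + Dd \<ge> 1/4" using ra(1,2) yd1(2) unfolding Dd_def by linarith+
    have G: "\<phi>3 (y + \<Delta> t) - \<phi>3 y \<ge> c * \<Delta> t" using mono3[of y "y + \<Delta> t"] yb \<Delta>p by (simp add: y_def)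
    \<comment> \<open>The first term is the error from the speed, at most \<open>c / 16\<close>. The
      second is nonpositive, since \<open>DD\<close> is a value of the increasing
      \<open>\<phi>3\<close> to the right of \<open>y\<close>. The subtracted term is at least
      \<open>c / 8\<close>.\<close>
    have Deq: "D = \<phi>3 y * (yd - 1) + (\<phi>3 y - DD) - t * ((yd * (\<phi>3 (y + \<Delta> t) - \<phi>3 y) + Dd * (\<phi>3 (y + \<Delta> t) - DD)) / \<Delta> t)"
      using \<Delta>p by (simp add: D_def DD_def field_simps)
    have "yd * (\<phi>3 (y + \<Delta> t) - \<phi>3 y) + Dd * (\<phi>3 (y + \<Delta> t) - DD) \<ge> yd * (\<phi>3 (y + \<Delta> t) - \<phi>3 y) + Dd * (\<phi>3 (y + \<Delta> t) - \<phi>3 y)"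
      using Dd DD1 by (intro add_left_mono mult_left_mono_neg) auto
    moreover have "yd * (\<phi>3 (y + \<Delta> t) - \<phi>3 y) + Dd * (\<phi>3 (y + \<Delta> t) - \<phi>3 y) = (yd + Dd) * (\<phi>3 (y + \<Delta> t) - \<phi>3 y)"
      by (simp add: algebra_simps)
    moreover have "(yd + Dd) * (\<phi>3 (y + \<Delta> t) - \<phi>3 y) \<ge> 1/4 * (c * \<Delta> t)"
      using Dd G c \<Delta>p by (intro mult_mono) auto
    ultimately have "(yd * (\<phi>3 (y + \<Delta> t) - \<phi>3 y) + Dd * (\<phi>3 (y + \<Delta> t) - DD)) / \<Delta> t \<ge> 1/4 * c"
      using \<Delta>p by (simp add: le_divide_eq)
    then have 1: "t * ((yd * (\<phi>3 (y + \<Delta> t) - \<phi>3 y) + Dd * (\<phi>3 (y + \<Delta> t) - DD)) / \<Delta> t) \<ge> 1/2 * (1/4 * c)"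
      using t1 c by (intro mult_mono) auto
    have "\<bar>\<phi>3 y * (yd - 1)\<bar> \<le> C * (\<bar>\<epsilon>\<bar> / 10)"
      unfolding abs_mult using bd3[of y] yb yd1 C by (intro mult_mono) (auto simp: y_def)
    also have "\<dots> \<le> c / 16" using mult_left_mono[OF eps(3), of C] C c by (simp add: field_simps)
    finally show ?thesis using 1 DD1 unfolding Deq by linarith
  qed
  ultimately show ?thesis by blast
qed

lemma \<tau>_decr:
  assumes "\<alpha> \<le> t" "t \<le> u" "u \<le> \<beta>" and \<theta>: "0 \<le> \<theta>" "\<theta> \<le> 1"
  shows "\<tau> \<theta> t - \<tau> \<theta> u \<ge> c / 16 * (u - t)"
proof -
  have "\<tau> \<theta> u + c / 16 * u \<le> \<tau> \<theta> t + c / 16 * t"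
  proof (rule DERIV_nonpos_imp_nonincreasing[OF assms(2)])
    fix x assume x: "t \<le> x" "x \<le> u"
    then obtain D where "(\<tau> \<theta> has_real_derivative D) (at x)" "D \<le> - c / 16"
      using \<tau>_deriv[of x \<theta>] assms by auto
    then have "((\<lambda>t. \<tau> \<theta> t + c / 16 * t) has_real_derivative D + c / 16 * 1) (at x)"
      by (intro DERIV_add DERIV_cmult DERIV_ident)
    moreover have "D + c / 16 * 1 \<le> 0" using \<open>D \<le> - c / 16\<close> by simp
    ultimately show "\<exists>y. ((\<lambda>t. \<tau> \<theta> t + c / 16 * t) has_real_derivative y) (at x) \<and> y \<le> 0" by blast
  qed
  then show ?thesis by (simp add: algebra_simps diff_divide_distrib)
qed

text \<open>The integral form of the difference quotient of \<open>\<phi>1\<close>. It keeps its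
  meaning at \<open>d = 0\<close>, and it can be estimated and differentiated pointwise in
  \<theta>.\<close>

definition "av x d = integral {0..1} (\<lambda>\<theta>. \<phi>2 (x + \<theta> * d))"

lemma av_props:
  assumes "x > 0" "x + d > 0"
  shows "(\<lambda>\<theta>. \<phi>2 (x + \<theta> * d)) integrable_on {0..1}" "\<phi>1 (x + d) - \<phi>1 x = d * av x d"
proof -
  have pos: "x + \<theta> * d > 0" if "0 \<le> \<theta>" "\<theta> \<le> 1" for \<theta>
  proof -
    have "x + \<theta> * d = (1 - \<theta>) * x + \<theta> * (x + d)" by (simp add: algebra_simps)
    also have "\<dots> > 0" using that assms
      by (cases "\<theta> = 0") (auto intro!: add_nonneg_pos)
    finally show ?thesis .
  qed
  have hi: "((\<lambda>\<theta>. d * \<phi>2 (x + \<theta> * d)) has_integral \<phi>1 (x + 1 * d) - \<phi>1 (x + 0 * d)) {0..1}"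
  proof (rule fundamental_theorem_of_calculus)
    fix \<theta> :: real assume "\<theta> \<in> {0..1}"
    then have p: "x + \<theta> * d > 0" using pos by auto
    have "((\<lambda>\<theta>. x + \<theta> * d) has_real_derivative 0 + 1 * d) (at \<theta> within {0..1})"
      by (intro DERIV_add DERIV_const DERIV_cmult_right DERIV_ident)
    then have "((\<lambda>\<theta>. \<phi>1 (x + \<theta> * d)) has_real_derivative \<phi>2 (x + \<theta> * d) * (0 + 1 * d)) (at \<theta> within {0..1})"
      by (rule DERIV_chain2[where f=\<phi>1 and g="\<lambda>\<theta>. x + \<theta> * d", OF d1[OF p]])
    then show "((\<lambda>\<theta>. \<phi>1 (x + \<theta> * d)) has_vector_derivative d * \<phi>2 (x + \<theta> * d)) (at \<theta> within {0..1})"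
      by (simp add: has_real_derivative_iff_has_vector_derivative mult.commute)
  qed auto
  show "(\<lambda>\<theta>. \<phi>2 (x + \<theta> * d)) integrable_on {0..1}"
  proof (rule integrable_continuous_real, rule continuous_on_compose2[of "{0<..}" \<phi>2])
    show "continuous_on {0<..} \<phi>2"
      by (rule DERIV_continuous_on) (use d2 in \<open>auto intro: has_field_derivative_at_within\<close>)
  qed (use pos in \<open>auto intro!: continuous_intros\<close>)
  show "\<phi>1 (x + d) - \<phi>1 x = d * av x d"
    using integral_unique[OF hi] by (simp add: av_def)
qed

definition "T0 t = integral {0..1} (\<lambda>\<theta>. \<tau> \<theta> t)"
text \<open>The correction with \<kappa> stems from the motion of \<open>h\<close> along the curve:
  in the numerator from the derivative of \<Psi>, in the denominator from that of \<open>Ef\<close>.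
  It is of order \<epsilon>. The 2 under \<open>lm\<close> is the factor 2 in
  \<open>Ed\<close>.\<close>

definition "R t = lm / 2 * ((T0 t - \<kappa> t * av (s t) (\<Delta> t)) / (1 - \<kappa> t))"

lemma T0_props:
  assumes t: "\<alpha> \<le> t" "t \<le> \<beta>"
  shows "(\<lambda>\<theta>. \<tau> \<theta> t) integrable_on {0..1}"
    "T0 t = av (s t) (h t) - t * ((av (sp t) (h t) - av (s t) (h t)) / \<Delta> t)"
proof -
  note t1 = t1[OF t] tp_gt[OF t]
  have sp: "sp t + \<theta> * h t = s t + \<theta> * h t + \<Delta> t" for \<theta> by (simp add: sp_def h_def \<Delta>_def)
  have i1: "(\<lambda>\<theta>. \<phi>2 (s t + \<theta> * h t)) integrable_on {0..1}"
    by (rule av_props) (use t1 in \<open>auto simp: h_def\<close>)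
  have i2: "(\<lambda>\<theta>. \<phi>2 (s t + \<theta> * h t + \<Delta> t)) integrable_on {0..1}"
    unfolding sp[symmetric] by (rule av_props) (use t1 in \<open>auto simp: sp_def h_def\<close>)
  have hi: "((\<lambda>\<theta>. \<tau> \<theta> t) has_integral av (s t) (h t) - t * ((av (sp t) (h t) - av (s t) (h t)) / \<Delta> t)) {0..1}"
    unfolding \<tau>_def av_def sp
    by (intro has_integral_diff has_integral_mult_right has_integral_divide integrable_integral i1 i2)
  show "(\<lambda>\<theta>. \<tau> \<theta> t) integrable_on {0..1}" using hi by (rule has_integral_integrable)
  show "T0 t = av (s t) (h t) - t * ((av (sp t) (h t) - av (s t) (h t)) / \<Delta> t)" unfolding T0_def using hi by (rule integral_unique)
qed

text \<open>The derivative is regrouped into increments of \<open>\<phi>1\<close> from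
  \<open>s\<close> to \<open>t\<close>, from \<open>sp\<close> to \<open>tp\<close> and from
  \<open>s\<close> to \<open>sp\<close>. The first two carry a factor \<open>h\<close>, the third a
  factor \<Delta> together with the derivative of \<open>h\<close>, so \<open>h\<close> comes out at
  once; \<open>\<Delta> / tp\<close> comes out by rewriting the difference of the first two through
  \<open>tp = t + \<Delta>\<close>.\<close>

lemma d\<Psi>:
  assumes t: "\<alpha> \<le> t" "t \<le> \<beta>"
  shows "(\<Psi> has_real_derivative Ed t * R t) (at t)"
proof -
  note t1 = t1[OF t] tp_gt[OF t] and \<Delta>p = \<Delta>_pos[OF t] and S = S_bd[OF t] and \<kappa>b = \<kappa>_bd'[OF t]
  have A1: "\<phi>1 t - \<phi>1 (s t) = h t * av (s t) (h t)"
    using av_props(2)[of "s t" "h t"] t1 by (simp add: h_def)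
  have A2: "\<phi>1 (tp t) - \<phi>1 (sp t) = h t * av (sp t) (h t)"
    using av_props(2)[of "sp t" "h t"] t1 by (simp add: h_def sp_def)
  have A3: "\<phi>1 (sp t) - \<phi>1 (s t) = \<Delta> t * av (s t) (\<Delta> t)"
  proof -
    have "s t + \<Delta> t = sp t" by (simp add: h_def sp_def \<Delta>_def)
    then show ?thesis using av_props(2)[of "s t" "\<Delta> t"] t1 by simp
  qed
  define A B D where "A = av (s t) (h t)" and "B = av (sp t) (h t)" and "D = av (s t) (\<Delta> t)"
  have D0: "((\<lambda>t. lm * (\<phi> t - \<phi> (s t) - \<phi> (tp t) + \<phi> (sp t))) has_real_derivative
     lm * (\<phi>1 t - \<phi>1 (s t) * (1 - hdot t) - \<phi>1 (tp t) * (t / tp t) + \<phi>1 (sp t) * (t / tp t - hdot t))) (at t)"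
    by (intro DERIV_cmult DERIV_add DERIV_diff d0 DERIV_chain2[OF d0 ds[OF t]] DERIV_chain2[OF d0 dtp[OF t]] DERIV_chain2[OF d0 dsp[OF t]])
       (use t1 in auto)
  have "\<phi>1 t - \<phi>1 (s t) * (1 - hdot t) - \<phi>1 (tp t) * (t / tp t) + \<phi>1 (sp t) * (t / tp t - hdot t)
     = (\<phi>1 t - \<phi>1 (s t)) - (t / tp t) * (\<phi>1 (tp t) - \<phi>1 (sp t)) - hdot t * (\<phi>1 (sp t) - \<phi>1 (s t))"
    by (simp add: algebra_simps)
  also have "\<dots> = h t * (A - (t / tp t) * B - (2 * \<epsilon> / S t) * \<Delta> t * D)"
    unfolding A1 A2 A3 hdot_def A_def B_def D_def by (simp add: algebra_simps)
  finally have e1: "\<phi>1 t - \<phi>1 (s t) * (1 - hdot t) - \<phi>1 (tp t) * (t / tp t) + \<phi>1 (sp t) * (t / tp t - hdot t)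
     = h t * (A - (t / tp t) * B - (2 * \<epsilon> / S t) * \<Delta> t * D)" .
  have e2: "lm * (h t * (A - (t / tp t) * B - (2 * \<epsilon> / S t) * \<Delta> t * D)) = Ed t * R t"
  proof -
    have tp: "tp t = t + \<Delta> t" by (simp add: \<Delta>_def)
    have k: "1 - \<kappa> t \<noteq> 0" using \<kappa>b by auto
    have "Ed t * R t = lm * (h t * (\<Delta> t / tp t * (T0 t - \<kappa> t * D)))"
    proof -
      have "(1 - \<kappa> t) / tp t * ((T0 t - \<kappa> t * D) / (1 - \<kappa> t)) = (T0 t - \<kappa> t * D) / tp t" using k by simp
      moreover have "Ed t * R t = lm * (h t * \<Delta> t) * ((1 - \<kappa> t) / tp t * ((T0 t - \<kappa> t * D) / (1 - \<kappa> t)))"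
      proof -
        have gen: "2 * a * b * w * (l / 2 * q) = l * (a * b) * (w * q)" for a b w l q :: real by simp
        show ?thesis unfolding Ed_def R_def D_def[symmetric] by (rule gen)
      qed
      ultimately have "Ed t * R t = lm * (h t * \<Delta> t) * ((T0 t - \<kappa> t * D) / tp t)" by (simp only:)
      then show ?thesis by simp
    qed
    also have "\<Delta> t / tp t * (T0 t - \<kappa> t * D) = A - (t / tp t) * B - (2 * \<epsilon> / S t) * \<Delta> t * D"
    proof -
      have "\<Delta> t * T0 t = \<Delta> t * A - t * (B - A)"
        unfolding T0_props(2)[OF t] A_def[symmetric] B_def[symmetric] using \<Delta>p by (simp add: field_simps)
      then have "\<Delta> t * T0 t = tp t * A - t * B" by (simp add: tp algebra_simps)
      then have "\<Delta> t / tp t * T0 t = A - (t / tp t) * B" using t1 by (simp add: field_simps)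
      moreover have "\<Delta> t / tp t * (\<kappa> t * D) = (2 * \<epsilon> / S t) * \<Delta> t * D"
        unfolding \<kappa>_def using t1 S by (simp add: field_simps)
      ultimately show ?thesis by (simp add: right_diff_distrib)
    qed
    finally show ?thesis by simp
  qed
  show ?thesis unfolding \<Psi>_def[abs_def] using D0 unfolding e1 e2 .
qed

text \<open>The main part \<open>T0\<close> has slope at least \<open>c / 16\<close>; all other
  contributions are multiples of \<open>C * |\<epsilon>|\<close>, and the smallness condition
  \<open>1200 * C * |\<epsilon>| \<le> c\<close> lets them be absorbed. The slope falls to
  \<open>c / 20\<close> after the correction in the numerator and to \<open>c / 40\<close> after the
  division; the prefactor \<open>lm / 2\<close> gives 80.\<close>

lemma R_decr:
  assumes t: "\<alpha> \<le> t" "t \<le> u" "u \<le> \<beta>"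
  shows "R t - R u \<ge> lm * c / 80 * (u - t)"
proof -
  have tb: "\<alpha> \<le> t" "t \<le> \<beta>" and ub: "\<alpha> \<le> u" "u \<le> \<beta>" using t by auto
  define Dt Du where "Dt = av (s t) (\<Delta> t)" and "Du = av (s u) (\<Delta> u)"
  have T0: "T0 t - T0 u \<ge> c / 16 * (u - t)"
  proof -
    have "integral {0..1::real} (\<lambda>\<theta>. c / 16 * (u - t)) \<le> integral {0..1} (\<lambda>\<theta>. \<tau> \<theta> t - \<tau> \<theta> u)"
      by (intro integral_le integrable_diff T0_props tb ub integrable_const_ivl) (use \<tau>_decr[OF t] in auto)
    also have "\<dots> = T0 t - T0 u" unfolding T0_def by (intro Henstock_Kurzweil_Integration.integral_diff T0_props tb ub)
    finally show ?thesis by simp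
  qed
  have avb: "\<bar>av (s x) (\<Delta> x)\<bar> \<le> C" "\<bar>T0 x\<bar> \<le> 2 * C" if x: "\<alpha> \<le> x" "x \<le> \<beta>" for x
  proof -
    have bnd: "\<bar>av a d\<bar> \<le> C" if "a > 0" "a + d > 0" "\<And>\<theta>. 0 \<le> \<theta> \<Longrightarrow> \<theta> \<le> 1 \<Longrightarrow> 1/2 \<le> a + \<theta> * d \<and> a + \<theta> * d \<le> 1" for a d
    proof -
      have "norm (av a d) \<le> integral {0..1::real} (\<lambda>_. C)"
        unfolding av_def by (intro Henstock_Kurzweil_Integration.integral_norm_bound_integral av_props that integrable_const_ivl) (use bd2 that in auto)
      then show ?thesis by simp
    qed
    show "\<bar>av (s x) (\<Delta> x)\<bar> \<le> C"
      by (rule bnd) (use y_bd(5,6)[OF x] y_bd(5)[OF x, of 0] y_bd(5)[OF x, of 1] in auto)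
    have tau: "\<bar>\<tau> \<theta> x\<bar> \<le> 2 * C" if "0 \<le> \<theta>" "\<theta> \<le> 1" for \<theta>
    proof -
      define y where "y = s x + \<theta> * h x"
      note yb = y_bd(1-4)[OF x that, folded y_def] and \<Delta>p = \<Delta>_pos[OF x]
      have "\<exists>z>y. z < y + \<Delta> x \<and> \<phi>2 (y + \<Delta> x) - \<phi>2 y = (y + \<Delta> x - y) * \<phi>3 z"
        by (rule MVT2) (use d2 \<Delta>p yb in auto)
      then obtain z where z: "y < z" "z < y + \<Delta> x" "\<phi>2 (y + \<Delta> x) - \<phi>2 y = (y + \<Delta> x - y) * \<phi>3 z" by blast
      have "\<tau> \<theta> x = \<phi>2 y - x * \<phi>3 z" unfolding \<tau>_def y_def[symmetric] z(3) using \<Delta>p by simp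
      moreover have "\<bar>\<phi>2 y\<bar> \<le> C" using bd2 yb by auto
      moreover have "\<bar>x * \<phi>3 z\<bar> \<le> 1 * C" unfolding abs_mult using bd3[of z] z yb t1[OF x] C by (intro mult_mono) auto
      ultimately show ?thesis by linarith
    qed
    have "norm (T0 x) \<le> integral {0..1::real} (\<lambda>_. 2 * C)"
      unfolding T0_def by (intro Henstock_Kurzweil_Integration.integral_norm_bound_integral T0_props x integrable_const_ivl) (use tau in auto)
    then show "\<bar>T0 x\<bar> \<le> 2 * C" by simp
  qed
  have lip: "\<bar>f u - f t\<bar> \<le> K * (u - t)" if der: "\<And>x. t \<le> x \<Longrightarrow> x \<le> u \<Longrightarrow> \<exists>D. (f has_real_derivative D) (at x) \<and> \<bar>D\<bar> \<le> K" for f :: "real \<Rightarrow> real" and K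
  proof -
    have "f u - K * u \<le> f t - K * t"
    proof (rule DERIV_nonpos_imp_nonincreasing[OF t(2)])
      fix x assume "t \<le> x" "x \<le> u"
      then obtain D where "(f has_real_derivative D) (at x)" "\<bar>D\<bar> \<le> K" using der by blast
      then show "\<exists>y. ((\<lambda>x. f x - K * x) has_real_derivative y) (at x) \<and> y \<le> 0"
        by (intro exI[of _ "D - K * 1"] conjI DERIV_diff DERIV_cmult DERIV_ident) auto
    qed
    moreover have "f t + K * t \<le> f u + K * u"
    proof (rule DERIV_nonneg_imp_nondecreasing[OF t(2)])
      fix x assume "t \<le> x" "x \<le> u"
      then obtain D where "(f has_real_derivative D) (at x)" "\<bar>D\<bar> \<le> K" using der by blast
      then show "\<exists>y. ((\<lambda>x. f x + K * x) has_real_derivative y) (at x) \<and> 0 \<le> y"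
        by (intro exI[of _ "D + K * 1"] conjI DERIV_add DERIV_cmult DERIV_ident) auto
    qed
    ultimately show ?thesis by (simp add: algebra_simps abs_le_iff)
  qed
  have \<kappa>l: "\<bar>\<kappa> u - \<kappa> t\<bar> \<le> 3 * \<bar>\<epsilon>\<bar> * (u - t)"
  proof (rule lip)
    fix x assume "t \<le> x" "x \<le> u"
    then have "\<alpha> \<le> x" "x \<le> \<beta>" using t by auto
    then show "\<exists>D. (\<kappa> has_real_derivative D) (at x) \<and> \<bar>D\<bar> \<le> 3 * \<bar>\<epsilon>\<bar>" using d\<kappa> \<kappa>d_bd by blast
  qed
  have Dl: "\<bar>Du - Dt\<bar> \<le> 2 * C * (u - t)"
  proof -
    have pw: "\<bar>\<phi>2 (s u + \<theta> * \<Delta> u) - \<phi>2 (s t + \<theta> * \<Delta> t)\<bar> \<le> 2 * C * (u - t)" if \<theta>: "0 \<le> \<theta>" "\<theta> \<le> 1" for \<theta>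
    proof (rule lip[of "\<lambda>t. \<phi>2 (s t + \<theta> * \<Delta> t)"])
      fix x assume "t \<le> x" "x \<le> u"
      then have x: "\<alpha> \<le> x" "x \<le> \<beta>" using t by auto
      note yb = y_bd(5,6)[OF x \<theta>]
      have "((\<lambda>t. s t + \<theta> * \<Delta> t) has_real_derivative 1 - hdot x + \<theta> * (x / tp x - 1)) (at x)"
        by (intro DERIV_add DERIV_cmult ds d\<Delta> x)
      then have yd: "((\<lambda>t. s t + \<theta> * \<Delta> t) has_real_derivative 1 - hdot x + \<theta> * (x / tp x - 1)) (at x)" .
      have 1: "((\<lambda>t. \<phi>2 (s t + \<theta> * \<Delta> t)) has_real_derivative \<phi>3 (s x + \<theta> * \<Delta> x) * (1 - hdot x + \<theta> * (x / tp x - 1))) (at x)"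
        by (rule DERIV_chain2[where f=\<phi>2 and g="\<lambda>t. s t + \<theta> * \<Delta> t", OF d2 yd]) (use yb in auto)
      have "\<bar>x / tp x - 1\<bar> \<le> 1/2" using ratio(1,2)[OF x] by linarith
      then have "\<bar>\<theta> * (x / tp x - 1)\<bar> \<le> 1 * (1/2)"
        unfolding abs_mult using \<theta> by (intro mult_mono) auto
      then have "\<bar>1 - hdot x + \<theta> * (x / tp x - 1)\<bar> \<le> 2" using hd_bd'[OF x] by linarith
      then have "\<bar>\<phi>3 (s x + \<theta> * \<Delta> x) * (1 - hdot x + \<theta> * (x / tp x - 1))\<bar> \<le> C * 2"
        unfolding abs_mult using bd3 yb C by (intro mult_mono) auto
      then show "\<exists>D. ((\<lambda>t. \<phi>2 (s t + \<theta> * \<Delta> t)) has_real_derivative D) (at x) \<and> \<bar>D\<bar> \<le> 2 * C" using 1 by (auto simp: mult.commute)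
    qed
    have i: "(\<lambda>\<theta>. \<phi>2 (s x + \<theta> * \<Delta> x)) integrable_on {0..1}" if x: "\<alpha> \<le> x" "x \<le> \<beta>" for x
      by (rule av_props) (use y_bd(5)[OF x, of 0] y_bd(5)[OF x, of 1] in auto)
    have "Du - Dt = integral {0..1} (\<lambda>\<theta>. \<phi>2 (s u + \<theta> * \<Delta> u) - \<phi>2 (s t + \<theta> * \<Delta> t))"
      unfolding Du_def Dt_def av_def by (intro Henstock_Kurzweil_Integration.integral_diff[symmetric] i tb ub)
    also have "norm \<dots> \<le> integral {0..1::real} (\<lambda>_. 2 * C * (u - t))"
      by (intro Henstock_Kurzweil_Integration.integral_norm_bound_integral integrable_diff i tb ub integrable_const_ivl) (use pw in auto)
    finally show ?thesis by simp
  qed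
  define X where "X x = T0 x - \<kappa> x * av (s x) (\<Delta> x)" for x
  define \<delta> where "\<delta> = u - t"
  have \<delta>: "\<delta> \<ge> 0" using t by (simp add: \<delta>_def)
  have Xd: "X t - X u \<ge> (c / 16 - 9 * C * \<bar>\<epsilon>\<bar>) * \<delta>"
  proof -
    have "X t - X u = (T0 t - T0 u) + \<kappa> t * (Du - Dt) + (\<kappa> u - \<kappa> t) * Du"
      by (simp add: X_def Dt_def Du_def algebra_simps)
    moreover have "\<bar>\<kappa> t * (Du - Dt)\<bar> \<le> (3 * \<bar>\<epsilon>\<bar>) * (2 * C * \<delta>)"
      unfolding abs_mult using \<kappa>_bd[OF tb] Dl C \<delta> by (intro mult_mono) (auto simp: \<delta>_def)
    moreover have "\<bar>(\<kappa> u - \<kappa> t) * Du\<bar> \<le> (3 * \<bar>\<epsilon>\<bar> * \<delta>) * C"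
      unfolding abs_mult using \<kappa>l avb(1)[OF ub] C \<delta> by (intro mult_mono) (auto simp: \<delta>_def Du_def)
    ultimately show ?thesis using T0 unfolding \<delta>_def by (simp add: algebra_simps abs_le_iff)
  qed
  have Xb: "\<bar>X u\<bar> \<le> 3 * C"
  proof -
    have "\<bar>\<kappa> u * av (s u) (\<Delta> u)\<bar> \<le> 1 * C"
      unfolding abs_mult using \<kappa>_bd'[OF ub] avb(1)[OF ub] C by (intro mult_mono) auto
    then show ?thesis using avb(2)[OF ub] unfolding X_def by linarith
  qed
  have kt: "97/100 \<le> 1 - \<kappa> t" "1 - \<kappa> t \<le> 103/100" and ku: "97/100 \<le> 1 - \<kappa> u"
    using \<kappa>_bd'[OF tb] \<kappa>_bd'[OF ub] by auto
  \<comment> \<open>This separates the change of the numerator, which carries the slope, from the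
    change of the denominator, which is an error of order \<epsilon>.\<close>
  have eq: "X t / (1 - \<kappa> t) - X u / (1 - \<kappa> u) = (X t - X u) / (1 - \<kappa> t) + X u * (\<kappa> t - \<kappa> u) / ((1 - \<kappa> t) * (1 - \<kappa> u))"
  proof -
    have gen: "x / a - y / b = (x - y) / a + y * (b - a) / (a * b)" if "a \<noteq> 0" "b \<noteq> 0" for a b x y :: real
      using that by (simp add: field_simps)
    show ?thesis using gen[of "1 - \<kappa> t" "1 - \<kappa> u" "X t" "X u"] kt ku by simp
  qed
  have ce: "1200 * C * \<bar>\<epsilon>\<bar> \<le> c" using eps(3) C by (simp add: field_simps)
  have a0: "c / 20 * \<delta> \<le> (c / 16 - 9 * C * \<bar>\<epsilon>\<bar>) * \<delta>"
    using ce c \<delta> by (intro mult_right_mono) auto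
  have "0 \<le> c / 20 * \<delta>" using c \<delta> by simp
  then have Xp: "0 \<le> X t - X u" using a0 Xd by linarith
  have "(X t - X u) / (1 - \<kappa> t) \<ge> (c / 20 * \<delta>) / (103/100)"
    using order_trans[OF a0 Xd] Xp kt by (intro frac_le) auto
  moreover have "\<bar>X u * (\<kappa> t - \<kappa> u) / ((1 - \<kappa> t) * (1 - \<kappa> u))\<bar> \<le> (3 * C * (3 * \<bar>\<epsilon>\<bar> * \<delta>)) / (97/100 * (97/100))"
  proof -
    have "97/100 * (97/100) \<le> (1 - \<kappa> t) * (1 - \<kappa> u)" using kt ku by (intro mult_mono) auto
    moreover have "\<bar>X u * (\<kappa> t - \<kappa> u)\<bar> \<le> 3 * C * (3 * \<bar>\<epsilon>\<bar> * \<delta>)"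
      unfolding abs_mult using Xb \<kappa>l C by (intro mult_mono) (auto simp: \<delta>_def abs_minus_commute)
    moreover have "0 < (1 - \<kappa> t) * (1 - \<kappa> u)" using kt ku by (intro mult_pos_pos) auto
    ultimately show ?thesis unfolding abs_divide using C \<delta> by (intro frac_le) auto
  qed
  moreover have "(3 * C * (3 * \<bar>\<epsilon>\<bar> * \<delta>)) / (97/100 * (97/100)) \<le> c / 100 * \<delta>"
  proof -
    have "1200 * (C * (\<bar>\<epsilon>\<bar> * \<delta>)) \<le> c * \<delta>" using mult_right_mono[OF ce \<delta>] by (simp add: mult_ac)
    moreover have "0 \<le> c * \<delta>" using c \<delta> by simp
    ultimately have k: "90000 / 9409 * (C * (\<bar>\<epsilon>\<bar> * \<delta>)) \<le> c * \<delta> / 100" by linarith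
    have "(3 * C * (3 * \<bar>\<epsilon>\<bar> * \<delta>)) / (97/100 * (97/100)) = 90000 / 9409 * (C * (\<bar>\<epsilon>\<bar> * \<delta>))" by simp
    also note k
    also have "c * \<delta> / 100 = c / 100 * \<delta>" by simp
    finally show ?thesis .
  qed
  ultimately have lo: "X t / (1 - \<kappa> t) - X u / (1 - \<kappa> u) \<ge> (c / 20 * \<delta>) / (103/100) - c / 100 * \<delta>"
    unfolding eq by linarith
  \<comment> \<open>The fraction 397/10300 is 5/103 - 1/100, the slope that is left after both
    losses.\<close>
  have "c / 40 * \<delta> = c * \<delta> * (1/40)" by simp
  also have "\<dots> \<le> c * \<delta> * (397/10300)" using c \<delta> by (intro mult_left_mono) auto
  also have "\<dots> = (c / 20 * \<delta>) / (103/100) - c / 100 * \<delta>" by simp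
  also note lo
  finally have "X t / (1 - \<kappa> t) - X u / (1 - \<kappa> u) \<ge> c / 40 * \<delta>" .
  then have "lm / 2 * (X t / (1 - \<kappa> t) - X u / (1 - \<kappa> u)) \<ge> lm / 2 * (c / 40 * \<delta>)"
    using lam by (intro mult_left_mono) auto
  moreover have "lm / 2 * (c / 40 * \<delta>) = lm * c / 80 * (u - t)" by (simp add: \<delta>_def)
  ultimately show ?thesis unfolding R_def X_def[symmetric] by (simp only: right_diff_distrib)
qed

text \<open>The sign of \<open>h\<close>, constant along the curve because \<open>h\<close> is a
  positive multiple of \<open>\<epsilon> * e\<close>. Multiplication by it replaces the absolute
  value by a differentiable expression.\<close>

definition "sg = (if \<epsilon> * e > 0 then 1 else -1 :: real)"

lemma sg_h: assumes "\<alpha> \<le> t" "t \<le> \<beta>" shows "sg * h t = \<bar>h t\<bar>"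
proof -
  have "h t * (1 - \<epsilon> * (t + s t)) = \<epsilon> * e" "1 - \<epsilon> * (t + s t) > 0"
    using h_eq2[OF assms] P_bd[OF assms] by auto
  then have "h t > 0 \<longleftrightarrow> \<epsilon> * e > 0" by (metis zero_less_mult_iff less_asym)
  moreover have "h t \<noteq> 0" using h_eq2[OF assms] eps(1) e by auto
  ultimately show ?thesis by (auto simp: sg_def)
qed

text \<open>Chosen so that \<open>Ed = sg * (2 * W / (S * tp))\<close>. The Jacobian weight
  \<open>1 / (2 * tp * S)\<close> is then \<open>sg * Ed / (4 * W)\<close>, and
  \<open>1 / (4 * W)\<close> can serve as the increasing factor \<open>b\<close> of the van der
  Corput estimate.\<close>

definition "W t = \<bar>h t\<bar> * \<Delta> t * (S t - 2 * \<epsilon> * tp t)"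

lemma W_props:
  assumes t: "\<alpha> \<le> t" "t \<le> \<beta>"
  shows "88/100 \<le> S t - 2 * \<epsilon> * tp t" "S t - 2 * \<epsilon> * tp t \<le> 112/100" "W t \<ge> \<bar>\<epsilon>\<bar> * \<bar>e\<bar> * p / 4" "W t > 0"
proof -
  have "\<bar>\<epsilon> * tp t\<bar> \<le> 1/100" by (rule eps_t[OF t]) (use t1[OF t] tp_gt[OF t] in auto)
  then show b: "88/100 \<le> S t - 2 * \<epsilon> * tp t" "S t - 2 * \<epsilon> * tp t \<le> 112/100"
    using S_bd[OF t] by (auto simp: abs_le_iff)
  have "(\<bar>\<epsilon>\<bar> * \<bar>e\<bar> * (98/100)) * (p / 2) * (88/100) \<le> W t"
    unfolding W_def using b h_bd[OF t] \<Delta>_ge[OF t] p by (intro mult_mono mult_nonneg_nonneg) auto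
  moreover have "(\<bar>\<epsilon>\<bar> * \<bar>e\<bar> * (98/100)) * (p / 2) * (88/100) = (\<bar>\<epsilon>\<bar> * \<bar>e\<bar> * p) * (539/1250)" by simp
  moreover have "0 < \<bar>\<epsilon>\<bar> * \<bar>e\<bar> * p" using eps(1) e p by simp
  ultimately show "W t \<ge> \<bar>\<epsilon>\<bar> * \<bar>e\<bar> * p / 4" "W t > 0" by linarith+
qed

text \<open>Compare relative rates: \<Delta> shrinks at rate \<open>1 / tp\<close>, which is at
  least 1, whereas \<open>h\<close> and the last factor vary only at rates of order \<epsilon>. The
  shrinking wins.\<close>

lemma W_decr:
  assumes "\<alpha> \<le> t" "t \<le> u" "u \<le> \<beta>"
  shows "W u \<le> W t"
proof -
  define V where "V t = (sg * h t) * \<Delta> t * (S t - 2 * \<epsilon> * tp t)" for t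
  have "V u \<le> V t"
  proof (rule DERIV_nonpos_imp_nonincreasing[OF assms(2)])
    fix x assume "t \<le> x" "x \<le> u"
    then have x: "\<alpha> \<le> x" "x \<le> \<beta>" using assms by auto
    define Q where "Q = S x - 2 * \<epsilon> * tp x"
    define q where "q = - 2 * \<epsilon> * (1 - 2 * \<epsilon> * x) / S x - 2 * \<epsilon> * (x / tp x)"
    define D where "D = (sg * hdot x * \<Delta> x + (x / tp x - 1) * (sg * h x)) * Q + q * (sg * h x * \<Delta> x)"
    have "(V has_real_derivative D) (at x)"
      unfolding V_def[abs_def] D_def Q_def q_def
      by (intro DERIV_mult DERIV_cmult DERIV_diff dh[OF x] d\<Delta>[OF x] dS[OF x] dtp[OF x])
    moreover have "D = (sg * h x * \<Delta> x) * ((2 * \<epsilon> / S x - 1 / tp x) * Q + q)"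
      unfolding D_def hdot_def ratio(3)[OF x] using tp_gt[OF x] t1[OF x] S_bd[OF x] by (simp add: field_simps)
    moreover have "(2 * \<epsilon> / S x - 1 / tp x) * Q + q \<le> 0"
    proof -
      have "\<bar>2 * \<epsilon> / S x\<bar> \<le> (2/100) / (98/100)"
        unfolding abs_divide using eps(2) S_bd[OF x] by (intro frac_le) (auto simp: abs_mult)
      then have "2 * \<epsilon> / S x \<le> (2/100) / (98/100)" by (rule order_trans[OF abs_ge_self])
      moreover have "1 \<le> 1 / tp x" using tp_gt[OF x] t1[OF x] by simp
      ultimately have "2 * \<epsilon> / S x - 1 / tp x \<le> (2/100) / (98/100) - 1" by (rule diff_mono)
      also have "\<dots> \<le> - (9/10)" by simp
      finally have "2 * \<epsilon> / S x - 1 / tp x \<le> - (9/10)" .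
      then have 1: "(2 * \<epsilon> / S x - 1 / tp x) * Q \<le> - (9/10 * (88/100))"
      proof -
        define z where "z = 2 * \<epsilon> / S x - 1 / tp x"
        have "9/10 * (88/100) \<le> - z * Q"
          using W_props(1)[OF x] \<open>2 * \<epsilon> / S x - 1 / tp x \<le> - (9/10)\<close> unfolding z_def Q_def by (intro mult_mono) auto
        then have "z * Q \<le> - (9/10 * (88/100))" by simp
        then show ?thesis unfolding z_def .
      qed
      have u1: "\<bar>- 2 * \<epsilon> * (1 - 2 * \<epsilon> * x) / S x\<bar> \<le> ((2/100) * (102/100)) / (98/100)"
        unfolding abs_divide abs_mult using eps(2) S_bd[OF x] a_t[OF x] by (intro frac_le mult_mono) auto
      have u2: "\<bar>2 * \<epsilon> * (x / tp x)\<bar> \<le> (2/100) * 1"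
        unfolding abs_mult using eps(2) ratio(1,2)[OF x] by (intro mult_mono) auto
      have "q \<le> ((2/100) * (102/100)) / (98/100) + (2/100) * 1"
        using add_mono[OF abs_le_D1[OF u1] abs_le_D2[OF u2]] by (simp only: q_def add_uminus_conv_diff)
      then have "q \<le> 1/10" by simp
      then show ?thesis using 1 by linarith
    qed
    moreover have "0 \<le> sg * h x * \<Delta> x" unfolding sg_h[OF x] using \<Delta>_pos[OF x] by simp
    ultimately show "\<exists>y. (V has_real_derivative y) (at x) \<and> y \<le> 0" by (metis mult_nonneg_nonpos)
  qed
  then show ?thesis using sg_h[of t] sg_h[of u] assms by (simp add: V_def W_def)
qed

lemma curve_points_mono:
  assumes "\<alpha> \<le> t" "t \<le> u" "u \<le> \<beta>"
  shows "s t \<le> s u" "tp t \<le> tp u" "sp t \<le> sp u"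
proof -
  have x: "\<alpha> \<le> x" "x \<le> \<beta>" if "t \<le> x" "x \<le> u" for x using that assms by auto
  show "s t \<le> s u"
  proof (rule DERIV_nonneg_imp_nondecreasing[OF assms(2)], rule exI, rule conjI, rule ds)
    fix z assume z: "t \<le> z" "z \<le> u"
    show "0 \<le> 1 - hdot z" using hd_bd'[OF x[OF z]] by linarith
  qed (use x in auto)
  show "tp t \<le> tp u"
  proof (rule DERIV_nonneg_imp_nondecreasing[OF assms(2)], rule exI, rule conjI, rule dtp)
    fix z assume z: "t \<le> z" "z \<le> u"
    show "0 \<le> z / tp z" using ratio(1)[OF x[OF z]] by linarith
  qed (use x in auto)
  show "sp t \<le> sp u"
  proof (rule DERIV_nonneg_imp_nondecreasing[OF assms(2)], rule exI, rule conjI, rule dsp)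
    fix z assume z: "t \<le> z" "z \<le> u"
    show "0 \<le> z / tp z - hdot z" using hd_bd'[OF x[OF z]] ratio(1)[OF x[OF z]] by linarith
  qed (use x in auto)
qed

definition "w t = 1 / (t * s t * tp t * sp t)"

lemma w_props:
  assumes t: "\<alpha> \<le> t" "t \<le> \<beta>"
  shows "0 \<le> w t" "w t \<le> 16"
proof -
  have "(1/2) * (1/2) * (1/2) * (1/2) \<le> t * s t * tp t * sp t"
    using t1[OF t] tp_gt[OF t] by (intro mult_mono mult_nonneg_nonneg) auto
  then have le: "1/16 \<le> t * s t * tp t * sp t" by simp
  then have "1 / (t * s t * tp t * sp t) \<le> 1 / (1/16)" by (intro frac_le) auto
  then show "w t \<le> 16" by (simp add: w_def)
  have "0 \<le> t * s t * tp t * sp t" using le by linarith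
  then show "0 \<le> w t" unfolding w_def by (rule divide_nonneg_nonneg[OF zero_le_one])
qed

lemma w_decr:
  assumes "\<alpha> \<le> t" "t \<le> u" "u \<le> \<beta>"
  shows "w u \<le> w t"
proof -
  have tt: "\<alpha> \<le> t" "t \<le> \<beta>" and uu: "\<alpha> \<le> u" "u \<le> \<beta>" using assms by auto
  have "t * s t * tp t * sp t \<le> u * s u * tp u * sp u"
    using curve_points_mono[OF assms] assms t1[OF tt] t1[OF uu] tp_gt[OF tt] tp_gt[OF uu] by (intro mult_mono mult_nonneg_nonneg) auto
  moreover have "0 < t * s t * tp t * sp t" "0 < u * s u * tp u * sp u"
    using t1[OF tt] t1[OF uu] tp_gt[OF tt] tp_gt[OF uu] by auto
  ultimately show ?thesis unfolding w_def by (intro frac_le) auto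
qed

text \<open>The phase has derivative \<open>Ed * (R - \<xi>)\<close>, so the frequency merely shifts
  \<open>R\<close> and the estimate is uniform in \<xi>. With \<open>am = 2\<close>,
  \<open>wm = 16\<close>, \<open>bm = 1 / (|\<epsilon>| * |e| * p)\<close> and
  \<open>\<mu> = lm * c / 80\<close> the constant is
  \<open>2 * (64 + 2 * 2) * 16 = 2176\<close>.\<close>

lemma multiplier_bound:
  "norm (integral {\<alpha>..\<beta>} (\<lambda>t. of_real (w t * (1 / (2 * tp t * S t))) * cis (\<Psi> t - \<xi> * Ef t)))
    \<le> 2176 * sqrt (80 / c) * sqrt (1 / (lm * \<bar>\<epsilon>\<bar> * \<bar>e\<bar> * p))"
proof -
  define a where "a t = sg * (1 / (2 * tp t * S t))" for t
  define b where "b t = 1 / (4 * W t)" for t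
  define bm where "bm = 1 / (\<bar>\<epsilon>\<bar> * \<bar>e\<bar> * p)"
  have E0: "0 < \<bar>\<epsilon>\<bar> * \<bar>e\<bar> * p" using eps(1) e p by simp
  have cont: "continuous_on {\<alpha>..\<beta>} f" if "\<And>t. \<alpha> \<le> t \<Longrightarrow> t \<le> \<beta> \<Longrightarrow> (f has_real_derivative D t) (at t)" for f D
    by (rule DERIV_continuous_on) (use that in \<open>auto intro: has_field_derivative_at_within\<close>)
  note conts = cont[OF ds] cont[OF dtp] cont[OF dsp] cont[OF dS]
  have "norm (integral {\<alpha>..\<beta>} (\<lambda>t. of_real (w t * a t) * cis (\<Psi> t - \<xi> * Ef t)))
     \<le> 2 * ((64 + 2 * 2) * 16 * sqrt (bm / (lm * c / 80)))"
  proof (rule van_der_corput[where Ed=Ed and R=R and \<xi>=\<xi> and b=b, OF ab])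
    fix t assume t: "\<alpha> \<le> t" "t \<le> \<beta>"
    note t1 = t1[OF t] tp_gt[OF t] and S = S_bd[OF t] and Wp = W_props[OF t]
    have "((\<lambda>t. \<Psi> t - \<xi> * Ef t) has_real_derivative Ed t * R t - \<xi> * Ed t) (at t)"
      by (intro DERIV_diff DERIV_cmult d\<Psi> dEf t)
    then show "((\<lambda>t. \<Psi> t - \<xi> * Ef t) has_real_derivative Ed t * (R t - \<xi>)) (at t within {\<alpha>..\<beta>})"
    proof -
      assume d: "((\<lambda>t. \<Psi> t - \<xi> * Ef t) has_real_derivative Ed t * R t - \<xi> * Ed t) (at t)"
      have "Ed t * R t - \<xi> * Ed t = Ed t * (R t - \<xi>)" by (simp add: right_diff_distrib mult.commute)
      then show ?thesis using has_field_derivative_at_within[OF d] by simp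
    qed
    have "b t \<le> 1 / (4 * (\<bar>\<epsilon>\<bar> * \<bar>e\<bar> * p / 4))" unfolding b_def using Wp E0 by (intro frac_le) auto
    then show "0 \<le> b t \<and> b t \<le> bm" using Wp by (simp add: b_def bm_def)
    show "0 \<le> w t \<and> w t \<le> 16" using w_props[OF t] by simp
    show "a t = b t * Ed t"
    proof -
      define Q where "Q = S t - 2 * \<epsilon> * tp t"
      have Q: "(1 - \<kappa> t) / tp t = Q / (S t * tp t)" using S t1 by (simp add: \<kappa>_def Q_def field_simps)
      have "h t = sg * \<bar>h t\<bar>" using sg_h[OF t] by (auto simp: sg_def split: if_splits)
      then have "Ed t = sg * (2 * W t / (S t * tp t))"
        unfolding Ed_def W_def Q_def[symmetric] Q by simp
      then show ?thesis using Wp by (simp add: a_def b_def)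
    qed
    have "1 / (2 * tp t * S t) \<le> 1 / (2 * (1/2) * (98/100))" using S t1 by (intro frac_le mult_mono mult_pos_pos) auto
    moreover have "0 \<le> 1 / (2 * tp t * S t)" using S t1 by simp
    ultimately show "\<bar>a t\<bar> \<le> 2" unfolding a_def by (auto simp: sg_def)
  next
    fix t u assume tu: "\<alpha> \<le> t" "t \<le> u" "u \<le> \<beta>"
    show "lm * c / 80 * (u - t) \<le> R t - R u" by (rule R_decr[OF tu])
    show "w u \<le> w t" by (rule w_decr[OF tu])
    show "b t \<le> b u" unfolding b_def
      using W_decr[OF tu] W_props(4)[of t] W_props(4)[of u] tu by (intro frac_le) auto
  next
    have nz: "t \<noteq> 0" "s t \<noteq> 0" "tp t \<noteq> 0" "sp t \<noteq> 0" "S t \<noteq> 0" if "\<alpha> \<le> t" "t \<le> \<beta>" for t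
      using t1[OF that] tp_gt[OF that] S_bd[OF that] by auto
    show "continuous_on {\<alpha>..\<beta>} w" unfolding w_def by (intro continuous_intros conts) (use nz in auto)
    show "continuous_on {\<alpha>..\<beta>} a" unfolding a_def by (intro continuous_intros conts) (use nz in auto)
  qed (use E0 lam c in \<open>auto simp: bm_def\<close>)
  moreover have "bm / (lm * c / 80) = (80 / c) * (1 / (lm * \<bar>\<epsilon>\<bar> * \<bar>e\<bar> * p))"
    unfolding bm_def by (simp add: field_simps)
  moreover have gen: "2 * ((64 + 2 * 2) * 16 * (x * y)) = 2176 * x * y" for x y :: real by simp
  ultimately have "norm (integral {\<alpha>..\<beta>} (\<lambda>t. of_real (w t * a t) * cis (\<Psi> t - \<xi> * Ef t)))
    \<le> 2176 * sqrt (80 / c) * sqrt (1 / (lm * \<bar>\<epsilon>\<bar> * \<bar>e\<bar> * p))" by (simp only: real_sqrt_mult gen)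
  moreover have "integral {\<alpha>..\<beta>} (\<lambda>t. of_real (w t * a t) * cis (\<Psi> t - \<xi> * Ef t)) =
     of_real sg * integral {\<alpha>..\<beta>} (\<lambda>t. of_real (w t * (1 / (2 * tp t * S t))) * cis (\<Psi> t - \<xi> * Ef t))"
    unfolding a_def by (subst Henstock_Kurzweil_Integration.integral_mult_right[symmetric]) (simp add: mult_ac)
  moreover have "norm (complex_of_real sg) = 1" by (simp add: sg_def)
  ultimately show ?thesis by (simp only: norm_mult mult_1_left)
qed

end

section \<open>The TT* argument\<close>

lemma integral_bounded_supp:
  fixes F :: "real \<Rightarrow> 'b::{banach,second_countable_topology}"
  assumes "F \<in> borel_measurable borel" "\<And>x. norm (F x) \<le> B" "\<And>x. F x \<noteq> 0 \<Longrightarrow> \<bar>x\<bar> \<le> R" "0 \<le> R"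
  shows "norm (LINT x|lborel. F x) \<le> 2 * R * B"
proof -
  have "norm (LINT x|lborel. F x) \<le> (LINT x|lborel. indicator {-R..R} x * B)"
  proof (rule Bochner_Integration.integral_norm_bound_integral)
    show "integrable lborel F" by (rule integrable_lborel_bounded_supp[OF assms(1-3)])
    show "norm (F x) \<le> indicator {-R..R} x * B" for x
      using assms(2)[of x] assms(3)[of x] by (cases "F x = 0") (auto simp: indicator_def abs_le_iff)
    show "integrable lborel (\<lambda>x. indicator {-R..R} x * B)"
      by (rule integrable_lborel_bounded_supp[of _ "\<bar>B\<bar>" R]) (auto simp: indicator_def split: if_splits)
  qed
  also have "\<dots> = 2 * R * B" using assms(4) by simp
  finally show ?thesis .
qed

locale bounded_kernel =
  fixes K :: "real \<Rightarrow> real \<Rightarrow> complex" and B R :: real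
  assumes K[measurable]: "(\<lambda>(x,u). K x u) \<in> borel_measurable (borel \<Otimes>\<^sub>M borel)"
    and KB: "\<And>x u. norm (K x u) \<le> B"
    and KR: "\<And>x u. K x u \<noteq> 0 \<Longrightarrow> \<bar>x\<bar> \<le> R \<and> \<bar>u\<bar> \<le> R" and R: "0 \<le> R"
begin

text \<open>The Gram kernel of the columns of \<open>K\<close>: up to conjugation, the kernel of the
  adjoint composed with the operator that has kernel \<open>K\<close>.\<close>

definition "L u1 u2 = (LINT x|lborel. K x u1 * cnj (K x u2))"

lemma B0: "0 \<le> B" using KB[of 0 0] norm_ge_zero[of "K 0 0"] by linarith

lemma KK: "norm (K x u * cnj (K y v)) \<le> B * B"
  unfolding norm_mult using KB[of x u] KB[of y v] B0 by (intro mult_mono) auto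

lemma L_meas[measurable]: "(\<lambda>(u1,u2). L u1 u2) \<in> borel_measurable (borel \<Otimes>\<^sub>M borel)"
  unfolding L_def by measurable

lemma L_bound: "norm (L u1 u2) \<le> 2 * R * (B * B)"
  unfolding L_def by (rule integral_bounded_supp) (use KK KR R in auto)

lemma L_supp: "L u1 u2 \<noteq> 0 \<Longrightarrow> \<bar>u1\<bar> \<le> R \<and> \<bar>u2\<bar> \<le> R"
proof (rule ccontr)
  assume a: "L u1 u2 \<noteq> 0" "\<not> (\<bar>u1\<bar> \<le> R \<and> \<bar>u2\<bar> \<le> R)"
  have z: "K x u1 * cnj (K x u2) = 0" for x using a(2) KR[of x u1] KR[of x u2] by auto
  have "L u1 u2 = (LINT (x::real)|lborel. 0)" unfolding L_def by (simp only: z)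
  then show False using a by simp
qed

lemma L_sym: "L u2 u1 = cnj (L u1 u2)"
  unfolding L_def Bochner_Integration.integral_cnj[symmetric] by (simp add: mult.commute)

lemma L_sym_norm: "norm (L u2 u1) = norm (L u1 u2)"
  by (simp add: L_sym[of u2])

text \<open>When the square is expanded, \<open>f\<close> survives only as the coefficient
  \<open>f u1 * cnj (f u2)\<close> of modulus at most 1, and absolute values remove it. Nothing but
  boundedness of \<open>f\<close> enters the estimate.\<close>

lemma TT_star_bound:
  assumes f[measurable]: "f \<in> borel_measurable borel" and f1: "\<And>x. norm (f x) \<le> 1"
  shows "(LINT x|lborel. (norm (LINT u|lborel. f u * K x u))\<^sup>2) \<le> (LINT u1|lborel. LINT u2|lborel. norm (L u1 u2))"
proof -
  define A where "A x = (LINT u|lborel. f u * K x u)" for x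
  have [measurable]: "A \<in> borel_measurable borel" unfolding A_def by measurable
  have fK: "norm (f u * K x u) \<le> B" for x u
    unfolding norm_mult using mult_mono[OF f1[of u] KB[of x u]] by simp
  have AB: "norm (A x) \<le> 2 * R * B" for x
    unfolding A_def by (rule integral_bounded_supp) (use fK KR R in auto)
  have AR: "A x \<noteq> 0 \<Longrightarrow> \<bar>x\<bar> \<le> R" for x
  proof (rule ccontr)
    assume a: "A x \<noteq> 0" "\<not> \<bar>x\<bar> \<le> R"
    have z: "f u * K x u = 0" for u using a(2) KR[of x u] by auto
    have "A x = (LINT (u::real)|lborel. 0)" unfolding A_def by (simp only: z)
    then show False using a by simp
  qed
  have inner: "(LINT x|lborel. K x u1 * cnj (A x)) = (LINT u2|lborel. cnj (f u2) * L u1 u2)" for u1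
  proof -
    have "(LINT x|lborel. K x u1 * cnj (A x)) = (LINT x|lborel. LINT u2|lborel. K x u1 * cnj (f u2 * K x u2))"
      unfolding A_def Bochner_Integration.integral_cnj[symmetric] by (simp only: integral_mult_right_zero)
    also have "\<dots> = (LINT u2|lborel. LINT x|lborel. K x u1 * cnj (f u2 * K x u2))"
    proof (rule swap_bounded_supp[where B="B * B" and R=R])
      show "norm (K x u1 * cnj (f u2 * K x u2)) \<le> B * B" for x u2
        unfolding norm_mult[of "K x u1"] complex_mod_cnj using KB fK B0 by (intro mult_mono) auto
    qed (use KR in auto)
    also have "\<dots> = (LINT u2|lborel. LINT x|lborel. cnj (f u2) * (K x u1 * cnj (K x u2)))"
      by (simp add: mult_ac)
    finally show ?thesis unfolding L_def by (simp only: integral_mult_right_zero)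
  qed
  have "complex_of_real (LINT x|lborel. (norm (A x))\<^sup>2) = (LINT x|lborel. A x * cnj (A x))"
    by (subst integral_complex_of_real[symmetric]) (simp only: complex_norm_square)
  also have "\<dots> = (LINT x|lborel. LINT u1|lborel. f u1 * K x u1 * cnj (A x))"
    unfolding A_def by (simp only: integral_mult_left_zero)
  also have "\<dots> = (LINT u1|lborel. LINT x|lborel. f u1 * K x u1 * cnj (A x))"
  proof (rule swap_bounded_supp[where B="B * (2 * R * B)" and R=R])
    show "norm (f u1 * K x u1 * cnj (A x)) \<le> B * (2 * R * B)" for x u1
      unfolding norm_mult[of "f u1 * K x u1"] complex_mod_cnj using AB fK B0 by (intro mult_mono) auto
  qed (use KR in auto)
  also have "\<dots> = (LINT u1|lborel. LINT u2|lborel. f u1 * cnj (f u2) * L u1 u2)"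
    by (simp only: mult.assoc integral_mult_right_zero inner)
  also have "norm \<dots> \<le> (LINT u1|lborel. LINT u2|lborel. norm (L u1 u2))"
  proof (rule Bochner_Integration.integral_norm_bound_integral)
    have ff: "norm (f u1 * cnj (f u2) * L u1 u2) \<le> norm (L u1 u2)" for u1 u2
      using f1[of u1] f1[of u2] mult_mono[of "norm (f u1)" 1 "norm (f u2)" 1]
      by (simp add: norm_mult mult_left_le_one_le)
    have i1: "integrable (lborel \<Otimes>\<^sub>M lborel) (\<lambda>(u1,u2). f u1 * cnj (f u2) * L u1 u2)"
      by (rule integrable_pair_bounded_supp[where B="2 * R * (B * B)" and R=R])
         (use ff L_bound L_supp order_trans in \<open>auto, blast\<close>)
    have i2: "integrable (lborel \<Otimes>\<^sub>M lborel) (\<lambda>(u1,u2). norm (L u1 u2))"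
      by (rule integrable_pair_bounded_supp[where B="2 * R * (B * B)" and R=R]) (use L_bound L_supp in auto)
    show "integrable lborel (\<lambda>u1. LINT u2|lborel. f u1 * cnj (f u2) * L u1 u2)"
      using lborel_pair.integrable_fst[OF i1] by simp
    show "integrable lborel (\<lambda>u1. LINT u2|lborel. norm (L u1 u2))"
      using lborel_pair.integrable_fst[OF i2] by simp
    show "norm (LINT u2|lborel. f u1 * cnj (f u2) * L u1 u2) \<le> (LINT u2|lborel. norm (L u1 u2))" for u1
      by (rule Bochner_Integration.integral_norm_bound_integral, rule integrable_lborel_bounded_supp[where B="2 * R * (B * B)" and R=R])
         (use ff L_bound L_supp order_trans[OF ff L_bound] in \<open>auto intro!: integrable_lborel_bounded_supp[where B="2 * R * (B * B)" and R=R]\<close>)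
  qed
  finally show ?thesis unfolding A_def by simp
qed

text \<open>The kernel is Hermitian and the diagonal is a null set. Keeping the half
  \<open>u2 < u1\<close> fixes the order \<open>t < tp\<close>, so that
  \<open>p = tp\<^sup>2 - t\<^sup>2\<close> is a positive coordinate.\<close>

lemma triangle_symmetry:
  "(LINT u1|lborel. LINT u2|lborel. norm (L u1 u2)) = 2 * (LINT u1|lborel. LINT u2|lborel. (if u2 < u1 then norm (L u1 u2) else 0))"
proof -
  define M1 where "M1 u1 u2 = (if u2 < u1 then norm (L u1 u2) else 0)" for u1 u2
  have M1m[measurable]: "(\<lambda>(u1,u2). M1 u1 u2) \<in> borel_measurable (borel \<Otimes>\<^sub>M borel)" unfolding M1_def by measurable
  have M1b: "norm (M1 u1 u2) \<le> 2 * R * (B * B)" for u1 u2 using L_bound[of u1 u2] R B0 by (simp add: M1_def)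
  have M1s: "M1 u1 u2 \<noteq> 0 \<Longrightarrow> \<bar>u1\<bar> \<le> R \<and> \<bar>u2\<bar> \<le> R" for u1 u2 using L_supp by (auto simp: M1_def split: if_splits)
  have i1: "integrable (lborel \<Otimes>\<^sub>M lborel) (\<lambda>(u1,u2). M1 u1 u2)"
    by (rule integrable_pair_bounded_supp[OF M1m M1b]) (use M1s in auto)
  have i2: "integrable (lborel \<Otimes>\<^sub>M lborel) (\<lambda>(u1,u2). M1 u2 u1)"
    by (rule integrable_pair_bounded_supp[OF _ M1b]) (use M1s in auto)
  have ii1: "integrable lborel (\<lambda>u2. M1 u1 u2)" for u1
    by (rule integrable_lborel_bounded_supp[OF _ M1b]) (use M1s in auto)
  have ii2: "integrable lborel (\<lambda>u2. M1 u2 u1)" for u1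
    by (rule integrable_lborel_bounded_supp[OF _ M1b]) (use M1s in auto)
  have "(LINT u2|lborel. norm (L u1 u2)) = (LINT u2|lborel. M1 u1 u2 + M1 u2 u1)" for u1
  proof (rule integral_cong_AE)
    have "AE u2 in lborel. u2 \<noteq> u1" by (rule AE_lborel_singleton)
    then show "AE u2 in lborel. norm (L u1 u2) = M1 u1 u2 + M1 u2 u1"
      by eventually_elim (auto simp: M1_def L_sym_norm)
  qed auto
  then have "(LINT u1|lborel. LINT u2|lborel. norm (L u1 u2)) = (LINT u1|lborel. (LINT u2|lborel. M1 u1 u2) + (LINT u2|lborel. M1 u2 u1))"
    using ii1 ii2 by simp
  also have "\<dots> = (LINT u1|lborel. LINT u2|lborel. M1 u1 u2) + (LINT u1|lborel. LINT u2|lborel. M1 u2 u1)"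
    by (rule Bochner_Integration.integral_add) (use lborel_pair.integrable_fst[OF i1] lborel_pair.integrable_fst[OF i2] in simp_all)
  also have "(LINT u1|lborel. LINT u2|lborel. M1 u2 u1) = (LINT u2|lborel. LINT u1|lborel. M1 u2 u1)"
    by (rule swap_bounded_supp[OF _ M1b]) (use M1s in auto)
  finally show ?thesis unfolding M1_def by simp
qed

text \<open>Cauchy--Schwarz over a square of side \<open>2 * R\<close>, in the form
  \<open>2 \<tau> y \<le> \<tau>\<^sup>2 + y\<^sup>2\<close>. The triangle contributes
  \<open>2 * R * sqrt Y\<close>, and symmetry doubles it.\<close>

lemma L1_norm_le:
  assumes Y: "(LINT u1|lborel. LINT u2|lborel. (if u2 < u1 then (norm (L u1 u2))\<^sup>2 else 0)) \<le> Y" "Y > 0" and R1: "R > 0"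
  shows "(LINT u1|lborel. LINT u2|lborel. norm (L u1 u2)) \<le> 4 * R * sqrt Y"
proof -
  define X where "X = (LINT u1|lborel. LINT u2|lborel. (if u2 < u1 then (norm (L u1 u2))\<^sup>2 else 0))"
  \<comment> \<open>This value minimizes \<open>2 R\<^sup>2 \<tau> + Y / (2 \<tau>)\<close>. A
    positive upper bound \<open>Y\<close>, rather than the integral itself, keeps \<tau>
    positive.\<close>
  define \<tau> where "\<tau> = sqrt Y / (2 * R)"
  have \<tau>: "\<tau> > 0" using Y R1 by (simp add: \<tau>_def)
  define I where "I u = (if \<bar>u\<bar> \<le> R then 1 else 0::real)" for u
  have [measurable]: "I \<in> borel_measurable borel" unfolding I_def by measurable
  have Ii: "(LINT u|lborel. I u) = 2 * R"
  proof -
    have "I = indicator {-R..R}" by (auto simp: I_def indicator_def abs_le_iff fun_eq_iff)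
    then show ?thesis using R by simp
  qed
  define Q where "Q u1 u2 = (if u2 < u1 then (norm (L u1 u2))\<^sup>2 else 0)" for u1 u2
  have Qm[measurable]: "(\<lambda>(u1,u2). Q u1 u2) \<in> borel_measurable (borel \<Otimes>\<^sub>M borel)" unfolding Q_def by measurable
  have Qb: "norm (Q u1 u2) \<le> (2 * R * (B * B))\<^sup>2" for u1 u2 using power_mono[OF L_bound[of u1 u2], of 2] by (simp add: Q_def)
  have Qs: "Q u1 u2 \<noteq> 0 \<Longrightarrow> \<bar>u1\<bar> \<le> R \<and> \<bar>u2\<bar> \<le> R" for u1 u2 using L_supp by (auto simp: Q_def split: if_splits)
  define M1 where "M1 u1 u2 = (if u2 < u1 then norm (L u1 u2) else 0)" for u1 u2
  have M1m[measurable]: "(\<lambda>(u1,u2). M1 u1 u2) \<in> borel_measurable (borel \<Otimes>\<^sub>M borel)" unfolding M1_def by measurable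
  have M1b: "norm (M1 u1 u2) \<le> 2 * R * (B * B)" for u1 u2 using L_bound[of u1 u2] R B0 by (simp add: M1_def)
  have M1s: "M1 u1 u2 \<noteq> 0 \<Longrightarrow> \<bar>u1\<bar> \<le> R \<and> \<bar>u2\<bar> \<le> R" for u1 u2 using L_supp by (auto simp: M1_def split: if_splits)
  define N where "N u1 u2 = \<tau> / 2 * (I u1 * I u2) + 1 / (2 * \<tau>) * Q u1 u2" for u1 u2
  have le: "M1 u1 u2 \<le> N u1 u2" for u1 u2
  proof (cases "u2 < u1 \<and> L u1 u2 \<noteq> 0")
    case True
    then have I1: "I u1 = 1" "I u2 = 1" using L_supp by (auto simp: I_def)
    define y where "y = norm (L u1 u2)"
    have "2 * \<tau> * y \<le> \<tau>\<^sup>2 + y\<^sup>2" by (rule sum_squares_bound)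
    then have "y \<le> \<tau> / 2 + 1 / (2 * \<tau>) * y\<^sup>2" using \<tau> by (simp add: field_simps power2_eq_square)
    then show ?thesis using True by (simp add: M1_def N_def Q_def I1 y_def)
  next
    case False
    then show ?thesis using \<tau> by (auto simp: M1_def N_def Q_def I_def)
  qed
  have iI: "integrable (lborel \<Otimes>\<^sub>M lborel) (\<lambda>(u1,u2). I u1 * I u2)"
    by (rule integrable_pair_bounded_supp[where B=1 and R=R]) (auto simp: I_def split: if_splits)
  have iQ: "integrable (lborel \<Otimes>\<^sub>M lborel) (\<lambda>(u1,u2). Q u1 u2)"
    by (rule integrable_pair_bounded_supp[OF Qm Qb]) (use Qs in auto)
  have iM: "integrable (lborel \<Otimes>\<^sub>M lborel) (\<lambda>(u1,u2). M1 u1 u2)"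
    by (rule integrable_pair_bounded_supp[OF M1m M1b]) (use M1s in auto)
  have "(LINT u1|lborel. LINT u2|lborel. M1 u1 u2) = (LINT z|(lborel \<Otimes>\<^sub>M lborel). (case z of (u1,u2) \<Rightarrow> M1 u1 u2))"
    by (rule lborel_pair.integral_fst[OF iM])
  also have "\<dots> \<le> (LINT z|(lborel \<Otimes>\<^sub>M lborel). \<tau> / 2 * (case z of (u1,u2) \<Rightarrow> I u1 * I u2) + 1 / (2 * \<tau>) * (case z of (u1,u2) \<Rightarrow> Q u1 u2))"
    by (rule integral_mono) (use iI iQ iM le in \<open>auto simp: N_def\<close>)
  also have "\<dots> = \<tau> / 2 * (LINT z|(lborel \<Otimes>\<^sub>M lborel). (case z of (u1,u2) \<Rightarrow> I u1 * I u2)) + 1 / (2 * \<tau>) * (LINT z|(lborel \<Otimes>\<^sub>M lborel). (case z of (u1,u2) \<Rightarrow> Q u1 u2))"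
    using iI iQ by simp
  also have "(LINT z|(lborel \<Otimes>\<^sub>M lborel). (case z of (u1,u2) \<Rightarrow> I u1 * I u2)) = (2 * R) * (2 * R)"
    unfolding lborel_pair.integral_fst[OF iI, symmetric] by (simp add: Ii)
  also have "(LINT z|(lborel \<Otimes>\<^sub>M lborel). (case z of (u1,u2) \<Rightarrow> Q u1 u2)) = X"
    using lborel_pair.integral_fst[OF iQ] unfolding X_def Q_def by simp
  also have "\<tau> / 2 * (2 * R * (2 * R)) + 1 / (2 * \<tau>) * X \<le> \<tau> / 2 * (2 * R * (2 * R)) + 1 / (2 * \<tau>) * Y"
    using Y \<tau> unfolding X_def by (intro add_left_mono mult_left_mono) auto
  also have "\<dots> = 2 * R * sqrt Y"
  proof -
    have "Y = sqrt Y * sqrt Y" using Y by simp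
    then have "1 / (2 * \<tau>) * Y = R * sqrt Y" using Y R1 unfolding \<tau>_def by (simp add: field_simps)
    moreover have "\<tau> / 2 * (2 * R * (2 * R)) = R * sqrt Y" using R1 unfolding \<tau>_def by simp
    ultimately show ?thesis by simp
  qed
  finally show ?thesis unfolding triangle_symmetry M1_def by simp
qed

end

section \<open>The quadrilinear form\<close>

lemma subst_lborel:
  fixes F :: "real \<Rightarrow> complex" and G G' :: "real \<Rightarrow> real"
  assumes F[measurable]: "F \<in> borel_measurable borel" and FB: "\<And>x. norm (F x) \<le> B" and ab: "a \<le> b"
    and d: "\<And>x. x \<in> {a..b} \<Longrightarrow> (G has_real_derivative G' x) (at x)" and c: "continuous_on {a..b} G'"
    and nn: "\<And>x. x \<in> {a..b} \<Longrightarrow> G' x \<ge> 0"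
  shows "(LINT y|lborel. indicator {G a..G b} y *\<^sub>R F y) = (LINT x|lborel. indicator {a..b} x *\<^sub>R (G' x *\<^sub>R F (G x)))"
proof -
  have Fi: "set_integrable lborel {x..y} F" for x y
    unfolding set_integrable_def
    by (rule integrable_bounded_supp[of _ _ "{x..y}" "\<bar>B\<bar>"]) (use FB order_trans[OF FB abs_ge_self] in \<open>auto simp: emeasure_lborel_Icc_eq indicator_def\<close>)
  have rr: "set_integrable lborel {x..y} (\<lambda>t. Re (F t))" "set_integrable lborel {x..y} (\<lambda>t. Im (F t))" for x y
    using integrable_Re[OF Fi[unfolded set_integrable_def]] integrable_Im[OF Fi[unfolded set_integrable_def]]
    unfolding set_integrable_def by simp_all
  note R = integral_substitution[OF rr(1) d c nn ab] and I = integral_substitution[OF rr(2) d c nn ab]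
  have ir: "integrable lborel (\<lambda>x. indicator {a..b} x *\<^sub>R (G' x *\<^sub>R F (G x)))"
  proof -
    have "integrable lborel (\<lambda>x. complex_of_real (indicator {a..b} x *\<^sub>R (Re (F (G x)) * G' x)) + \<i> * complex_of_real (indicator {a..b} x *\<^sub>R (Im (F (G x)) * G' x)))"
      by (intro Bochner_Integration.integrable_add integrable_of_real integrable_mult_right R(1)[unfolded set_integrable_def] I(1)[unfolded set_integrable_def])
    moreover have "(\<lambda>x. complex_of_real (indicator {a..b} x *\<^sub>R (Re (F (G x)) * G' x)) + \<i> * complex_of_real (indicator {a..b} x *\<^sub>R (Im (F (G x)) * G' x)))
      = (\<lambda>x. indicator {a..b} x *\<^sub>R (G' x *\<^sub>R F (G x)))"
      by (simp add: fun_eq_iff complex_eq_iff mult_ac)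
    ultimately show ?thesis by simp
  qed
  show ?thesis
  proof (rule complex_eqI)
    show "Re (LINT y|lborel. indicator {G a..G b} y *\<^sub>R F y) = Re (LINT x|lborel. indicator {a..b} x *\<^sub>R (G' x *\<^sub>R F (G x)))"
      using R(2) unfolding integral_Re[OF ir, symmetric] integral_Re[OF Fi[unfolded set_integrable_def], symmetric]
      by (simp add: mult_ac)
    show "Im (LINT y|lborel. indicator {G a..G b} y *\<^sub>R F y) = Im (LINT x|lborel. indicator {a..b} x *\<^sub>R (G' x *\<^sub>R F (G x)))"
      using I(2) unfolding integral_Im[OF ir, symmetric] integral_Im[OF Fi[unfolded set_integrable_def], symmetric]
      by (simp add: mult_ac)
  qed
qed

lemma integral_reflect:
  fixes F :: "real \<Rightarrow> complex"
  shows "(LINT u|lborel. F u) = (LINT t|lborel. F (c - t))"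
  using lborel_integral_real_affine[of "-1" F c] by simp

lemma integral_shift:
  fixes F :: "real \<Rightarrow> complex"
  shows "(LINT u|lborel. F u) = (LINT t|lborel. F (t + c))"
  using lborel_integral_real_affine[of 1 F c] by (simp add: add.commute)

text \<open>The piece of the operator at unit scale. The lower cut-off \<open>a\<close> is variable
  because the pieces that are summed later lie in \<open>r1 \<le> |t| \<le> r2\<close> with a ratio
  that need not be 2.\<close>

locale core_form = phase +
  fixes \<epsilon> a lm :: real and g :: "real \<Rightarrow> complex"
  assumes \<phi>m[measurable]: "\<phi> \<in> borel_measurable borel"
    and eps: "\<epsilon> \<noteq> 0" "\<bar>\<epsilon>\<bar> \<le> 1/100" "\<bar>\<epsilon>\<bar> \<le> c / (1200 * C)" and lam: "lm > 0"
    and a: "1/2 \<le> a" "a \<le> 1"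
    and g[measurable]: "g \<in> borel_measurable borel" and g1: "\<And>y. norm (g y) \<le> 1" and gs: "\<And>y. g y \<noteq> 0 \<Longrightarrow> \<bar>y\<bar> \<le> 1"
begin

definition "q t = (if a \<le> t \<and> t \<le> 1 then cis (lm * \<phi> t) / of_real t else 0)"

lemma q_meas[measurable]: "q \<in> borel_measurable borel" unfolding q_def by measurable

lemma q_bound: "norm (q t) \<le> 2"
  using a by (auto simp: q_def norm_divide divide_simps)

lemma q_supp: "q t \<noteq> 0 \<Longrightarrow> 1/2 \<le> t \<and> t \<le> 1" using a by (auto simp: q_def split: if_splits)

definition "K x u = q (\<epsilon> * x - u) * g (x - (\<epsilon> * x - u)\<^sup>2)"

lemma eps_mult: "\<bar>x\<bar> \<le> 2 \<Longrightarrow> \<bar>\<epsilon> * x\<bar> \<le> 1/50"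
  using eps(2) mult_mono[of "\<bar>\<epsilon>\<bar>" "1/100" "\<bar>x\<bar>" 2] by (simp add: abs_mult)

sublocale bounded_kernel K 2 3
proof
  show "(\<lambda>(x, u). K x u) \<in> borel_measurable (borel \<Otimes>\<^sub>M borel)" unfolding K_def by measurable
  show "norm (K x u) \<le> 2" for x u
    using mult_mono[OF q_bound[of "\<epsilon> * x - u"] g1[of "x - (\<epsilon> * x - u)\<^sup>2"]] by (simp add: K_def norm_mult)
  show "\<bar>x\<bar> \<le> 3 \<and> \<bar>u\<bar> \<le> 3" if "K x u \<noteq> 0" for x u
  proof -
    define t where "t = \<epsilon> * x - u"
    have "q t \<noteq> 0" "g (x - t\<^sup>2) \<noteq> 0" using that unfolding K_def t_def by auto
    then have t: "1/2 \<le> t" "t \<le> 1" "\<bar>x - t\<^sup>2\<bar> \<le> 1" using q_supp[of t] gs[of "x - t\<^sup>2"] by auto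
    have "t\<^sup>2 \<le> 1" "0 \<le> t\<^sup>2" using t by (auto simp: power_le_one)
    then have x: "\<bar>x\<bar> \<le> 2" using t by linarith
    then show ?thesis using eps_mult[OF x] t unfolding t_def by linarith
  qed
qed auto

section \<open>The coordinates p and e\<close>

definition "TP p t = sqrt (t\<^sup>2 + p)"
definition "SS e t = sqrt ((1 - 2 * \<epsilon> * t)\<^sup>2 + 4 * \<epsilon>\<^sup>2 * e)"
definition "Sf e t = (1 - SS e t) / (2 * \<epsilon>)"
definition "SP p e t = TP p t - (t - Sf e t)"
definition "EE p e t = e - 2 * (t - Sf e t) * (TP p t - t)"

lemma substitution_meas[measurable]: "(\<lambda>(p,t). TP p t) \<in> borel_measurable (borel \<Otimes>\<^sub>M borel)" "(\<lambda>(e,t). SS e t) \<in> borel_measurable (borel \<Otimes>\<^sub>M borel)"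
   "(\<lambda>(e,t). Sf e t) \<in> borel_measurable (borel \<Otimes>\<^sub>M borel)"
  "(\<lambda>(p,e,t). SP p e t) \<in> borel_measurable (borel \<Otimes>\<^sub>M borel \<Otimes>\<^sub>M borel)"
  "(\<lambda>(p,e,t). EE p e t) \<in> borel_measurable (borel \<Otimes>\<^sub>M borel \<Otimes>\<^sub>M borel)"
  unfolding TP_def SS_def Sf_def SP_def EE_def by measurable

lemma at_bd: "1/2 \<le> t \<Longrightarrow> t \<le> 1 \<Longrightarrow> 98/100 \<le> 1 - 2 * \<epsilon> * t \<and> 1 - 2 * \<epsilon> * t \<le> 102/100"
  using eps_mult[of "2*t"] by (auto simp: abs_le_iff)

lemma rad: assumes "1/2 \<le> t" "t \<le> 1" "\<bar>e\<bar> \<le> 2"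
  shows "(1 - 2 * \<epsilon> * t)\<^sup>2 + 4 * \<epsilon>\<^sup>2 * e \<ge> 95/100" "(1 - 2 * \<epsilon> * t)\<^sup>2 + 4 * \<epsilon>\<^sup>2 * e \<le> 105/100"
proof -
  have "\<epsilon>\<^sup>2 \<le> (1/100)\<^sup>2" using power_mono[OF eps(2), of 2] by simp
  then have "\<epsilon>\<^sup>2 * \<bar>e\<bar> \<le> (1/100)\<^sup>2 * 2" using assms by (intro mult_mono) auto
  then have "\<bar>4 * \<epsilon>\<^sup>2 * e\<bar> \<le> 8/10000" by (simp add: abs_mult power2_eq_square)
  then show "(1 - 2 * \<epsilon> * t)\<^sup>2 + 4 * \<epsilon>\<^sup>2 * e \<ge> 95/100" "(1 - 2 * \<epsilon> * t)\<^sup>2 + 4 * \<epsilon>\<^sup>2 * e \<le> 105/100"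
    using at_bd[OF assms(1,2)] power_mono[of "98/100" "1 - 2 * \<epsilon> * t" 2] power_mono[of "1 - 2 * \<epsilon> * t" "102/100" 2]
    by (auto simp: abs_le_iff power2_eq_square)
qed

lemma SS_sq: "1/2 \<le> t \<Longrightarrow> t \<le> 1 \<Longrightarrow> \<bar>e\<bar> \<le> 2 \<Longrightarrow> (SS e t)\<^sup>2 = (1 - 2 * \<epsilon> * t)\<^sup>2 + 4 * \<epsilon>\<^sup>2 * e"
  using rad[of t e] by (simp add: SS_def)

lemma SS_bd: assumes "1/2 \<le> t" "t \<le> 1" "\<bar>e\<bar> \<le> 2" shows "9/10 \<le> SS e t" "SS e t \<le> 103/100"
proof -
  show "9/10 \<le> SS e t" unfolding SS_def using rad[OF assms] by (intro real_le_rsqrt) (auto simp: power2_eq_square)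
  show "SS e t \<le> 103/100" unfolding SS_def using rad[OF assms] by (intro real_le_lsqrt) (auto simp: power2_eq_square)
qed

text \<open>The difference \<open>x\<^sub>1 - x\<^sub>2\<close> as a function of \<open>e\<close>
  for fixed \<open>t\<close>, that is, the inverse of \<open>d \<mapsto> d (1 - 2 \<epsilon> t) +
  \<epsilon>\<^sup>2 d\<^sup>2\<close> on the relevant range.\<close>

definition "Dd t e = (t - Sf e t) / \<epsilon>"

lemma Dd_eq: "Dd t e = (SS e t - (1 - 2 * \<epsilon> * t)) / (2 * \<epsilon>\<^sup>2)"
  using eps(1) by (simp add: Dd_def Sf_def field_simps power2_eq_square)

lemma Dd_quad: assumes "1/2 \<le> t" "t \<le> 1" "\<bar>e\<bar> \<le> 2"
  shows "Dd t e * (1 - 2 * \<epsilon> * t) + \<epsilon>\<^sup>2 * (Dd t e)\<^sup>2 = e"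
proof -
  define A D where "A = 1 - 2 * \<epsilon> * t" and "D = Dd t e"
  have "SS e t = A + 2 * \<epsilon>\<^sup>2 * D" unfolding A_def D_def Dd_eq using eps(1) by simp
  then have "(A + 2 * \<epsilon>\<^sup>2 * D)\<^sup>2 = A\<^sup>2 + 4 * \<epsilon>\<^sup>2 * e" using SS_sq[OF assms] unfolding A_def by simp
  then have "4 * \<epsilon>\<^sup>2 * (D * A + \<epsilon>\<^sup>2 * D\<^sup>2) = 4 * \<epsilon>\<^sup>2 * e" by (simp add: power2_eq_square algebra_simps)
  then show ?thesis using eps(1) unfolding A_def D_def by simp
qed

lemma Dd_inv:
  assumes t: "1/2 \<le> t" "t \<le> 1" and s: "1/2 \<le> t - \<epsilon> * d" "t - \<epsilon> * d \<le> 1" and e: "e = d * (1 - 2 * \<epsilon> * t) + \<epsilon>\<^sup>2 * d\<^sup>2"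
  shows "Dd t e = d"
proof -
  have "(1 - 2 * \<epsilon> * t)\<^sup>2 + 4 * \<epsilon>\<^sup>2 * e = (1 - 2 * \<epsilon> * (t - \<epsilon> * d))\<^sup>2"
    unfolding e by (simp add: power2_eq_square algebra_simps)
  then have "SS e t = 1 - 2 * \<epsilon> * (t - \<epsilon> * d)"
    unfolding SS_def using at_bd[OF s] by simp
  then show ?thesis unfolding Dd_eq using eps(1) by (simp add: field_simps power2_eq_square)
qed

lemma Dd_mono: "e \<le> e' \<Longrightarrow> Dd t e \<le> Dd t e'"
  unfolding Dd_eq SS_def using eps(1) by (intro divide_right_mono) (auto intro!: real_sqrt_le_mono mult_left_mono)

lemma Dd_deriv: assumes "1/2 \<le> t" "t \<le> 1" "\<bar>e\<bar> \<le> 2"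
  shows "(Dd t has_real_derivative 1 / SS e t) (at e)"
proof -
  have "((\<lambda>e. (sqrt ((1 - 2 * \<epsilon> * t)\<^sup>2 + 4 * \<epsilon>\<^sup>2 * e) - (1 - 2 * \<epsilon> * t)) / (2 * \<epsilon>\<^sup>2)) has_real_derivative
      (inverse (sqrt ((1 - 2 * \<epsilon> * t)\<^sup>2 + 4 * \<epsilon>\<^sup>2 * e)) / 2 * (4 * \<epsilon>\<^sup>2)) / (2 * \<epsilon>\<^sup>2)) (at e)"
  proof -
    have "((\<lambda>e. sqrt ((1 - 2 * \<epsilon> * t)\<^sup>2 + 4 * \<epsilon>\<^sup>2 * e)) has_real_derivative
      inverse (sqrt ((1 - 2 * \<epsilon> * t)\<^sup>2 + 4 * \<epsilon>\<^sup>2 * e)) / 2 * (0 + 4 * \<epsilon>\<^sup>2 * 1)) (at e)"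
    proof (rule DERIV_chain2[where f=sqrt, OF DERIV_real_sqrt])
      show "0 < (1 - 2 * \<epsilon> * t)\<^sup>2 + 4 * \<epsilon>\<^sup>2 * e" using rad(1)[OF assms] by linarith
    qed (intro DERIV_add DERIV_const DERIV_cmult DERIV_ident)
    from DERIV_cdivide[OF DERIV_diff[OF this DERIV_const], of "1 - 2 * \<epsilon> * t" "2 * \<epsilon>\<^sup>2"] show ?thesis by simp
  qed
  moreover have "(inverse (sqrt ((1 - 2 * \<epsilon> * t)\<^sup>2 + 4 * \<epsilon>\<^sup>2 * e)) / 2 * (4 * \<epsilon>\<^sup>2)) / (2 * \<epsilon>\<^sup>2) = 1 / SS e t"
    using eps(1) unfolding SS_def[symmetric] by (simp add: field_simps)
  moreover have "Dd t = (\<lambda>e. (sqrt ((1 - 2 * \<epsilon> * t)\<^sup>2 + 4 * \<epsilon>\<^sup>2 * e) - (1 - 2 * \<epsilon> * t)) / (2 * \<epsilon>\<^sup>2))"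
    by (simp add: fun_eq_iff Dd_eq SS_def)
  ultimately show ?thesis by simp
qed

text \<open>Here \<open>x\<close> plays the part of \<open>x\<^sub>1\<close>, and the integration
  variable is \<open>x\<^sub>2 = x - d\<close> with \<open>d = Dd t e\<close>. Since
  \<open>u1\<close> and \<open>u2\<close> stay fixed, moving \<open>x\<^sub>2\<close> shifts both
  \<open>t\<close> and \<open>TP p t\<close> by the same amount \<open>\<epsilon> * d\<close>; thus
  one coordinate \<open>e\<close> determines the two remaining points and both arguments of
  \<open>g\<close>.\<close>

lemma L_subst:
  assumes t: "a \<le> t" "t \<le> 1" and v: "\<bar>v\<bar> \<le> 1" and p: "0 \<le> p"
  defines "x \<equiv> v + t\<^sup>2"
  shows "cnj (L (\<epsilon> * x - t) (\<epsilon> * x - TP p t)) = (LINT e|lborel. (if \<bar>e\<bar> \<le> 2 then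
    of_real (1 / SS e t) * (cnj (q (Sf e t)) * cnj (g (v - e)) * (q (SP p e t) * g (v - p - EE p e t))) else 0))"
proof -
  have t': "1/2 \<le> t" "t \<le> 1" using t a by auto
  define F where "F d = cnj (K (x - d) (\<epsilon> * x - t)) * K (x - d) (\<epsilon> * x - TP p t)" for d
  have [measurable]: "F \<in> borel_measurable borel" unfolding F_def by measurable
  have FB: "norm (F d) \<le> 4" for d
    using KK[of "x - d" "\<epsilon> * x - TP p t" "x - d" "\<epsilon> * x - t"] unfolding F_def by (simp add: norm_mult mult.commute)
  have "cnj (L (\<epsilon> * x - t) (\<epsilon> * x - TP p t)) = (LINT x2|lborel. cnj (K x2 (\<epsilon> * x - t)) * K x2 (\<epsilon> * x - TP p t))"
    unfolding L_def Bochner_Integration.integral_cnj[symmetric] by simp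
  also have "\<dots> = (LINT d|lborel. F d)" unfolding F_def by (rule integral_reflect)
  \<comment> \<open>The supports allow only this range: \<open>v\<close> and \<open>v - e\<close>
    both lie in [-1,1], hence \<open>|e| \<le> 2\<close>.\<close>
  also have "\<dots> = (LINT d|lborel. indicator {Dd t (-2)..Dd t 2} d *\<^sub>R F d)"
  proof (rule Bochner_Integration.integral_cong[OF refl])
    fix d
    show "F d = indicator {Dd t (-2)..Dd t 2} d *\<^sub>R F d"
    proof (cases "F d = 0")
      case False
      define s where "s = t - \<epsilon> * d"
      have es: "\<epsilon> * (x - d) - (\<epsilon> * x - t) = s" by (simp add: s_def algebra_simps)
      have "q s \<noteq> 0" "g (x - d - s\<^sup>2) \<noteq> 0" using False unfolding F_def K_def es by auto
      then have s: "1/2 \<le> s" "s \<le> 1" "\<bar>x - d - s\<^sup>2\<bar> \<le> 1" using q_supp gs by auto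
      define e where "e = d * (1 - 2 * \<epsilon> * t) + \<epsilon>\<^sup>2 * d\<^sup>2"
      have "x - d - s\<^sup>2 = v - e" unfolding x_def s_def e_def by (simp add: power2_eq_square algebra_simps)
      then have e2: "-2 \<le> e" "e \<le> 2" using s v by auto
      have "Dd t e = d" by (rule Dd_inv[OF t' _ _ e_def]) (use s in \<open>auto simp: s_def\<close>)
      then have "Dd t (-2) \<le> d" "d \<le> Dd t 2" using Dd_mono e2 by metis+
      then show ?thesis by simp
    qed simp
  qed
  also have "\<dots> = (LINT e|lborel. indicator {-2..2} e *\<^sub>R (1 / SS e t) *\<^sub>R F (Dd t e))"
  proof (rule subst_lborel[OF _ FB])
    show "continuous_on {-2..2} (\<lambda>e. 1 / SS e t)"
      unfolding SS_def using rad[OF t'] by (intro continuous_intros) (auto simp: abs_le_iff, fastforce)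
    show "0 \<le> 1 / SS e t" if "e \<in> {-2..2}" for e
    proof -
      have "\<bar>e\<bar> \<le> 2" using that by auto
      then show ?thesis using SS_bd(1)[OF t', of e] by simp
    qed
  qed (use Dd_deriv[OF t'] in auto)
  also have "\<dots> = (LINT e|lborel. (if \<bar>e\<bar> \<le> 2 then
    of_real (1 / SS e t) * (cnj (q (Sf e t)) * cnj (g (v - e)) * (q (SP p e t) * g (v - p - EE p e t))) else 0))"
  proof (rule Bochner_Integration.integral_cong[OF refl])
    fix e
    show "indicator {-2..2} e *\<^sub>R (1 / SS e t) *\<^sub>R F (Dd t e) = (if \<bar>e\<bar> \<le> 2 then
    of_real (1 / SS e t) * (cnj (q (Sf e t)) * cnj (g (v - e)) * (q (SP p e t) * g (v - p - EE p e t))) else 0)"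
    proof (cases "\<bar>e\<bar> \<le> 2")
      case True
      define d where "d = Dd t e"
      have q: "d * (1 - 2 * \<epsilon> * t) + \<epsilon>\<^sup>2 * d\<^sup>2 = e" unfolding d_def by (rule Dd_quad[OF t' True])
      have ed: "\<epsilon> * d = t - Sf e t" unfolding d_def Dd_def using eps(1) by simp
      have tp: "(TP p t)\<^sup>2 = t\<^sup>2 + p" unfolding TP_def using p by simp
      have 1: "\<epsilon> * (x - d) - (\<epsilon> * x - t) = Sf e t" using ed by (simp add: algebra_simps)
      have 2: "\<epsilon> * (x - d) - (\<epsilon> * x - TP p t) = SP p e t" using ed by (simp add: SP_def algebra_simps)
      have 3: "x - d - (Sf e t)\<^sup>2 = v - e"
      proof -
        have "Sf e t = t - \<epsilon> * d" using ed by simp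
        moreover have "x - d - (t - \<epsilon> * d)\<^sup>2 = v - (d * (1 - 2 * \<epsilon> * t) + \<epsilon>\<^sup>2 * d\<^sup>2)"
          unfolding x_def by (simp add: power2_eq_square algebra_simps)
        ultimately show ?thesis unfolding q by simp
      qed
      have 4: "x - d - (SP p e t)\<^sup>2 = v - p - EE p e t"
      proof -
        have "SP p e t = TP p t - \<epsilon> * d" unfolding SP_def ed ..
        moreover have "EE p e t = (d * (1 - 2 * \<epsilon> * t) + \<epsilon>\<^sup>2 * d\<^sup>2) - 2 * (\<epsilon> * d) * (TP p t - t)" unfolding EE_def ed q ..
        moreover have "x - d - (TP p t - \<epsilon> * d)\<^sup>2 = v - p - ((d * (1 - 2 * \<epsilon> * t) + \<epsilon>\<^sup>2 * d\<^sup>2) - 2 * (\<epsilon> * d) * (TP p t - t))"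
          using tp unfolding x_def by (simp add: power2_eq_square algebra_simps)
        ultimately show ?thesis by simp
      qed
      have "F (Dd t e) = cnj (q (Sf e t)) * cnj (g (v - e)) * (q (SP p e t) * g (v - p - EE p e t))"
        unfolding d_def[symmetric] F_def K_def 1 2 3 4 by simp
      then show ?thesis using True by (auto simp: scaleR_conv_of_real indicator_def abs_le_iff)
    qed (auto simp: indicator_def abs_le_iff)
  qed
  finally show ?thesis .
qed

text \<open>The integrand of the squared norm of \<open>L\<close> written out: four factors
  \<open>q\<close>, four factors \<open>g\<close>, and the Jacobians \<open>1 / (2 * TP p t)\<close>
  of the substitution for \<open>u2\<close> and \<open>1 / SS e t\<close> of the one for
  \<open>x\<^sub>2\<close>. The cut-offs display a bounded support for the exchanges of
  integrals.\<close>

definition "Z t v p e = (if 0 < p \<and> p \<le> 1 \<and> \<bar>e\<bar> \<le> 2 then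
   of_real (1 / (2 * TP p t * SS e t)) * (q t * cnj (q (TP p t)) * cnj (q (Sf e t)) * q (SP p e t))
     * (g v * cnj (g (v - p)) * cnj (g (v - e)) * g (v - p - EE p e t)) else 0)"

lemma Z_meas[measurable (raw)]:
  assumes [measurable]: "f1 \<in> borel_measurable M" "f2 \<in> borel_measurable M" "f3 \<in> borel_measurable M" "f4 \<in> borel_measurable M"
  shows "(\<lambda>x. Z (f1 x) (f2 x) (f3 x) (f4 x)) \<in> borel_measurable M"
  unfolding Z_def SP_def EE_def TP_def SS_def Sf_def by measurable

lemma Z_supp: "Z t v p e \<noteq> 0 \<Longrightarrow> \<bar>t\<bar> \<le> 2 \<and> \<bar>v\<bar> \<le> 2 \<and> \<bar>p\<bar> \<le> 2 \<and> \<bar>e\<bar> \<le> 2"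
  using q_supp[of t] gs[of v] by (auto simp: Z_def split: if_splits)

lemma weight_bound:
  assumes "q t \<noteq> 0" "q (TP p t) \<noteq> 0" "\<bar>e\<bar> \<le> 2"
  shows "\<bar>1 / (2 * TP p t * SS e t)\<bar> \<le> 2"
proof -
  have "1/2 \<le> TP p t" "9/10 \<le> SS e t" using q_supp[OF assms(2)] q_supp[OF assms(1)] SS_bd[of t e] assms(3) by auto
  then have *: "2 * (1/2) * (9/10) \<le> 2 * TP p t * SS e t" by (intro mult_mono) auto
  define y where "y = 2 * TP p t * SS e t"
  have "9/10 \<le> y" using * unfolding y_def by simp
  then show ?thesis unfolding y_def[symmetric] by (simp add: abs_divide divide_le_eq)
qed

lemma Z_bound: "norm (Z t v p e) \<le> 32"
proof (cases "Z t v p e = 0")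
  case False
  then have nz: "q t \<noteq> 0" "q (TP p t) \<noteq> 0" "\<bar>e\<bar> \<le> 2" by (auto simp: Z_def split: if_splits)
  define P Q G where "P = 1 / (2 * TP p t * SS e t)" and "Q = q t * cnj (q (TP p t)) * cnj (q (Sf e t)) * q (SP p e t)"
    and "G = g v * cnj (g (v - p)) * cnj (g (v - e)) * g (v - p - EE p e t)"
  have Q: "norm Q \<le> 2 * 2 * 2 * 2"
    unfolding Q_def norm_mult complex_mod_cnj using q_bound by (intro mult_mono mult_nonneg_nonneg) auto
  have G: "norm G \<le> 1 * 1 * 1 * 1"
    unfolding G_def norm_mult complex_mod_cnj using g1 by (intro mult_mono mult_nonneg_nonneg) auto
  have P: "\<bar>P\<bar> \<le> 2" unfolding P_def by (rule weight_bound[OF nz])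
  have "Z t v p e = of_real P * Q * G"
  proof -
    have c: "0 < p \<and> p \<le> 1 \<and> \<bar>e\<bar> \<le> 2" using False unfolding Z_def by presburger
    show ?thesis unfolding Z_def P_def Q_def G_def by (rule if_P[OF c])
  qed
  then have "norm (Z t v p e) = \<bar>P\<bar> * norm Q * norm G" by (simp add: norm_mult)
  also have "\<dots> \<le> 2 * (2 * 2 * 2 * 2) * (1 * 1 * 1 * 1)" using P Q G by (intro mult_mono mult_nonneg_nonneg) auto
  finally show ?thesis by simp
qed simp

end

text \<open>With this, the supports of iterated integrals are read off one integration at a
  time.\<close>

lemma integral_nonzeroD: "(LINT y|M. F y) \<noteq> (0::'b::{banach,second_countable_topology}) \<Longrightarrow> \<exists>y. F y \<noteq> 0"
proof (rule ccontr)
  assume nz: "(LINT y|M. F y) \<noteq> 0" and "\<not> (\<exists>y. F y \<noteq> 0)"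
  then have "F = (\<lambda>_. 0)" by auto
  then show False using nz by simp
qed

context core_form
begin

section \<open>The quadrilinear form in the new coordinates\<close>

definition "Ip = (LINT u1|lborel. LINT u2|lborel. (if u2 < u1 then (norm (L u1 u2))\<^sup>2 else 0))"

text \<open>One factor \<open>L\<close> is opened as an integral over \<open>x\<close>, the variable
  \<open>x\<^sub>1\<close>; the other stays closed until \<open>L_subst\<close> opens it in the
  coordinate \<open>e\<close>.\<close>

definition "G u1 u2 x = (if u2 < u1 then K x u1 * cnj (K x u2) * cnj (L u1 u2) else 0)"

lemma G_meas[measurable (raw)]:
  assumes [measurable]: "f1 \<in> borel_measurable M" "f2 \<in> borel_measurable M" "f3 \<in> borel_measurable M"
  shows "(\<lambda>x. G (f1 x) (f2 x) (f3 x)) \<in> borel_measurable M"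
  unfolding G_def by measurable

lemma G_bound: "norm (G u1 u2 x) \<le> 96"
proof -
  have "norm (K x u1 * cnj (K x u2) * cnj (L u1 u2)) \<le> (2 * 2) * (2 * 3 * (2 * 2))"
    unfolding norm_mult[of _ "cnj (L u1 u2)"] complex_mod_cnj using KK L_bound by (intro mult_mono) auto
  then show ?thesis by (simp add: G_def)
qed

lemma G_supp: "G u1 u2 x \<noteq> 0 \<Longrightarrow> \<bar>u1\<bar> \<le> 3 \<and> \<bar>u2\<bar> \<le> 3 \<and> \<bar>x\<bar> \<le> 3"
  using KR[of x u1] KR[of x u2] by (auto simp: G_def split: if_splits)

definition "Mi t x = (LINT u2|lborel. G (\<epsilon> * x - t) u2 x)"

lemma Mi_meas[measurable (raw)]:
  assumes [measurable]: "f1 \<in> borel_measurable M" "f2 \<in> borel_measurable M"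
  shows "(\<lambda>x. Mi (f1 x) (f2 x)) \<in> borel_measurable M"
  unfolding Mi_def by measurable

lemma Mi_bound: "norm (Mi t x) \<le> 2 * 3 * 96"
  unfolding Mi_def by (rule integral_bounded_supp) (use G_bound G_supp in auto)

lemma Mi_supp: "Mi t x \<noteq> 0 \<Longrightarrow> q t \<noteq> 0 \<and> g (x - t\<^sup>2) \<noteq> 0 \<and> \<bar>x\<bar> \<le> 3"
proof -
  assume "Mi t x \<noteq> 0"
  then obtain u2 where "G (\<epsilon> * x - t) u2 x \<noteq> 0" unfolding Mi_def using integral_nonzeroD by blast
  then have "K x (\<epsilon> * x - t) \<noteq> 0" by (auto simp: G_def split: if_splits)
  then show ?thesis using KR[of x "\<epsilon> * x - t"] by (auto simp: K_def)
qed

text \<open>The variable \<open>u2\<close> becomes the point \<open>TP p t\<close>, which introduces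
  \<open>p\<close>; then \<open>L_subst\<close> introduces \<open>e\<close>. The base point
  \<open>v\<close> is the argument of the first factor \<open>g\<close>.\<close>

lemma Mi_eq: "Mi t (v + t\<^sup>2) = (LINT p|lborel. LINT e|lborel. Z t v p e)"
proof (cases "q t = 0 \<or> g v = 0")
  case True
  then have "Z t v p e = 0" for p e by (auto simp: Z_def)
  then have "(LINT p|lborel. LINT e|lborel. Z t v p e) = 0" by simp
  moreover have "Mi t (v + t\<^sup>2) = 0" using Mi_supp[of t "v + t\<^sup>2"] True by auto
  ultimately show ?thesis by simp
next
  case False
  then have t: "a \<le> t" "t \<le> 1" and v: "\<bar>v\<bar> \<le> 1" using gs by (auto simp: q_def split: if_splits)
  have t': "1/2 \<le> t" using t a by simp
  define x where "x = v + t\<^sup>2"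
  define G2 where "G2 t' = (if t < t' then q t * g v * cnj (q t' * g (x - t'\<^sup>2)) * cnj (L (\<epsilon> * x - t) (\<epsilon> * x - t')) else 0)" for t'
  have [measurable]: "G2 \<in> borel_measurable borel" unfolding G2_def by measurable
  have G2e: "G2 t' = G (\<epsilon> * x - t) (\<epsilon> * x - t') x" for t'
    by (simp add: G2_def G_def K_def x_def)
  have G2b: "norm (G2 t') \<le> 96" for t' unfolding G2e by (rule G_bound)
  have t2: "t\<^sup>2 \<le> 1" using t t' by (simp add: power_le_one)
  have TP0: "TP 0 t = t" "TP (1 - t\<^sup>2) t = 1" using t' by (auto simp: TP_def)
  have "Mi t x = (LINT t'|lborel. G2 t')" unfolding Mi_def G2e by (rule integral_reflect)
  also have "\<dots> = (LINT t'|lborel. indicator {TP 0 t..TP (1 - t\<^sup>2) t} t' *\<^sub>R G2 t')"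
  proof (rule Bochner_Integration.integral_cong[OF refl])
    fix t'
    show "G2 t' = indicator {TP 0 t..TP (1 - t\<^sup>2) t} t' *\<^sub>R G2 t'"
    proof (cases "G2 t' = 0")
      case False
      then have "t < t'" "q t' \<noteq> 0" by (auto simp: G2_def split: if_splits)
      then show ?thesis unfolding TP0 using q_supp[of t'] by auto
    qed simp
  qed
  also have "\<dots> = (LINT p|lborel. indicator {0..1 - t\<^sup>2} p *\<^sub>R ((1 / (2 * TP p t)) *\<^sub>R G2 (TP p t)))"
  proof (rule subst_lborel[where G="\<lambda>p. TP p t" and a=0 and b="1 - t\<^sup>2" and B=96])
    have pos: "0 < t\<^sup>2 + p" if "p \<in> {0..1 - t\<^sup>2}" for p using that t' by (intro add_pos_nonneg) auto
    show "((\<lambda>p. TP p t) has_real_derivative 1 / (2 * TP p t)) (at p)" if "p \<in> {0..1 - t\<^sup>2}" for p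
    proof -
      have "((\<lambda>p. sqrt (t\<^sup>2 + p)) has_real_derivative inverse (sqrt (t\<^sup>2 + p)) / 2 * (0 + 1)) (at p)"
        by (rule DERIV_chain2[where f=sqrt and g="\<lambda>p. t\<^sup>2 + p", OF DERIV_real_sqrt[OF pos[OF that]]]) (intro DERIV_add DERIV_const DERIV_ident)
      then show ?thesis unfolding TP_def by (simp add: inverse_eq_divide mult.commute)
    qed
    show "continuous_on {0..1 - t\<^sup>2} (\<lambda>p. 1 / (2 * TP p t))"
      unfolding TP_def using pos by (intro continuous_intros) force
  qed (use G2b t2 t' in \<open>auto simp: TP_def\<close>)
  also have "\<dots> = (LINT p|lborel. LINT e|lborel. Z t v p e)"
  proof (rule Bochner_Integration.integral_cong[OF refl])
    fix p
    show "indicator {0..1 - t\<^sup>2} p *\<^sub>R ((1 / (2 * TP p t)) *\<^sub>R G2 (TP p t)) = (LINT e|lborel. Z t v p e)"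
    proof (cases "0 < p \<and> p \<le> 1 - t\<^sup>2")
      case True
      have "0 \<le> t\<^sup>2" by simp
      with True have p: "0 < p" "p \<le> 1 - t\<^sup>2" "p \<le> 1" "0 \<le> p" by linarith+
      have tt: "t < TP p t" unfolding TP_def using p t' by (intro real_less_rsqrt) auto
      have xt: "x - (TP p t)\<^sup>2 = v - p" unfolding x_def TP_def using p by simp
      have "G2 (TP p t) = q t * g v * cnj (q (TP p t)) * cnj (g (v - p)) * cnj (L (\<epsilon> * x - t) (\<epsilon> * x - TP p t))"
        using tt by (simp add: G2_def xt)
      also have "\<dots> = q t * g v * cnj (q (TP p t)) * cnj (g (v - p)) * (LINT e|lborel. (if \<bar>e\<bar> \<le> 2 then
         of_real (1 / SS e t) * (cnj (q (Sf e t)) * cnj (g (v - e)) * (q (SP p e t) * g (v - p - EE p e t))) else 0))"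
        unfolding x_def L_subst[OF t v p(4)] ..
      finally have "indicator {0..1 - t\<^sup>2} p *\<^sub>R ((1 / (2 * TP p t)) *\<^sub>R G2 (TP p t)) =
        of_real (1 / (2 * TP p t)) * (q t * g v * cnj (q (TP p t)) * cnj (g (v - p)) * (LINT e|lborel. (if \<bar>e\<bar> \<le> 2 then
         of_real (1 / SS e t) * (cnj (q (Sf e t)) * cnj (g (v - e)) * (q (SP p e t) * g (v - p - EE p e t))) else 0)))"
        using p by (simp add: scaleR_conv_of_real)
      also have "\<dots> = (LINT e|lborel. of_real (1 / (2 * TP p t)) * (q t * g v * cnj (q (TP p t)) * cnj (g (v - p)) * (if \<bar>e\<bar> \<le> 2 then
         of_real (1 / SS e t) * (cnj (q (Sf e t)) * cnj (g (v - e)) * (q (SP p e t) * g (v - p - EE p e t))) else 0)))"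
        by (simp only: integral_mult_right_zero)
      also have "\<dots> = (LINT e|lborel. Z t v p e)"
        using p by (intro Bochner_Integration.integral_cong) (auto simp: Z_def mult_ac)
      finally show ?thesis .
    next
      case False
      have "Z t v p e = 0" for e
      proof (rule ccontr)
        assume "Z t v p e \<noteq> 0"
        then have p: "0 < p" "q (TP p t) \<noteq> 0" by (auto simp: Z_def split: if_splits)
        then have "(TP p t)\<^sup>2 \<le> 1\<^sup>2" using q_supp[of "TP p t"] by (intro power_mono) auto
        then show False using False p unfolding TP_def by simp
      qed
      then have "(LINT e|lborel. Z t v p e) = 0" by simp
      moreover have "p = 0 \<or> p \<notin> {0..1 - t\<^sup>2}" using False by auto
      \<comment> \<open>At \<open>p = 0\<close> the two points coincide, and the strict inequality
        in \<open>G2\<close> makes the integrand vanish, in agreement with the cut-off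
        \<open>0 < p\<close> in \<open>Z\<close>.\<close>
      moreover have "G2 (TP 0 t) = 0" unfolding TP0 by (simp add: G2_def)
      ultimately show ?thesis by auto
    qed
  qed
  finally show ?thesis unfolding x_def .
qed

text \<open>Of the four translates of \<open>g\<close> in \<open>Z t v p e\<close> only the one at \<open>v - p - EE p e t\<close> involves \<open>t\<close>,
  so the \<open>t\<close>-integral acts on it as a Fourier multiplier.\<close>

lemma Ip_eq: "complex_of_real Ip = (LINT p|lborel. LINT e|lborel. LINT v|lborel. LINT t|lborel. Z t v p e)"
proof -
  have "complex_of_real Ip = (LINT u1|lborel. LINT u2|lborel. LINT x|lborel. G u1 u2 x)"
  proof -
    have "(LINT x|lborel. G u1 u2 x) = of_real (if u2 < u1 then (norm (L u1 u2))\<^sup>2 else 0)" for u1 u2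
    proof (cases "u2 < u1")
      case True
      have "(LINT x|lborel. K x u1 * cnj (K x u2) * cnj (L u1 u2)) = L u1 u2 * cnj (L u1 u2)"
        unfolding L_def[of u1 u2] by (simp only: integral_mult_left_zero)
      then show ?thesis using True unfolding G_def by (simp only: if_True complex_norm_square)
    qed (simp add: G_def)
    then show ?thesis unfolding Ip_def by simp
  qed
  also have "\<dots> = (LINT u1|lborel. LINT x|lborel. LINT u2|lborel. G u1 u2 x)"
    by (rule Bochner_Integration.integral_cong[OF refl], rule swap_bounded_supp[where B=96 and R=3])
       (use G_bound G_supp in auto)
  also have "\<dots> = (LINT x|lborel. LINT u1|lborel. LINT u2|lborel. G u1 u2 x)"
  proof (rule swap_bounded_supp[where B="2*3*96" and R=3])
    show "norm (LINT u2|lborel. G u1 u2 x) \<le> 2*3*96" for u1 x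
      by (rule integral_bounded_supp) (use G_bound G_supp in auto)
    show "(LINT u2|lborel. G u1 u2 x) \<noteq> 0 \<Longrightarrow> \<bar>u1\<bar> \<le> 3" "(LINT u2|lborel. G u1 u2 x) \<noteq> 0 \<Longrightarrow> \<bar>x\<bar> \<le> 3" for u1 x
      using G_supp by (auto dest!: integral_nonzeroD)
  qed measurable
  also have "\<dots> = (LINT x|lborel. LINT t|lborel. Mi t x)"
    unfolding Mi_def by (rule Bochner_Integration.integral_cong[OF refl], rule integral_reflect)
  also have "\<dots> = (LINT t|lborel. LINT x|lborel. Mi t x)"
    by (rule swap_bounded_supp[where B="2*3*96" and R=3]) (use Mi_bound Mi_supp q_supp in \<open>auto, fastforce\<close>)
  \<comment> \<open>With \<open>t\<close> outermost, the inner variable may be translated by an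
    amount depending on \<open>t\<close>.\<close>
  also have "\<dots> = (LINT t|lborel. LINT v|lborel. Mi t (v + t\<^sup>2))"
    by (rule Bochner_Integration.integral_cong[OF refl], rule integral_shift)
  also have "\<dots> = (LINT t|lborel. LINT v|lborel. LINT p|lborel. LINT e|lborel. Z t v p e)"
    by (simp only: Mi_eq)
  \<comment> \<open>From here on \<open>t\<close> travels from the outermost to the innermost place,
    so that its integral can be read as a multiplier for fixed \<open>p\<close> and
    \<open>e\<close>; after that \<open>v\<close> moves inside.\<close>
  also have "\<dots> = (LINT v|lborel. LINT t|lborel. LINT p|lborel. LINT e|lborel. Z t v p e)"
  proof (rule swap_bounded_supp[where B="2*2*(2*2*32)" and R=2])
    show "norm (LINT p|lborel. LINT e|lborel. Z t v p e) \<le> 2*2*(2*2*32)" for t v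
      by (intro integral_bounded_supp) (use Z_bound Z_supp in \<open>auto dest!: integral_nonzeroD\<close>)
  qed (use Z_supp in \<open>auto dest!: integral_nonzeroD\<close>)
  also have "\<dots> = (LINT v|lborel. LINT p|lborel. LINT t|lborel. LINT e|lborel. Z t v p e)"
  proof (rule Bochner_Integration.integral_cong[OF refl], rule swap_bounded_supp[where B="2*2*32" and R=2])
    show "norm (LINT e|lborel. Z t v p e) \<le> 2*2*32" for t v p
      by (intro integral_bounded_supp) (use Z_bound Z_supp in auto)
  qed (use Z_supp in \<open>auto dest!: integral_nonzeroD\<close>)
  also have "\<dots> = (LINT v|lborel. LINT p|lborel. LINT e|lborel. LINT t|lborel. Z t v p e)"
    by (rule Bochner_Integration.integral_cong[OF refl], rule Bochner_Integration.integral_cong[OF refl], rule swap_bounded_supp[where B=32 and R=2]) (use Z_bound Z_supp in auto)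
  also have "\<dots> = (LINT p|lborel. LINT v|lborel. LINT e|lborel. LINT t|lborel. Z t v p e)"
  proof (rule swap_bounded_supp[where B="2*2*(2*2*32)" and R=2])
    show "norm (LINT e|lborel. LINT t|lborel. Z t v p e) \<le> 2*2*(2*2*32)" for p v
      by (intro integral_bounded_supp) (use Z_bound Z_supp in \<open>auto dest!: integral_nonzeroD\<close>)
  qed (use Z_supp in \<open>auto dest!: integral_nonzeroD\<close>)
  also have "\<dots> = (LINT p|lborel. LINT e|lborel. LINT v|lborel. LINT t|lborel. Z t v p e)"
  proof (rule Bochner_Integration.integral_cong[OF refl], rule swap_bounded_supp[where B="2*2*32" and R=2])
    show "norm (LINT t|lborel. Z t v p e) \<le> 2*2*32" for e v p
      by (intro integral_bounded_supp) (use Z_bound Z_supp in auto)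
  qed (use Z_supp in \<open>auto dest!: integral_nonzeroD\<close>)
  finally show ?thesis .
qed

text \<open>A difference of squares gives
  \<open>(Sf e u - Sf e t) * (SS e t + SS e u) = (u - t) * (A + B)\<close>, and the quotient of the
  two sums is close to 1 for small \<epsilon>.\<close>

lemma Sf_mono:
  assumes t: "1/2 \<le> t" "t \<le> u" "u \<le> 1" and e: "\<bar>e\<bar> \<le> 2"
  shows "Sf e u - Sf e t \<ge> 19/20 * (u - t)"
proof -
  have t1: "1/2 \<le> t" "t \<le> 1" and u1: "1/2 \<le> u" "u \<le> 1" using t by auto
  define A B where "A = 1 - 2 * \<epsilon> * t" and "B = 1 - 2 * \<epsilon> * u"
  have "(SS e t - SS e u) * (SS e t + SS e u) = (A - B) * (A + B)"
    using SS_sq[OF t1 e] SS_sq[OF u1 e] unfolding A_def B_def by (simp add: power2_eq_square algebra_simps)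
  moreover have "A - B = 2 * \<epsilon> * (u - t)" by (simp add: A_def B_def algebra_simps)
  moreover have "SS e t - SS e u = 2 * \<epsilon> * (Sf e u - Sf e t)"
    using eps(1) by (simp add: Sf_def field_simps)
  ultimately have "2 * \<epsilon> * (Sf e u - Sf e t) * (SS e t + SS e u) = 2 * \<epsilon> * (u - t) * (A + B)" by (simp only:)
  then have "2 * \<epsilon> * ((Sf e u - Sf e t) * (SS e t + SS e u)) = 2 * \<epsilon> * ((u - t) * (A + B))" by (simp only: mult.assoc)
  then have eq: "(Sf e u - Sf e t) * (SS e t + SS e u) = (u - t) * (A + B)" using eps(1) by simp
  have AB: "49/25 \<le> A + B" using at_bd[OF t1] at_bd[OF u1] unfolding A_def B_def by linarith
  have SSs: "0 < SS e t + SS e u" "SS e t + SS e u \<le> 103/50" using SS_bd[OF t1 e] SS_bd[OF u1 e] by auto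
  have "19/20 * (u - t) * (SS e t + SS e u) \<le> 19/20 * (u - t) * (103/50)" using SSs t by (intro mult_left_mono) auto
  also have "\<dots> \<le> (u - t) * (49/25)" using t by simp
  also have "\<dots> \<le> (Sf e u - Sf e t) * (SS e t + SS e u)" unfolding eq using AB t by (intro mult_left_mono) auto
  finally show ?thesis using SSs by simp
qed

text \<open>\<open>SP p e t\<close> equals \<open>TP p t + Sf e t - t\<close>; the slopes 1/2 and
  19/20 of the first two terms together outweigh the last one.\<close>

lemma SP_mono:
  assumes t: "1/2 \<le> t" "t \<le> u" "u \<le> 1" and e: "\<bar>e\<bar> \<le> 2" and p: "0 \<le> p" "TP p u \<le> 1"
  shows "SP p e t \<le> SP p e u" "TP p t \<le> TP p u"
proof -
  show le: "TP p t \<le> TP p u" unfolding TP_def using t by (intro real_sqrt_le_mono add_right_mono power_mono) auto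
  have "(TP p u - TP p t) * (TP p u + TP p t) = u\<^sup>2 - t\<^sup>2"
    using p by (simp add: TP_def algebra_simps)
  then have eq: "(TP p u - TP p t) * (TP p u + TP p t) = (u - t) * (u + t)" by (simp add: power2_eq_square algebra_simps)
  have "(u - t) * 1 \<le> (TP p u - TP p t) * (TP p u + TP p t)" unfolding eq using t by (intro mult_left_mono) auto
  also have "\<dots> \<le> (TP p u - TP p t) * 2" using le p by (intro mult_left_mono) auto
  finally have "TP p u - TP p t \<ge> 1/2 * (u - t)" by simp
  then show "SP p e t \<le> SP p e u" using Sf_mono[OF t e] t(2) unfolding SP_def by argo
qed

section \<open>The symbol of the multiplier\<close>

definition "\<Phi> p e t = of_real (1 / (2 * TP p t * SS e t)) * (q t * cnj (q (TP p t)) * cnj (q (Sf e t)) * q (SP p e t))"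

lemma \<Phi>_meas[measurable]: "\<Phi> p e \<in> borel_measurable borel"
  unfolding \<Phi>_def SP_def EE_def TP_def SS_def Sf_def by measurable

lemma \<Phi>_bound:
  assumes e: "\<bar>e\<bar> \<le> 2"
  shows "norm (\<Phi> p e t) \<le> 32"
proof (cases "\<Phi> p e t = 0")
  case False
  then have nz: "q t \<noteq> 0" "q (TP p t) \<noteq> 0" by (auto simp: \<Phi>_def)
  have Q: "norm (q t * cnj (q (TP p t)) * cnj (q (Sf e t)) * q (SP p e t)) \<le> 2 * 2 * 2 * 2"
    unfolding norm_mult complex_mod_cnj using q_bound by (intro mult_mono mult_nonneg_nonneg) auto
  have "norm (\<Phi> p e t) = \<bar>1 / (2 * TP p t * SS e t)\<bar> * norm (q t * cnj (q (TP p t)) * cnj (q (Sf e t)) * q (SP p e t))"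
    unfolding \<Phi>_def by (simp only: norm_mult[of "of_real _"] norm_of_real)
  also have "\<dots> \<le> 2 * (2 * 2 * 2 * 2)"
    using Q weight_bound[OF nz e] by (intro mult_mono) auto
  finally show ?thesis by simp
qed simp

definition "TT p e = {t. a \<le> t \<and> t \<le> 1 \<and> a \<le> TP p t \<and> TP p t \<le> 1 \<and> a \<le> Sf e t \<and> Sf e t \<le> 1 \<and> a \<le> SP p e t \<and> SP p e t \<le> 1}"

lemma \<Phi>_off: "t \<notin> TT p e \<Longrightarrow> \<Phi> p e t = 0"
  by (auto simp: \<Phi>_def q_def TT_def)

text \<open>All four points increase with \<open>t\<close>, so the constraints cut out one compact
  interval, on which the van der Corput estimate is applied a single time with its monotone
  factors.\<close>

lemma TT_interval:
  assumes p: "0 \<le> p" and e: "\<bar>e\<bar> \<le> 2" and ne: "TT p e \<noteq> {}"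
  obtains \<alpha> \<beta> where "\<alpha> \<le> \<beta>" "TT p e = {\<alpha>..\<beta>}"
proof -
  have cont: "continuous_on UNIV (\<lambda>t. TP p t)" "continuous_on UNIV (\<lambda>t. Sf e t)" "continuous_on UNIV (\<lambda>t. SP p e t)"
    unfolding SP_def TP_def Sf_def SS_def using eps(1) by (auto intro!: continuous_intros)
  have "closed (TT p e)" unfolding TT_def
    by (intro closed_Collect_conj closed_Collect_le continuous_intros cont)
  moreover have "bounded (TT p e)"
    by (rule bounded_subset[of "{a..1}"]) (auto simp: TT_def)
  ultimately have "compact (TT p e)" by (simp add: compact_eq_bounded_closed)
  moreover have "is_interval (TT p e)"
    unfolding is_interval_1
  proof (intro ballI allI impI)
    fix t u x assume tu: "t \<in> TT p e" "u \<in> TT p e" and x: "t \<le> x \<and> x \<le> u"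
    have h: "1/2 \<le> t" "1/2 \<le> x" "u \<le> 1" "x \<le> 1" using tu x a by (auto simp: TT_def)
    have "TP p u \<le> 1" using tu by (simp add: TT_def)
    note 2 = SP_mono[of x u e p, OF h(2) conjunct2[OF x] h(3) e p this]
    have "TP p x \<le> 1" using 2 \<open>TP p u \<le> 1\<close> by simp
    note 1 = SP_mono[of t x e p, OF h(1) conjunct1[OF x] h(4) e p this]
    have "Sf e t \<le> Sf e x" "Sf e x \<le> Sf e u"
      using Sf_mono[of t x e, OF h(1) conjunct1[OF x] h(4) e] Sf_mono[of x u e, OF h(2) conjunct2[OF x] h(3) e] conjunct1[OF x] conjunct2[OF x] by argo+
    then show "x \<in> TT p e" using tu x 1 2 unfolding TT_def by auto
  qed
  ultimately obtain \<alpha> \<beta> where "TT p e = {\<alpha>..\<beta>}"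
    using connected_compact_interval_1[of "TT p e"] is_interval_connected_1[of "TT p e"] by auto
  then show thesis using that[of \<alpha> \<beta>] ne by auto
qed

definition "Mb p e = 2176 * sqrt (80 / c) * sqrt (1 / (lm * \<bar>\<epsilon>\<bar> * \<bar>e\<bar> * p))"

text \<open>The left side is the symbol of the operator that averages translations by
  \<open>EE p e t\<close> with weight \<Phi>. On \<open>TT p e\<close> the conjugations in the
  product of the four \<open>q\<close> produce exactly the signs of the phase \<Psi>, and the moduli
  produce the amplitude \<open>w\<close>; since \<open>a \<ge> 1/2\<close>, the interval meets the
  requirements of the locale \<open>phase_curve\<close>.\<close>

lemma multiplier_le:
  assumes p: "0 < p" and e: "e \<noteq> 0" "\<bar>e\<bar> \<le> 2"
  shows "norm (LINT t|lborel. \<Phi> p e t * cis (- \<xi> * EE p e t)) \<le> Mb p e"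
proof (cases "TT p e = {}")
  case True
  then have "\<Phi> p e t = 0" for t using \<Phi>_off by auto
  moreover have "0 \<le> Mb p e"
    unfolding Mb_def using c lam p by (intro mult_nonneg_nonneg real_sqrt_ge_zero divide_nonneg_nonneg) auto
  ultimately show ?thesis by simp
next
  case False
  then obtain \<alpha> \<beta> where ab: "\<alpha> \<le> \<beta>" "TT p e = {\<alpha>..\<beta>}" using TT_interval p e by (metis less_imp_le)
  have dom: "a \<le> t \<and> t \<le> 1 \<and> a \<le> TP p t \<and> TP p t \<le> 1 \<and> a \<le> Sf e t \<and> Sf e t \<le> 1 \<and> a \<le> SP p e t \<and> SP p e t \<le> 1" if "\<alpha> \<le> t" "t \<le> \<beta>" for t
  proof -
    have "t \<in> TT p e" using that ab by auto
    then show ?thesis by (simp add: TT_def)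
  qed
  have cv: "phase_curve \<phi> \<phi>1 \<phi>2 \<phi>3 \<phi>4 C c \<epsilon> p e lm \<alpha> \<beta>"
  proof (intro phase_curve.intro phase_curve_axioms.intro)
    show "phase \<phi> \<phi>1 \<phi>2 \<phi>3 \<phi>4 C c" by (rule phase_axioms)
    fix t assume "\<alpha> \<le> t" "t \<le> \<beta>"
    from dom[OF this] a(1)
    have "1 / 2 \<le> t \<and> t \<le> 1 \<and> 1 / 2 \<le> Sf e t \<and> Sf e t \<le> 1 \<and> TP p t \<le> 1 \<and> 1 / 2 \<le> SP p e t \<and> SP p e t \<le> 1" by linarith
    then show "1 / 2 \<le> t \<and> t \<le> 1 \<and>
      1 / 2 \<le> (1 - sqrt ((1 - 2 * \<epsilon> * t)\<^sup>2 + 4 * \<epsilon>\<^sup>2 * e)) / (2 * \<epsilon>) \<and>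
      (1 - sqrt ((1 - 2 * \<epsilon> * t)\<^sup>2 + 4 * \<epsilon>\<^sup>2 * e)) / (2 * \<epsilon>) \<le> 1 \<and>
      sqrt (t\<^sup>2 + p) \<le> 1 \<and>
      1 / 2 \<le> sqrt (t\<^sup>2 + p) - (t - (1 - sqrt ((1 - 2 * \<epsilon> * t)\<^sup>2 + 4 * \<epsilon>\<^sup>2 * e)) / (2 * \<epsilon>)) \<and>
      sqrt (t\<^sup>2 + p) - (t - (1 - sqrt ((1 - 2 * \<epsilon> * t)\<^sup>2 + 4 * \<epsilon>\<^sup>2 * e)) / (2 * \<epsilon>)) \<le> 1"
      unfolding SS_def Sf_def SP_def TP_def .
  qed (use eps lam p e ab in auto)
  define cw where "cw = phase_curve.w \<epsilon> p e"
  define H where "H t = of_real (cw t * (1 / (2 * TP p t * SS e t))) * cis (lm * (\<phi> t - \<phi> (Sf e t) - \<phi> (TP p t) + \<phi> (SP p e t)) - \<xi> * EE p e t)" for t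
  have B: "norm (integral {\<alpha>..\<beta>} H) \<le> Mb p e"
    using phase_curve.multiplier_bound[OF cv, of \<xi>] unfolding H_def cw_def TP_def SS_def SP_def Sf_def EE_def Mb_def .
  have HP: "\<Phi> p e t * cis (- \<xi> * EE p e t) = indicator {\<alpha>..\<beta>} t *\<^sub>R H t" for t
  proof (cases "t \<in> {\<alpha>..\<beta>}")
    case True
    then have d: "a \<le> t \<and> t \<le> 1 \<and> a \<le> TP p t \<and> TP p t \<le> 1 \<and> a \<le> Sf e t \<and> Sf e t \<le> 1 \<and> a \<le> SP p e t \<and> SP p e t \<le> 1"
      using dom by auto
    have w: "cw t = 1 / (t * Sf e t * TP p t * SP p e t)"
      unfolding cw_def phase_curve.w_def[OF cv] TP_def SS_def SP_def Sf_def ..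
    have "q t * cnj (q (TP p t)) * cnj (q (Sf e t)) * q (SP p e t) =
      of_real (cw t) * cis (lm * (\<phi> t - \<phi> (Sf e t) - \<phi> (TP p t) + \<phi> (SP p e t)))"
    proof -
      have "cis (lm * (\<phi> t - \<phi> (Sf e t) - \<phi> (TP p t) + \<phi> (SP p e t))) =
        cis (lm * \<phi> t) * cis (- (lm * \<phi> (TP p t))) * cis (- (lm * \<phi> (Sf e t))) * cis (lm * \<phi> (SP p e t))"
        unfolding cis_mult by (simp add: algebra_simps)
      then show ?thesis unfolding w using d by (simp add: q_def cis_cnj)
    qed
    then have "\<Phi> p e t * cis (- \<xi> * EE p e t) = of_real (1 / (2 * TP p t * SS e t)) * (of_real (cw t) * (cis (lm * (\<phi> t - \<phi> (Sf e t) - \<phi> (TP p t) + \<phi> (SP p e t))) * cis (- \<xi> * EE p e t)))"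
      unfolding \<Phi>_def by (simp only: mult.assoc)
    also have "\<dots> = H t" unfolding H_def cis_mult by (simp add: mult_ac)
    finally show ?thesis using True by simp
  next
    case False
    then have "\<Phi> p e t = 0" using \<Phi>_off ab by auto
    then show ?thesis using False by simp
  qed
  have [measurable]: "(\<lambda>t. EE p e t) \<in> borel_measurable borel" unfolding EE_def SP_def TP_def Sf_def SS_def by measurable
  have "integrable lborel (\<lambda>t. \<Phi> p e t * cis (- \<xi> * EE p e t))"
  proof (rule integrable_lborel_bounded_supp[where B=32 and R=1])
    show "\<Phi> p e t * cis (- \<xi> * EE p e t) \<noteq> 0 \<Longrightarrow> \<bar>t\<bar> \<le> 1" for t
      using q_supp[of t] by (auto simp: \<Phi>_def)
  qed (use \<Phi>_bound[OF e(2)] in \<open>auto simp: norm_mult\<close>)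
  then have "set_integrable lborel {\<alpha>..\<beta>} H" unfolding HP set_integrable_def .
  then have "(LINT t|lborel. \<Phi> p e t * cis (- \<xi> * EE p e t)) = integral {\<alpha>..\<beta>} H"
    unfolding HP using set_borel_integral_eq_integral(2) unfolding set_lebesgue_integral_def by blast
  then show ?thesis using B by simp
qed

end

section \<open>Integrals of the inverse square root\<close>

definition inv_sqrt :: "real \<Rightarrow> real \<Rightarrow> real" where
  "inv_sqrt b x = (if 0 < x \<and> x \<le> b then 1 / sqrt x else 0)"

lemma inv_sqrt_meas[measurable]: "inv_sqrt b \<in> borel_measurable borel" unfolding inv_sqrt_def by measurable

lemma inv_sqrt_integral:
  assumes "b \<ge> 0"
  shows "integrable lborel (inv_sqrt b)" "(LINT x|lborel. inv_sqrt b x) = 2 * sqrt b"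
proof -
  have "((\<lambda>x. x powr (-1/2)) has_integral b powr (-1/2 + 1) / (-1/2 + 1)) {0..b}"
    by (rule has_integral_powr_from_0) (use assms in auto)
  then have "(inv_sqrt b has_integral b powr (-1/2 + 1) / (-1/2 + 1)) {0..b}"
  proof (rule has_integral_eq[rotated])
    fix x assume x: "x \<in> {0..b}"
    show "x powr (-1/2) = inv_sqrt b x"
    proof (cases "x = 0")
      case False
      then have x0: "0 < x" "x \<le> b" using x by auto
      have "x powr (-1/2) = inverse (x powr (1/2))" using powr_minus[of x "1/2"] by simp
      also have "\<dots> = 1 / sqrt x" using powr_half_sqrt[of x] x0 by (simp add: inverse_eq_divide)
      finally show ?thesis using x0 by (simp add: inv_sqrt_def)
    qed (simp add: inv_sqrt_def)
  qed
  then have "((\<lambda>x. if x \<in> {0..b} then inv_sqrt b x else 0) has_integral b powr (-1/2 + 1) / (-1/2 + 1)) UNIV"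
    by (simp only: has_integral_restrict_UNIV)
  moreover have "(\<lambda>x. if x \<in> {0..b} then inv_sqrt b x else 0) = inv_sqrt b" by (auto simp: inv_sqrt_def fun_eq_iff)
  moreover have "b powr (-1/2 + 1) / (-1/2 + 1) = 2 * sqrt b" using assms by (simp add: powr_half_sqrt)
  ultimately have hi: "(inv_sqrt b has_integral 2 * sqrt b) UNIV" by (simp only:)
  have nn: "(\<integral>\<^sup>+x. ennreal (inv_sqrt b x) \<partial>lborel) = ennreal (2 * sqrt b)"
    by (rule nn_integral_has_integral_lborel[OF _ _ hi]) (auto simp: inv_sqrt_def)
  show i: "integrable lborel (inv_sqrt b)"
    by (rule integrableI_nonneg) (use nn in \<open>auto simp: inv_sqrt_def\<close>)
  show "(LINT x|lborel. inv_sqrt b x) = 2 * sqrt b"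
    using nn assms by (subst integral_eq_nn_integral) (auto simp: inv_sqrt_def)
qed

lemma inv_sqrt_abs_integral:
  assumes "b \<ge> 0"
  shows "integrable lborel (\<lambda>x. inv_sqrt b \<bar>x\<bar>)" "(LINT x|lborel. inv_sqrt b \<bar>x\<bar>) = 4 * sqrt b"
proof -
  have e: "inv_sqrt b \<bar>x\<bar> = inv_sqrt b x + inv_sqrt b (0 + (-1) * x)" for x by (auto simp: inv_sqrt_def)
  have i2: "integrable lborel (\<lambda>x. inv_sqrt b (0 + (-1) * x))"
    by (rule lborel_integrable_real_affine[OF inv_sqrt_integral(1)[OF assms]]) simp
  have v2: "(LINT x|lborel. inv_sqrt b (0 + (-1) * x)) = 2 * sqrt b"
    using lborel_integral_real_affine[of "-1" "inv_sqrt b" 0] inv_sqrt_integral(2)[OF assms] by simp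
  show "integrable lborel (\<lambda>x. inv_sqrt b \<bar>x\<bar>)" unfolding e using inv_sqrt_integral(1)[OF assms] i2 by (rule Bochner_Integration.integrable_add)
  show "(LINT x|lborel. inv_sqrt b \<bar>x\<bar>) = 4 * sqrt b"
    unfolding e using Bochner_Integration.integral_add[OF inv_sqrt_integral(1)[OF assms] i2] v2 inv_sqrt_integral(2)[OF assms] by simp
qed

context core_form
begin

lemma EE_meas[measurable (raw)]:
  assumes [measurable]: "f1 \<in> borel_measurable M" "f2 \<in> borel_measurable M" "f3 \<in> borel_measurable M"
  shows "(\<lambda>x. EE (f1 x) (f2 x) (f3 x)) \<in> borel_measurable M"
  unfolding EE_def TP_def SS_def Sf_def by measurable

lemma EE_bound:
  assumes "\<Phi> p e t \<noteq> 0" "\<bar>e\<bar> \<le> 2"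
  shows "\<bar>EE p e t\<bar> \<le> 5/2"
proof -
  have "q t \<noteq> 0" "q (TP p t) \<noteq> 0" "q (Sf e t) \<noteq> 0" using assms by (auto simp: \<Phi>_def)
  then have "1/2 \<le> t" "t \<le> 1" "1/2 \<le> TP p t" "TP p t \<le> 1" "1/2 \<le> Sf e t" "Sf e t \<le> 1"
    using q_supp by auto
  then have "\<bar>t - Sf e t\<bar> \<le> 1/2" "\<bar>TP p t - t\<bar> \<le> 1/2" by argo+
  then have "\<bar>(t - Sf e t) * (TP p t - t)\<bar> \<le> 1/2 * (1/2)" unfolding abs_mult by (intro mult_mono) auto
  moreover have "EE p e t = e - 2 * ((t - Sf e t) * (TP p t - t))" unfolding EE_def by (simp only: mult.assoc)
  ultimately show ?thesis using assms(2) by linarith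
qed

lemma Mb_pos: "0 < p \<Longrightarrow> e \<noteq> 0 \<Longrightarrow> 0 < Mb p e"
  unfolding Mb_def using c lam eps(1) by (intro mult_pos_pos real_sqrt_gt_zero divide_pos_pos) auto

text \<open>The \<open>t\<close>-integral gives a function \<open>F\<close> whose transform is the
  symbol times that of a translate of \<open>g\<close>; hence the squared norm of \<open>F\<close>
  is at most \<open>4 * M\<^sup>2\<close>. The other three factors form a function \<open>h\<close>
  bounded by 1 on [-1,1]. Pairing by \<open>2 M y \<le> M\<^sup>2 + y\<^sup>2\<close> gives
  \<open>M + 2 * M\<close>.\<close>

lemma inner_bound:
  assumes p: "0 < p" "p \<le> 1" and e: "e \<noteq> 0" "\<bar>e\<bar> \<le> 2"
  shows "norm (LINT v|lborel. LINT t|lborel. Z t v p e) \<le> 3 * Mb p e"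
proof -
  define M where "M = Mb p e"
  have M: "M > 0" unfolding M_def by (rule Mb_pos[OF p(1) e(1)])
  define P where "P = \<Phi> p e"
  have [measurable]: "P \<in> borel_measurable borel" unfolding P_def by measurable
  define E where "E t = EE p e t" for t
  have [measurable]: "E \<in> borel_measurable borel" unfolding E_def by measurable
  have Pb: "norm (P t) \<le> 32" for t unfolding P_def by (rule \<Phi>_bound[OF e(2)])
  have Ps: "P t \<noteq> 0 \<Longrightarrow> \<bar>t\<bar> \<le> 5 \<and> \<bar>E t\<bar> \<le> 5/2" for t
    using EE_bound[of p e t] e q_supp[of t] unfolding P_def E_def by (auto simp: \<Phi>_def)
  define F where "F v = (LINT t|lborel. P t * g (v - p - E t))" for v
  define G where "G y = g (y - p)" for y
  have [measurable]: "F \<in> borel_measurable borel" "G \<in> borel_measurable borel" unfolding F_def G_def by measurable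
  have PG: "norm (P t * g y) \<le> 32" for t y using mult_mono[OF Pb[of t] g1[of y]] by (simp add: norm_mult)
  have Fb: "norm (F v) \<le> 2 * 5 * 32" for v
    unfolding F_def by (rule integral_bounded_supp) (use PG Ps in auto)
  have PGs: "P t * g (v - p - E t) \<noteq> 0 \<Longrightarrow> \<bar>t\<bar> \<le> 5 \<and> \<bar>v\<bar> \<le> 5" for t v
    using Ps[of t] gs[of "v - p - E t"] p by auto
  have Fs: "F v \<noteq> 0 \<Longrightarrow> \<bar>v\<bar> \<le> 5" for v unfolding F_def using PGs by (auto dest!: integral_nonzeroD)
  have Gb: "norm (G y) \<le> 1" and Gs: "G y \<noteq> 0 \<Longrightarrow> \<bar>y\<bar> \<le> 2" for y
    using g1[of "y-p"] gs[of "y-p"] p unfolding G_def by auto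
  have ftF: "norm (fourier F \<xi>) \<le> M * norm (fourier G \<xi>)" for \<xi>
  proof -
    have "fourier F \<xi> = (LINT v|lborel. LINT t|lborel. P t * g (v - p - E t) * cis (- \<xi> * v))"
      unfolding fourier_def F_def by (simp only: integral_mult_left_zero)
    also have "\<dots> = (LINT t|lborel. LINT v|lborel. P t * g (v - p - E t) * cis (- \<xi> * v))"
    proof (rule swap_bounded_supp[where B=32 and R=5])
      show "norm (P t * g (v - p - E t) * cis (- \<xi> * v)) \<le> 32" for v t
        using PG by (simp add: norm_mult)
    qed (use PGs in auto)
    also have "\<dots> = (LINT t|lborel. P t * cis (- \<xi> * E t) * fourier G \<xi>)"
    proof (rule Bochner_Integration.integral_cong[OF refl])
      fix t
      have "(LINT v|lborel. P t * g (v - p - E t) * cis (- \<xi> * v)) = (LINT v|lborel. P t * g (v + E t - p - E t) * cis (- \<xi> * (v + E t)))"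
        by (rule integral_shift)
      also have "\<dots> = (LINT v|lborel. P t * cis (- \<xi> * E t) * (G v * cis (- \<xi> * v)))"
      proof (rule Bochner_Integration.integral_cong[OF refl])
        fix v
        have "cis (- \<xi> * (v + E t)) = cis (- \<xi> * E t) * cis (- \<xi> * v)" by (simp add: cis_mult algebra_simps)
        then show "P t * g (v + E t - p - E t) * cis (- \<xi> * (v + E t)) = P t * cis (- \<xi> * E t) * (G v * cis (- \<xi> * v))"
          by (simp add: G_def)
      qed
      also have "\<dots> = P t * cis (- \<xi> * E t) * fourier G \<xi>" unfolding fourier_def by simp
      finally show "(LINT v|lborel. P t * g (v - p - E t) * cis (- \<xi> * v)) = P t * cis (- \<xi> * E t) * fourier G \<xi>" .
    qed
    also have "\<dots> = (LINT t|lborel. P t * cis (- \<xi> * E t)) * fourier G \<xi>" by simp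
    also have "norm \<dots> \<le> M * norm (fourier G \<xi>)"
      unfolding norm_mult M_def P_def E_def by (intro mult_right_mono multiplier_le p e) auto
    finally show ?thesis .
  qed
  have "(LINT v|lborel. (norm (F v))\<^sup>2) \<le> M\<^sup>2 * (LINT v|lborel. (norm (G v))\<^sup>2)"
    by (rule plancherel_dom[OF _ Fb Fs _ Gb Gs ftF]) auto
  also have "\<dots> \<le> M\<^sup>2 * (2 * 2 * 1)"
  proof (intro mult_left_mono)
    have "norm (LINT v|lborel. (norm (G v))\<^sup>2) \<le> 2 * 2 * 1"
      by (rule integral_bounded_supp) (use Gb Gs in \<open>auto simp: power_le_one\<close>)
    then show "(LINT v|lborel. (norm (G v))\<^sup>2) \<le> 2 * 2 * 1" by simp
  qed auto
  finally have F2: "(LINT v|lborel. (norm (F v))\<^sup>2) \<le> 4 * M\<^sup>2" by simp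
  define h where "h v = g v * cnj (g (v - p)) * cnj (g (v - e))" for v
  have [measurable]: "h \<in> borel_measurable borel" unfolding h_def by measurable
  have h1: "norm (h v) \<le> indicator {-1..1} v" for v
  proof (cases "g v = 0")
    case False
    have "norm (h v) \<le> 1 * 1 * 1"
      unfolding h_def norm_mult complex_mod_cnj using g1 by (intro mult_mono mult_nonneg_nonneg) auto
    then show ?thesis using gs[OF False] by (auto simp: indicator_def)
  qed (simp add: h_def)
  have Fsq: "(norm (F v))\<^sup>2 \<le> (2 * 5 * 32)\<^sup>2" for v using Fb[of v] by (intro power_mono) auto
  have indM: "integrable lborel (\<lambda>v. indicator {-1..1::real} v * (M / 2))"
    by (intro integrable_mult_left integrable_real_indicator) (auto simp: emeasure_lborel_Icc_eq)
  have "(LINT t|lborel. Z t v p e) = h v * F v" for v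
  proof -
    have "Z t v p e = h v * (P t * g (v - p - E t))" for t
      using p e by (simp add: Z_def h_def P_def E_def \<Phi>_def mult_ac)
    then show ?thesis unfolding F_def by simp
  qed
  then have "norm (LINT v|lborel. LINT t|lborel. Z t v p e) = norm (LINT v|lborel. h v * F v)" by simp
  also have "\<dots> \<le> (LINT v|lborel. indicator {-1..1} v * (M / 2) + (1 / (2 * M)) * (norm (F v))\<^sup>2)"
  proof (rule Bochner_Integration.integral_norm_bound_integral)
    show "norm (h v * F v) \<le> indicator {-1..1} v * (M / 2) + (1 / (2 * M)) * (norm (F v))\<^sup>2" for v
    proof -
      define y where "y = norm (F v)"
      have "2 * M * y \<le> M\<^sup>2 + y\<^sup>2" by (rule sum_squares_bound)
      then have y: "y \<le> M / 2 + 1 / (2 * M) * y\<^sup>2" using M by (simp add: field_simps power2_eq_square)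
      have "norm (h v * F v) \<le> indicator {-1..1} v * y" unfolding norm_mult y_def using h1 by (intro mult_right_mono) auto
      also have "\<dots> \<le> indicator {-1..1} v * (M / 2) + (1 / (2 * M)) * y\<^sup>2"
        using y M by (auto simp: indicator_def)
      finally show ?thesis unfolding y_def .
    qed
    show "integrable lborel (\<lambda>v. h v * F v)"
    proof (rule integrable_lborel_bounded_supp[where B="1 * (2 * 5 * 32)" and R=5])
      show "norm (h v * F v) \<le> 1 * (2 * 5 * 32)" for v
        unfolding norm_mult using order_trans[OF h1[of v], of 1] Fb[of v] by (intro mult_mono) (auto simp: indicator_def)
    qed (use Fs in auto)
    show "integrable lborel (\<lambda>v. indicator {-1..1} v * (M / 2) + (1 / (2 * M)) * (norm (F v))\<^sup>2)"
    proof (intro Bochner_Integration.integrable_add integrable_mult_right)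
      show "integrable lborel (\<lambda>v. indicator {-1..1::real} v * (M / 2))"
        by (rule indM)
      show "integrable lborel (\<lambda>v. (norm (F v))\<^sup>2)"
        by (rule integrable_lborel_bounded_supp[where B="(2 * 5 * 32)\<^sup>2" and R=5]) (use Fs Fsq in auto)
    qed
  qed
  also have "\<dots> = (LINT v|lborel. indicator {-1..1::real} v * (M / 2)) + (LINT v|lborel. (1 / (2 * M)) * (norm (F v))\<^sup>2)"
  proof (rule Bochner_Integration.integral_add)
    show "integrable lborel (\<lambda>v. indicator {-1..1::real} v * (M / 2))"
      by (rule indM)
    show "integrable lborel (\<lambda>v. (1 / (2 * M)) * (norm (F v))\<^sup>2)"
      by (rule integrable_mult_right, rule integrable_lborel_bounded_supp[where B="(2 * 5 * 32)\<^sup>2" and R=5]) (use Fs Fsq in auto)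
  qed
  also have "\<dots> = M + (1 / (2 * M)) * (LINT v|lborel. (norm (F v))\<^sup>2)" by simp
  also have "\<dots> \<le> M + (1 / (2 * M)) * (4 * M\<^sup>2)" using F2 M by (intro add_left_mono mult_left_mono) auto
  also have "\<dots> = 3 * M" using M by (simp add: power2_eq_square)
  finally show ?thesis unfolding M_def .
qed

definition "Wc = 3 * 2176 * sqrt (80 / c) * sqrt (1 / (lm * \<bar>\<epsilon>\<bar>))"

lemma Wc_pos: "Wc > 0" unfolding Wc_def using c lam eps(1) by (intro mult_pos_pos real_sqrt_gt_zero divide_pos_pos) auto

text \<open>Outside the null set \<open>e = 0\<close> the bound splits into a function of
  \<open>p\<close> and a function of \<open>e\<close>, both with an integrable inverse square root
  singularity. Their integrals are 2 and \<open>4 * sqrt 2 \<le> 6\<close>, whence 12.\<close>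

lemma Ip_bound: "Ip \<le> 12 * Wc"
proof -
  define X where "X p e = (LINT v|lborel. LINT t|lborel. Z t v p e)" for p e
  have [measurable]: "(\<lambda>(p,e). X p e) \<in> borel_measurable (borel \<Otimes>\<^sub>M borel)" unfolding X_def by measurable
  have Xz: "X p e \<noteq> 0 \<Longrightarrow> 0 < p \<and> p \<le> 1 \<and> \<bar>e\<bar> \<le> 2" for p e
    unfolding X_def by (auto dest!: integral_nonzeroD simp: Z_def split: if_splits)
  have Xb: "norm (X p e) \<le> 2*2*(2*2*32)" for p e
    unfolding X_def by (intro integral_bounded_supp) (use Z_bound Z_supp in \<open>auto dest!: integral_nonzeroD\<close>)
  have Xe: "norm (X p e) \<le> Wc * inv_sqrt 1 p * inv_sqrt 2 \<bar>e\<bar>" if "e \<noteq> 0" for p e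
  proof (cases "X p e = 0")
    case True
    then show ?thesis using Wc_pos by (simp add: inv_sqrt_def)
  next
    case False
    then have pe: "0 < p" "p \<le> 1" "\<bar>e\<bar> \<le> 2" using Xz by auto
    have "norm (X p e) \<le> 3 * Mb p e" unfolding X_def by (rule inner_bound) (use pe that in auto)
    also have "\<dots> = Wc * inv_sqrt 1 p * inv_sqrt 2 \<bar>e\<bar>"
      using pe that unfolding Mb_def Wc_def by (simp add: inv_sqrt_def real_sqrt_mult real_sqrt_divide)
    finally show ?thesis .
  qed
  have Xi: "integrable lborel (\<lambda>e. X p e)" for p
    by (rule integrable_lborel_bounded_supp[OF _ Xb, where R=2]) (use Xz in auto)
  have i2: "integrable lborel (\<lambda>e. Wc * inv_sqrt 1 p * inv_sqrt 2 \<bar>e\<bar>)" for p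
    using inv_sqrt_abs_integral(1)[of 2] by (intro integrable_mult_right) auto
  have row: "norm (LINT e|lborel. X p e) \<le> Wc * inv_sqrt 1 p * 6" for p
  proof -
    have "norm (LINT e|lborel. X p e) \<le> (LINT e|lborel. norm (X p e))" by (rule integral_norm_bound)
    also have "\<dots> \<le> (LINT e|lborel. Wc * inv_sqrt 1 p * inv_sqrt 2 \<bar>e\<bar>)"
    proof (rule integral_mono_AE)
      have "AE e in lborel. e \<noteq> (0::real)" by (rule AE_lborel_singleton)
      then show "AE e in lborel. norm (X p e) \<le> Wc * inv_sqrt 1 p * inv_sqrt 2 \<bar>e\<bar>" by eventually_elim (rule Xe)
    qed (use Xi i2 in auto)
    also have "\<dots> = Wc * inv_sqrt 1 p * (4 * sqrt 2)" using inv_sqrt_abs_integral(2)[of 2] by simp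
    also have "\<dots> \<le> Wc * inv_sqrt 1 p * 6"
    proof (rule mult_left_mono)
      have "sqrt 2 \<le> 3/2" by (rule real_le_lsqrt) (auto simp: power2_eq_square)
      then show "4 * sqrt 2 \<le> 6" by simp
    qed (use Wc_pos in \<open>auto simp: inv_sqrt_def\<close>)
    finally show ?thesis .
  qed
  have "norm (complex_of_real Ip) \<le> (LINT p|lborel. Wc * inv_sqrt 1 p * 6)"
    unfolding Ip_eq X_def[symmetric]
  proof (rule Bochner_Integration.integral_norm_bound_integral)
    show "integrable lborel (\<lambda>p. LINT e|lborel. X p e)"
    proof (rule integrable_lborel_bounded_supp[where B="2*2*(2*2*(2*2*32))" and R=2])
      show "norm (LINT e|lborel. X p e) \<le> 2*2*(2*2*(2*2*32))" for p
        by (rule integral_bounded_supp) (use Xb Xz in auto)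
    qed (use Xz in \<open>auto dest!: integral_nonzeroD, fastforce?\<close>)
    show "integrable lborel (\<lambda>p. Wc * inv_sqrt 1 p * 6)"
      using inv_sqrt_integral(1)[of 1] by (intro integrable_mult_left integrable_mult_right) auto
  qed (rule row)
  also have "\<dots> = 12 * Wc" using inv_sqrt_integral(2)[of 1] by simp
  finally show ?thesis by simp
qed

text \<open>The supports lie in a square with \<open>R = 3\<close>, so the first 12 is
  \<open>4 * R\<close>; the second comes from \<open>Ip_bound\<close>.\<close>

lemma core_bound:
  assumes [measurable]: "f \<in> borel_measurable borel" and f1: "\<And>x. norm (f x) \<le> 1"
  shows "(LINT x|lborel. (norm (LINT t|lborel. f (\<epsilon> * x - t) * (q t * g (x - t\<^sup>2))))\<^sup>2) \<le> 12 * sqrt (12 * Wc)"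
proof -
  have "(LINT u|lborel. f u * K x u) = (LINT t|lborel. f (\<epsilon> * x - t) * (q t * g (x - t\<^sup>2)))" for x
  proof -
    have "(LINT u|lborel. f u * K x u) = (LINT t|lborel. f (\<epsilon> * x - t) * K x (\<epsilon> * x - t))" by (rule integral_reflect)
    then show ?thesis by (simp add: K_def)
  qed
  then have "(LINT x|lborel. (norm (LINT t|lborel. f (\<epsilon> * x - t) * (q t * g (x - t\<^sup>2))))\<^sup>2) \<le> (LINT u1|lborel. LINT u2|lborel. norm (L u1 u2))"
    using TT_star_bound[of f] f1 by simp
  also have "\<dots> \<le> 4 * 3 * sqrt (12 * Wc)"
    by (rule L1_norm_le) (use Ip_bound Wc_pos in \<open>auto simp: Ip_def\<close>)
  finally show ?thesis by simp
qed

end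

section \<open>Localization and scaling\<close>

text \<open>What is retained of the oscillatory estimate: a gain \<gamma> for bounded
  \<open>g\<close> supported in [-1,1]. The passage to square integrable \<open>g\<close> on the
  whole line uses nothing else about the phase.\<close>

locale local_operator =
  fixes \<epsilon> \<gamma> :: real and qq :: "real \<Rightarrow> complex"
  assumes qm[measurable]: "qq \<in> borel_measurable borel" and qb: "\<And>t. norm (qq t) \<le> 2"
    and qs: "\<And>t. qq t \<noteq> 0 \<Longrightarrow> 1/2 \<le> t \<and> t \<le> 1" and \<gamma>: "\<gamma> > 0"
    and H: "\<And>f g. f \<in> borel_measurable borel \<Longrightarrow> (\<And>x. norm (f x) \<le> 1) \<Longrightarrow> g \<in> borel_measurable borel \<Longrightarrow> (\<And>x. norm (g x) \<le> 1) \<Longrightarrow>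
       (\<And>x. g x \<noteq> 0 \<Longrightarrow> \<bar>x\<bar> \<le> 1) \<Longrightarrow> (LINT x|lborel. (norm (LINT t|lborel. f (\<epsilon> * x - t) * (qq t * g (x - t\<^sup>2))))\<^sup>2) \<le> \<gamma>"
begin

definition "A f g x = (LINT t|lborel. f (\<epsilon> * x - t) * (qq t * g (x - t\<^sup>2)))"

lemma A_meas[measurable]:
  assumes [measurable]: "f \<in> borel_measurable borel" "g \<in> borel_measurable borel"
  shows "A f g \<in> borel_measurable borel"
  unfolding A_def by measurable

text \<open>For the substitution \<open>s = t\<^sup>2\<close> the Jacobian \<open>2 * t\<close> is
  at least 1 on the support of \<open>qq\<close>, so integration along the parabola costs no more
  than integration over the line.\<close>

lemma nn_subst:
  assumes [measurable]: "G \<in> borel_measurable borel"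
  shows "(\<integral>\<^sup>+t. ennreal (norm (qq t * G (x - t\<^sup>2))) \<partial>lborel) \<le> 2 * (\<integral>\<^sup>+y. ennreal (norm (G y)) \<partial>lborel)"
proof -
  define h where "h s = norm (G (x - s))" for s
  have [measurable]: "h \<in> borel_measurable borel" unfolding h_def by measurable
  have "(\<integral>\<^sup>+t. ennreal (norm (qq t * G (x - t\<^sup>2))) \<partial>lborel) \<le> (\<integral>\<^sup>+t. 2 * ennreal (h (t\<^sup>2) * (2 * t) * indicator {1/2..1} t) \<partial>lborel)"
  proof (rule nn_integral_mono)
    fix t :: real
    show "ennreal (norm (qq t * G (x - t\<^sup>2))) \<le> 2 * ennreal (h (t\<^sup>2) * (2 * t) * indicator {1/2..1} t)"
    proof (cases "qq t = 0")
      case False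
      then have t: "1/2 \<le> t" "t \<le> 1" using qs by auto
      have "norm (qq t * G (x - t\<^sup>2)) \<le> 2 * h (t\<^sup>2)"
        unfolding norm_mult h_def using qb by (intro mult_right_mono) auto
      also have "\<dots> \<le> 2 * (h (t\<^sup>2) * (2 * t))" using t mult_left_mono[of 1 "2 * t" "h (t\<^sup>2)"] by (simp add: h_def mult_ac)
      finally have "ennreal (norm (qq t * G (x - t\<^sup>2))) \<le> ennreal (2 * (h (t\<^sup>2) * (2 * t)))" by (rule ennreal_leI)
      also have "\<dots> = 2 * ennreal (h (t\<^sup>2) * (2 * t))" using t by (subst ennreal_mult) (auto simp: h_def)
      finally show ?thesis using t by simp
    qed simp
  qed
  also have "\<dots> = 2 * (\<integral>\<^sup>+t. ennreal (h (t\<^sup>2) * (2 * t) * indicator {1/2..1} t) \<partial>lborel)"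
    by (rule nn_integral_cmult) auto
  also have "(\<integral>\<^sup>+t. ennreal (h (t\<^sup>2) * (2 * t) * indicator {1/2..1} t) \<partial>lborel) = (\<integral>\<^sup>+s. ennreal (h s * indicator {(1/2)\<^sup>2..1\<^sup>2} s) \<partial>lborel)"
    by (rule nn_integral_substitution[symmetric, where g="\<lambda>t. t\<^sup>2"])
       (auto simp: set_borel_measurable_def intro!: derivative_eq_intros continuous_intros)
  also have "\<dots> \<le> (\<integral>\<^sup>+s. ennreal (norm (G (x + (-1) * s))) \<partial>lborel)"
    by (rule nn_integral_mono) (auto simp: h_def indicator_def)
  also have "\<dots> = (\<integral>\<^sup>+y. ennreal (norm (G y)) \<partial>lborel)"
    using nn_integral_real_affine[of "\<lambda>y. ennreal (norm (G y))" "-1" x] by simp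
  finally show ?thesis by (simp add: mult_left_mono)
qed

lemma A_bound_L1:
  assumes [measurable]: "f \<in> borel_measurable borel" "G \<in> borel_measurable borel" and f1: "\<And>x. norm (f x) \<le> 1"
    and fin: "(\<integral>\<^sup>+y. ennreal (norm (G y)) \<partial>lborel) < \<infinity>"
  shows "integrable lborel (\<lambda>t. f (\<epsilon> * x - t) * (qq t * G (x - t\<^sup>2)))"
    "ennreal (norm (A f G x)) \<le> 2 * (\<integral>\<^sup>+y. ennreal (norm (G y)) \<partial>lborel)"
proof -
  have le: "(\<integral>\<^sup>+t. ennreal (norm (f (\<epsilon> * x - t) * (qq t * G (x - t\<^sup>2)))) \<partial>lborel) \<le> 2 * (\<integral>\<^sup>+y. ennreal (norm (G y)) \<partial>lborel)"
  proof (rule order_trans[OF nn_integral_mono nn_subst])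
    fix t
    have "norm (f (\<epsilon> * x - t)) * norm (qq t * G (x - t\<^sup>2)) \<le> 1 * norm (qq t * G (x - t\<^sup>2))"
      using f1 by (intro mult_right_mono) auto
    then show "ennreal (norm (f (\<epsilon> * x - t) * (qq t * G (x - t\<^sup>2)))) \<le> ennreal (norm (qq t * G (x - t\<^sup>2)))"
      by (intro ennreal_leI) (simp add: norm_mult)
  qed auto
  show i: "integrable lborel (\<lambda>t. f (\<epsilon> * x - t) * (qq t * G (x - t\<^sup>2)))"
    by (rule integrableI_bounded) (use le fin in \<open>auto simp: ennreal_mult_less_top intro: le_less_trans\<close>)
  show "ennreal (norm (A f G x)) \<le> 2 * (\<integral>\<^sup>+y. ennreal (norm (G y)) \<partial>lborel)"
    unfolding A_def using integral_norm_bound_ennreal[OF i] le by (rule order_trans)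
qed

text \<open>Homogeneity reduces to height 1. The scaled output is bounded with bounded support,
  which allows the estimate \<open>H\<close> for Bochner integrals to be read as one for nonnegative
  integrals.\<close>

lemma bounded_part:
  assumes [measurable]: "f \<in> borel_measurable borel" "G \<in> borel_measurable borel" and f1: "\<And>x. norm (f x) \<le> 1"
    and M: "M > 0" "\<And>y. norm (G y) \<le> M" and Gs: "\<And>y. G y \<noteq> 0 \<Longrightarrow> \<bar>y\<bar> \<le> 1"
  shows "(\<integral>\<^sup>+x. ennreal ((norm (A f G x))\<^sup>2) \<partial>lborel) \<le> ennreal (M\<^sup>2 * \<gamma>)"
proof -
  define G' where "G' y = G y / of_real M" for y
  have [measurable]: "G' \<in> borel_measurable borel" unfolding G'_def by measurable
  have G1: "norm (G' y) \<le> 1" for y using M by (simp add: G'_def norm_divide divide_le_eq)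
  have Gs': "G' y \<noteq> 0 \<Longrightarrow> \<bar>y\<bar> \<le> 1" for y using Gs[of y] by (auto simp: G'_def)
  have AA: "A f G x = of_real M * A f G' x" for x
    unfolding A_def G'_def integral_mult_right_zero[symmetric] using M by (intro Bochner_Integration.integral_cong) auto
  have b: "norm (f (\<epsilon> * x - t) * (qq t * G' (x - t\<^sup>2))) \<le> 2" for x t
  proof -
    have "norm (f (\<epsilon> * x - t)) * (norm (qq t) * norm (G' (x - t\<^sup>2))) \<le> 1 * (2 * 1)"
      using f1 qb G1 by (intro mult_mono) auto
    then show ?thesis by (simp add: norm_mult)
  qed
  have Ab: "norm (A f G' x) \<le> 2 * 1 * 2" for x
    unfolding A_def by (rule integral_bounded_supp) (use b qs in \<open>auto, fastforce\<close>)
  have As: "\<bar>x\<bar> \<le> 2" if nz: "A f G' x \<noteq> 0" for x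
  proof -
    obtain t where t: "f (\<epsilon> * x - t) * (qq t * G' (x - t\<^sup>2)) \<noteq> 0" using integral_nonzeroD[OF nz[unfolded A_def]] by blast
    then have t: "1/2 \<le> t" "t \<le> 1" "\<bar>x - t\<^sup>2\<bar> \<le> 1" using qs[of t] Gs'[of "x - t\<^sup>2"] by auto
    have "t\<^sup>2 \<le> 1" "0 \<le> t\<^sup>2" using t by (auto simp: power_le_one)
    then show ?thesis using t by linarith
  qed
  have Asq: "(norm (A f G' x))\<^sup>2 \<le> 4\<^sup>2" for x using Ab[of x] by (intro power_mono) auto
  have i: "integrable lborel (\<lambda>x. (norm (A f G' x))\<^sup>2)"
    by (rule integrable_lborel_bounded_supp[where B="4\<^sup>2" and R=2]) (use Asq As in auto)
  have "(\<integral>\<^sup>+x. ennreal ((norm (A f G x))\<^sup>2) \<partial>lborel) = (\<integral>\<^sup>+x. ennreal (M\<^sup>2) * ennreal ((norm (A f G' x))\<^sup>2) \<partial>lborel)"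
    unfolding AA norm_mult power_mult_distrib by (intro nn_integral_cong) (simp add: ennreal_mult)
  also have "\<dots> = ennreal (M\<^sup>2) * ennreal (LINT x|lborel. (norm (A f G' x))\<^sup>2)"
    by (subst nn_integral_cmult) (auto simp: nn_integral_eq_integral[OF i])
  also have "\<dots> \<le> ennreal (M\<^sup>2) * ennreal \<gamma>"
    using H[of f G'] f1 G1 Gs' unfolding A_def by (intro mult_left_mono ennreal_leI) auto
  also have "\<dots> = ennreal (M\<^sup>2 * \<gamma>)" using \<gamma> by (simp add: ennreal_mult)
  finally show ?thesis .
qed

text \<open>Truncating \<open>g\<close> at height \<open>M\<close>: the bounded part is controlled by \<open>\<gamma>\<close>, the rest through its \<open>L\<^sup>1\<close> norm,
  which is at most \<open>1/M\<close> times the squared \<open>L\<^sup>2\<close> norm; \<open>M\<close> is then optimized.\<close>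

lemma bound_unit_interval:
  assumes [measurable]: "f \<in> borel_measurable borel" "g \<in> borel_measurable borel" and f1: "\<And>x. norm (f x) \<le> 1"
  shows "(\<integral>\<^sup>+x. ennreal ((norm (A f g x))\<^sup>2) * indicator {0..1} x \<partial>lborel)
    \<le> ennreal (10 * sqrt \<gamma>) * (\<integral>\<^sup>+y. ennreal ((norm (g y))\<^sup>2) * indicator {-1..1} y \<partial>lborel)"
proof (cases "(\<integral>\<^sup>+y. ennreal ((norm (g y))\<^sup>2) * indicator {-1..1} y \<partial>lborel) = \<infinity>")
  case True
  then show ?thesis using \<gamma> by (simp add: ennreal_mult_top)
next
  case False
  define E where "E = enn2real (\<integral>\<^sup>+y. ennreal ((norm (g y))\<^sup>2) * indicator {-1..1} y \<partial>lborel)"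
  have E0: "0 \<le> E" by (simp add: E_def)
  have E: "(\<integral>\<^sup>+y. ennreal ((norm (g y))\<^sup>2) * indicator {-1..1} y \<partial>lborel) = ennreal E"
    unfolding E_def using False by (simp add: less_top)
  have main: "(\<integral>\<^sup>+x. ennreal ((norm (A f g x))\<^sup>2) * indicator {0..1} x \<partial>lborel) \<le> ennreal (10 * sqrt \<gamma> * (E + \<eta>))" if \<eta>: "\<eta> > 0" for \<eta>
  proof -
    \<comment> \<open>This choice balances \<open>M\<^sup>2 * \<gamma>\<close> from the bounded part
      against \<open>(E / M)\<^sup>2\<close> from the rest; both become at most
      \<open>(E + \<eta>) * sqrt \<gamma>\<close>, and the weights 2 and 8 add up to 10. The
      auxiliary \<eta> keeps \<open>M\<close> positive when \<open>E = 0\<close> and is removed at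
      the end.\<close>
    define M where "M = sqrt ((E + \<eta>) / sqrt \<gamma>)"
    have M: "M > 0" "M\<^sup>2 = (E + \<eta>) / sqrt \<gamma>" using E0 \<eta> \<gamma> by (auto simp: M_def)
    define G1 where "G1 y = (if \<bar>y\<bar> \<le> 1 \<and> norm (g y) \<le> M then g y else 0)" for y
    define G2 where "G2 y = (if \<bar>y\<bar> \<le> 1 \<and> \<not> norm (g y) \<le> M then g y else 0)" for y
    have [measurable]: "G1 \<in> borel_measurable borel" "G2 \<in> borel_measurable borel" unfolding G1_def G2_def by measurable
    have n2: "(\<integral>\<^sup>+y. ennreal (norm (G2 y)) \<partial>lborel) \<le> ennreal (E / M)"
    proof -
      have "(\<integral>\<^sup>+y. ennreal (norm (G2 y)) \<partial>lborel) \<le> (\<integral>\<^sup>+y. ennreal (1 / M) * (ennreal ((norm (g y))\<^sup>2) * indicator {-1..1} y) \<partial>lborel)"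
      proof (rule nn_integral_mono)
        fix y
        show "ennreal (norm (G2 y)) \<le> ennreal (1 / M) * (ennreal ((norm (g y))\<^sup>2) * indicator {-1..1} y)"
        proof (cases "\<bar>y\<bar> \<le> 1 \<and> \<not> norm (g y) \<le> M")
          case True
          then have "M * norm (g y) \<le> (norm (g y))\<^sup>2" unfolding power2_eq_square by (intro mult_right_mono) auto
          then have "norm (g y) \<le> 1 / M * (norm (g y))\<^sup>2" using M by (simp add: field_simps)
          then have "ennreal (norm (g y)) \<le> ennreal (1 / M) * ennreal ((norm (g y))\<^sup>2)"
            using M by (simp add: ennreal_mult[symmetric] ennreal_leI)
          moreover have "y \<in> {-1..1}" using True by auto
          ultimately show ?thesis using True by (simp add: G2_def)
        qed (auto simp: G2_def)
      qed
      also have "\<dots> = ennreal (1 / M) * ennreal E" by (subst nn_integral_cmult) (auto simp: E)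
      also have "\<dots> = ennreal (E / M)" using M E0 by (simp add: ennreal_mult[symmetric])
      finally show ?thesis .
    qed
    have n1: "(\<integral>\<^sup>+y. ennreal (norm (G1 y)) \<partial>lborel) < \<infinity>"
    proof -
      have "integrable lborel G1" by (rule integrable_lborel_bounded_supp[where B=M and R=1]) (use M in \<open>auto simp: G1_def split: if_splits\<close>)
      then show ?thesis by (simp add: integrable_iff_bounded)
    qed
    have n2': "(\<integral>\<^sup>+y. ennreal (norm (G2 y)) \<partial>lborel) < \<infinity>" using n2 by (simp add: le_less_trans)
    \<comment> \<open>For \<open>x\<close> in [0,1] and \<open>t\<close> in [1/2,1] the point
      \<open>x - t\<^sup>2\<close> stays in [-1,1], so restricting \<open>g\<close> to that interval
      goes unnoticed.\<close>
    have A12: "A f g x = A f G1 x + A f G2 x" if x: "x \<in> {0..1}" for x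
    proof -
      have "A f g x = (LINT t|lborel. f (\<epsilon> * x - t) * (qq t * G1 (x - t\<^sup>2)) + f (\<epsilon> * x - t) * (qq t * G2 (x - t\<^sup>2)))"
        unfolding A_def
      proof (rule Bochner_Integration.integral_cong[OF refl])
        fix t
        show "f (\<epsilon> * x - t) * (qq t * g (x - t\<^sup>2)) = f (\<epsilon> * x - t) * (qq t * G1 (x - t\<^sup>2)) + f (\<epsilon> * x - t) * (qq t * G2 (x - t\<^sup>2))"
        proof (cases "qq t = 0")
          case False
          then have t: "1/2 \<le> t" "t \<le> 1" using qs by auto
          then have "t\<^sup>2 \<le> 1" "0 \<le> t\<^sup>2" by (auto simp: power_le_one)
          moreover have "0 \<le> x" "x \<le> 1" using x by auto
          ultimately have "\<bar>x - t\<^sup>2\<bar> \<le> 1" by linarith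
          then show ?thesis by (simp add: G1_def G2_def)
        qed simp
      qed
      also have "\<dots> = A f G1 x + A f G2 x" unfolding A_def
        by (rule Bochner_Integration.integral_add) (intro A_bound_L1(1) f1 n1 n2'; measurable)+
      finally show ?thesis .
    qed
    have A2: "norm (A f G2 x) \<le> 2 * (E / M)" for x
    proof -
      have "ennreal (norm (A f G2 x)) \<le> 2 * ennreal (E / M)"
        by (rule order_trans[OF A_bound_L1(2)]) (use f1 n2 n2' in \<open>auto intro!: mult_left_mono\<close>)
      also have "\<dots> = ennreal (2 * (E / M))" using M E0 by (subst ennreal_mult) auto
      finally show ?thesis using M E0 by (subst (asm) ennreal_le_iff) auto
    qed
    have "(\<integral>\<^sup>+x. ennreal ((norm (A f g x))\<^sup>2) * indicator {0..1} x \<partial>lborel) \<le>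
       (\<integral>\<^sup>+x. 2 * ennreal ((norm (A f G1 x))\<^sup>2) + ennreal (2 * (2 * (E / M))\<^sup>2) * indicator {0..1} x \<partial>lborel)"
    proof (rule nn_integral_mono)
      fix x
      show "ennreal ((norm (A f g x))\<^sup>2) * indicator {0..1} x \<le> 2 * ennreal ((norm (A f G1 x))\<^sup>2) + ennreal (2 * (2 * (E / M))\<^sup>2) * indicator {0..1} x"
      proof (cases "x \<in> {0..1}")
        case True
        define u v where "u = norm (A f G1 x)" and "v = norm (A f G2 x)"
        have "(norm (A f g x))\<^sup>2 \<le> (u + v)\<^sup>2" unfolding A12[OF True] u_def v_def by (intro power_mono norm_triangle_ineq) auto
        also have "\<dots> \<le> 2 * u\<^sup>2 + 2 * v\<^sup>2" using sum_squares_bound[of u v] by (simp add: power2_eq_square algebra_simps)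
        also have "\<dots> \<le> 2 * u\<^sup>2 + 2 * (2 * (E / M))\<^sup>2" using A2[of x] unfolding v_def by (intro add_left_mono mult_left_mono power_mono) auto
        finally have "ennreal ((norm (A f g x))\<^sup>2) \<le> ennreal (2 * u\<^sup>2 + 2 * (2 * (E / M))\<^sup>2)" by (rule ennreal_leI)
        also have "\<dots> = 2 * ennreal (u\<^sup>2) + ennreal (2 * (2 * (E / M))\<^sup>2)"
          by (subst ennreal_plus) (auto simp: ennreal_mult)
        finally show ?thesis using True by (simp add: u_def)
      qed simp
    qed
    also have "\<dots> = 2 * (\<integral>\<^sup>+x. ennreal ((norm (A f G1 x))\<^sup>2) \<partial>lborel) + ennreal (2 * (2 * (E / M))\<^sup>2)"
      by (subst nn_integral_add) (auto simp: nn_integral_cmult)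
    also have "\<dots> \<le> 2 * ennreal (M\<^sup>2 * \<gamma>) + ennreal (2 * (2 * (E / M))\<^sup>2)"
      by (intro add_right_mono mult_left_mono bounded_part) (use f1 M in \<open>auto simp: G1_def split: if_splits\<close>)
    also have "\<dots> = ennreal (2 * (M\<^sup>2 * \<gamma>) + 2 * (2 * (E / M))\<^sup>2)"
      using \<gamma> by (subst ennreal_plus) (auto simp: ennreal_mult)
    also have "\<dots> \<le> ennreal (10 * sqrt \<gamma> * (E + \<eta>))"
    proof (rule ennreal_leI)
      have g: "\<gamma> = sqrt \<gamma> * sqrt \<gamma>" "sqrt \<gamma> > 0" using \<gamma> by auto
      have 1: "M\<^sup>2 * \<gamma> = (E + \<eta>) * sqrt \<gamma>" unfolding M(2) using g by (simp add: field_simps)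
      have "(2 * (E / M))\<^sup>2 = 4 * (E\<^sup>2 / M\<^sup>2)" by (simp add: power_mult_distrib power_divide)
      also have "E\<^sup>2 / M\<^sup>2 = E * (E / (E + \<eta>)) * sqrt \<gamma>" unfolding M(2) using g E0 \<eta> by (simp add: power2_eq_square)
      also have "\<dots> \<le> (E + \<eta>) * 1 * sqrt \<gamma>" using E0 \<eta> g by (intro mult_right_mono mult_mono) auto
      finally show "2 * (M\<^sup>2 * \<gamma>) + 2 * (2 * (E / M))\<^sup>2 \<le> 10 * sqrt \<gamma> * (E + \<eta>)" unfolding 1 by (simp add: algebra_simps)
    qed
    finally show ?thesis .
  qed
  show ?thesis unfolding E
  proof (rule ennreal_le_epsilon)
    fix e :: real assume e: "0 < e"
    have g: "sqrt \<gamma> > 0" using \<gamma> by auto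
    have "(\<integral>\<^sup>+x. ennreal ((norm (A f g x))\<^sup>2) * indicator {0..1} x \<partial>lborel) \<le> ennreal (10 * sqrt \<gamma> * (E + e / (10 * sqrt \<gamma>)))"
      by (rule main) (use e g in auto)
    also have "10 * sqrt \<gamma> * (E + e / (10 * sqrt \<gamma>)) = 10 * sqrt \<gamma> * E + e" using g by (simp add: field_simps)
    also have "ennreal \<dots> = ennreal (10 * sqrt \<gamma>) * ennreal E + ennreal e"
      using g E0 e by (subst ennreal_plus) (auto simp: ennreal_mult)
    finally show "(\<integral>\<^sup>+x. ennreal ((norm (A f g x))\<^sup>2) * indicator {0..1} x \<partial>lborel) \<le> ennreal (10 * sqrt \<gamma>) * ennreal E + ennreal e" .
  qed
qed

lemma nn_shift:
  fixes F :: "real \<Rightarrow> ennreal"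
  assumes [measurable]: "F \<in> borel_measurable borel"
  shows "(\<integral>\<^sup>+x. F x \<partial>lborel) = (\<integral>\<^sup>+x. F (x + y) \<partial>lborel)"
  using nn_integral_real_affine[of F 1 y] by (simp add: add.commute)

text \<open>Translation by \<open>y\<close> acts on \<open>g\<close> by \<open>y\<close> and on
  \<open>f\<close> by \<open>\<epsilon> * y\<close>; the class of functions \<open>f\<close> bounded
  by 1 is invariant under this.\<close>

lemma bound_interval:
  assumes [measurable]: "f \<in> borel_measurable borel" "g \<in> borel_measurable borel" and f1: "\<And>x. norm (f x) \<le> 1"
  shows "(\<integral>\<^sup>+x. ennreal ((norm (A f g x))\<^sup>2) * indicator {y..y+1} x \<partial>lborel)
    \<le> ennreal (10 * sqrt \<gamma>) * (\<integral>\<^sup>+z. ennreal ((norm (g z))\<^sup>2) * indicator {y-1..y+1} z \<partial>lborel)"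
proof -
  define f' g' where "f' z = f (z + \<epsilon> * y)" and "g' z = g (z + y)" for z
  have [measurable]: "f' \<in> borel_measurable borel" "g' \<in> borel_measurable borel" unfolding f'_def g'_def by measurable
  have AA: "A f g (x + y) = A f' g' x" for x
    unfolding A_def f'_def g'_def by (intro Bochner_Integration.integral_cong refl) (simp add: algebra_simps)
  have "(\<integral>\<^sup>+x. ennreal ((norm (A f g x))\<^sup>2) * indicator {y..y+1} x \<partial>lborel) =
     (\<integral>\<^sup>+x. ennreal ((norm (A f g (x + y)))\<^sup>2) * indicator {y..y+1} (x + y) \<partial>lborel)"
    by (rule nn_shift) measurable
  also have "\<dots> = (\<integral>\<^sup>+x. ennreal ((norm (A f' g' x))\<^sup>2) * indicator {0..1} x \<partial>lborel)"
    unfolding AA by (intro nn_integral_cong) (auto simp: indicator_def)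
  also have "\<dots> \<le> ennreal (10 * sqrt \<gamma>) * (\<integral>\<^sup>+z. ennreal ((norm (g' z))\<^sup>2) * indicator {-1..1} z \<partial>lborel)"
    by (rule bound_unit_interval) (use f1 in \<open>auto simp: f'_def\<close>)
  also have "(\<integral>\<^sup>+z. ennreal ((norm (g' z))\<^sup>2) * indicator {-1..1} z \<partial>lborel) = (\<integral>\<^sup>+z. ennreal ((norm (g (z + y)))\<^sup>2) * indicator {y-1..y+1} (z + y) \<partial>lborel)"
    unfolding g'_def by (intro nn_integral_cong) (auto simp: indicator_def)
  also have "\<dots> = (\<integral>\<^sup>+z. ennreal ((norm (g z))\<^sup>2) * indicator {y-1..y+1} z \<partial>lborel)"
    by (rule nn_shift[symmetric]) measurable
  finally show ?thesis .
qed

text \<open>The local estimate is integrated over the position \<open>y\<close> of the interval.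
  Each \<open>x\<close> belongs to the intervals on the left for a set of \<open>y\<close> of length
  1, each \<open>z\<close> to those on the right for a set of length 2, which doubles the
  constant.\<close>

lemma bound_line:
  assumes [measurable]: "f \<in> borel_measurable borel" "g \<in> borel_measurable borel" and f1: "\<And>x. norm (f x) \<le> 1"
  shows "(\<integral>\<^sup>+x. ennreal ((norm (A f g x))\<^sup>2) \<partial>lborel) \<le> ennreal (20 * sqrt \<gamma>) * (\<integral>\<^sup>+z. ennreal ((norm (g z))\<^sup>2) \<partial>lborel)"
proof -
  have ind: "(\<integral>\<^sup>+y. (\<integral>\<^sup>+x. F x * (if y - l \<le> x \<and> x \<le> y + 1 then 1 else 0) \<partial>lborel) \<partial>lborel) = ennreal (1 + l) * (\<integral>\<^sup>+x. F x \<partial>lborel)"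
    if [measurable]: "F \<in> borel_measurable borel" and l: "0 \<le> l" for F :: "real \<Rightarrow> ennreal" and l :: real
  proof -
    have "(\<integral>\<^sup>+y. (\<integral>\<^sup>+x. F x * (if y - l \<le> x \<and> x \<le> y + 1 then 1 else 0) \<partial>lborel) \<partial>lborel)
      = (\<integral>\<^sup>+x. (\<integral>\<^sup>+y. F x * (if y - l \<le> x \<and> x \<le> y + 1 then 1 else 0) \<partial>lborel) \<partial>lborel)"
      by (rule lborel_pair.Fubini'[symmetric]) measurable
    also have "\<dots> = (\<integral>\<^sup>+x. F x * ennreal (1 + l) \<partial>lborel)"
    proof (rule nn_integral_cong)
      fix x
      have "(\<integral>\<^sup>+y. F x * (if y - l \<le> x \<and> x \<le> y + 1 then 1 else 0) \<partial>lborel) = (\<integral>\<^sup>+y. F x * indicator {x-1..x+l} y \<partial>lborel)"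
        by (intro nn_integral_cong) (auto simp: indicator_def)
      also have "\<dots> = F x * ennreal (1 + l)" using l by (subst nn_integral_cmult_indicator) (auto simp: add.commute)
      finally show "(\<integral>\<^sup>+y. F x * (if y - l \<le> x \<and> x \<le> y + 1 then 1 else 0) \<partial>lborel) = F x * ennreal (1 + l)" .
    qed
    also have "\<dots> = ennreal (1 + l) * (\<integral>\<^sup>+x. F x \<partial>lborel)" by (subst nn_integral_multc) (auto simp: mult.commute)
    finally show ?thesis .
  qed
  have i1: "(indicator {a..b} x :: ennreal) = (if a \<le> x \<and> x \<le> b then 1 else 0)" for a b x :: real by (auto simp: indicator_def)
  have "(\<integral>\<^sup>+x. ennreal ((norm (A f g x))\<^sup>2) \<partial>lborel) = (\<integral>\<^sup>+y. (\<integral>\<^sup>+x. ennreal ((norm (A f g x))\<^sup>2) * indicator {y..y+1} x \<partial>lborel) \<partial>lborel)"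
    unfolding i1 using ind[of "\<lambda>x. ennreal ((norm (A f g x))\<^sup>2)" 0] by simp
  also have "\<dots> \<le> (\<integral>\<^sup>+y. ennreal (10 * sqrt \<gamma>) * (\<integral>\<^sup>+z. ennreal ((norm (g z))\<^sup>2) * indicator {y-1..y+1} z \<partial>lborel) \<partial>lborel)"
    by (intro nn_integral_mono bound_interval f1) auto
  also have "\<dots> = ennreal (10 * sqrt \<gamma>) * (ennreal (1 + 1) * (\<integral>\<^sup>+z. ennreal ((norm (g z))\<^sup>2) \<partial>lborel))"
    unfolding i1 by (subst nn_integral_cmult) (auto simp: ind)
  also have "\<dots> = ennreal (20 * sqrt \<gamma>) * (\<integral>\<^sup>+z. ennreal ((norm (g z))\<^sup>2) \<partial>lborel)"
  proof -
    have "ennreal (10 * sqrt \<gamma>) * ennreal (1 + 1) = ennreal (20 * sqrt \<gamma>)" using \<gamma> by (subst ennreal_mult[symmetric]) auto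
    then show ?thesis by (simp only: mult.assoc[symmetric])
  qed
  finally show ?thesis .
qed

end

section \<open>The power phase\<close>

lemma phase_powr:
  assumes b: "\<beta> > 0"
  shows "phase (\<lambda>t. t powr (-\<beta>)) (\<lambda>t. -\<beta> * t powr (-\<beta>-1)) (\<lambda>t. \<beta> * (\<beta>+1) * t powr (-\<beta>-2))
    (\<lambda>t. - (\<beta> * (\<beta>+1) * (\<beta>+2)) * t powr (-\<beta>-3)) (\<lambda>t. \<beta> * (\<beta>+1) * (\<beta>+2) * (\<beta>+3) * t powr (-\<beta>-4))
    (\<beta> * (\<beta>+1) * (1/2) powr (-\<beta>-2) + \<beta> * (\<beta>+1) * (\<beta>+2) * (1/2) powr (-\<beta>-3)) (\<beta> * (\<beta>+1) * (\<beta>+2) * (\<beta>+3))"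
proof
  have D: "((\<lambda>t. k * t powr r) has_real_derivative k * (r * t powr (r - 1))) (at t)" if "t > 0" for k r t :: real
    by (intro DERIV_cmult has_real_derivative_powr that)
  have le: "t powr (-s) \<le> (1/2) powr (-s)" if "1/2 \<le> t" "s \<ge> 0" for t s :: real
    using that by (intro powr_mono2') auto
  fix t :: real
  {
    assume t: "t > 0"
    show "((\<lambda>t. t powr (-\<beta>)) has_real_derivative -\<beta> * t powr (-\<beta>-1)) (at t)"
      using D[OF t, of 1 "-\<beta>"] by simp
    have 1: "-\<beta>-1-1 = -\<beta>-2" and 2: "-\<beta>-2-1 = -\<beta>-3" and 3: "-\<beta>-3-1 = -\<beta>-4" by auto
    have "-\<beta> * ((-\<beta>-1) * t powr (-\<beta>-2)) = \<beta> * (\<beta>+1) * t powr (-\<beta>-2)" by (simp add: algebra_simps)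
    then show "((\<lambda>t. -\<beta> * t powr (-\<beta>-1)) has_real_derivative \<beta> * (\<beta>+1) * t powr (-\<beta>-2)) (at t)"
      using D[OF t, of "-\<beta>" "-\<beta>-1"] unfolding 1 by simp
    have "\<beta> * (\<beta>+1) * ((-\<beta>-2) * t powr (-\<beta>-3)) = - (\<beta> * (\<beta>+1) * (\<beta>+2)) * t powr (-\<beta>-3)" by (simp add: algebra_simps)
    then show "((\<lambda>t. \<beta> * (\<beta>+1) * t powr (-\<beta>-2)) has_real_derivative - (\<beta> * (\<beta>+1) * (\<beta>+2)) * t powr (-\<beta>-3)) (at t)"
      using D[OF t, of "\<beta> * (\<beta>+1)" "-\<beta>-2"] unfolding 2 by simp
    have "- (\<beta> * (\<beta>+1) * (\<beta>+2)) * ((-\<beta>-3) * t powr (-\<beta>-4)) = \<beta> * (\<beta>+1) * (\<beta>+2) * (\<beta>+3) * t powr (-\<beta>-4)" by (simp add: algebra_simps)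
    then show "((\<lambda>t. - (\<beta> * (\<beta>+1) * (\<beta>+2)) * t powr (-\<beta>-3)) has_real_derivative \<beta> * (\<beta>+1) * (\<beta>+2) * (\<beta>+3) * t powr (-\<beta>-4)) (at t)"
      using D[OF t, of "- (\<beta> * (\<beta>+1) * (\<beta>+2))" "-\<beta>-3"] unfolding 3 by simp
  }
  {
    assume t: "1/2 \<le> t" "t \<le> 1"
    have "t powr (-\<beta>-2) \<le> (1/2) powr (-\<beta>-2)" using le[of t "\<beta>+2"] t b by (simp add: algebra_simps)
    then have "\<beta> * (\<beta>+1) * t powr (-\<beta>-2) \<le> \<beta> * (\<beta>+1) * (1/2) powr (-\<beta>-2)" using b by (intro mult_left_mono) auto
    moreover have "0 \<le> \<beta> * (\<beta>+1) * (\<beta>+2) * (1/2) powr (-\<beta>-3)" "0 \<le> \<beta> * (\<beta>+1) * t powr (-\<beta>-2)" using b by auto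
    ultimately show "\<bar>\<beta> * (\<beta>+1) * t powr (-\<beta>-2)\<bar> \<le> \<beta> * (\<beta>+1) * (1/2) powr (-\<beta>-2) + \<beta> * (\<beta>+1) * (\<beta>+2) * (1/2) powr (-\<beta>-3)"
      by linarith
    have "t powr (-\<beta>-3) \<le> (1/2) powr (-\<beta>-3)" using le[of t "\<beta>+3"] t b by (simp add: algebra_simps)
    then have "\<beta> * (\<beta>+1) * (\<beta>+2) * t powr (-\<beta>-3) \<le> \<beta> * (\<beta>+1) * (\<beta>+2) * (1/2) powr (-\<beta>-3)" using b by (intro mult_left_mono) auto
    moreover have "0 \<le> \<beta> * (\<beta>+1) * (1/2) powr (-\<beta>-2)" "0 \<le> \<beta> * (\<beta>+1) * (\<beta>+2) * t powr (-\<beta>-3)" using b by auto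
    moreover have "- (\<beta> * (\<beta>+1) * (\<beta>+2)) * t powr (-\<beta>-3) = - (\<beta> * (\<beta>+1) * (\<beta>+2) * t powr (-\<beta>-3))" by simp
    ultimately show "\<bar>- (\<beta> * (\<beta>+1) * (\<beta>+2)) * t powr (-\<beta>-3)\<bar> \<le> \<beta> * (\<beta>+1) * (1/2) powr (-\<beta>-2) + \<beta> * (\<beta>+1) * (\<beta>+2) * (1/2) powr (-\<beta>-3)"
      by linarith
    have "1 powr (-\<beta>-4) \<le> t powr (-\<beta>-4)" using t b by (intro powr_mono2') auto
    then show "\<beta> * (\<beta>+1) * (\<beta>+2) * (\<beta>+3) \<le> \<beta> * (\<beta>+1) * (\<beta>+2) * (\<beta>+3) * t powr (-\<beta>-4)"
      using b mult_left_mono[of 1 "t powr (-\<beta>-4)" "\<beta> * (\<beta>+1) * (\<beta>+2) * (\<beta>+3)"] by simp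
  }
  show "0 < \<beta> * (\<beta>+1) * (\<beta>+2) * (\<beta>+3)" using b by simp
  show "0 < \<beta> * (\<beta>+1) * (1/2) powr (-\<beta>-2) + \<beta> * (\<beta>+1) * (\<beta>+2) * (1/2) powr (-\<beta>-3)"
    using b by (intro add_pos_pos mult_pos_pos) auto
qed

text \<open>The rescaled kernel: the dilation \<open>t \<mapsto> |\<epsilon>| t\<close> multiplies
  the phase by \<open>|\<epsilon>| powr (-\<beta>)\<close> and leaves \<open>dt / t\<close>
  unchanged.\<close>

definition "qpow \<beta> \<epsilon> a t = (if a \<le> t \<and> t \<le> 1 then cis (\<bar>\<epsilon>\<bar> powr (-\<beta>) * t powr (-\<beta>)) / complex_of_real t else 0)"

text \<open>With \<open>lm = |\<epsilon>| powr (-\<beta>)\<close> the gain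
  \<open>1 / (lm * |\<epsilon>|)\<close> is \<open>|\<epsilon>| powr (\<beta> - 1)\<close>. It
  enters \<open>Wc\<close> under a square root, and \<open>core_bound\<close> takes another one;
  hence the quarter.\<close>

lemma local_operator_powr:
  assumes b: "\<beta> > 1"
  obtains \<epsilon>0 K where "\<epsilon>0 > 0" "\<epsilon>0 \<le> 1" "K > 0"
    "\<And>\<epsilon> a. \<epsilon> \<noteq> 0 \<Longrightarrow> \<bar>\<epsilon>\<bar> \<le> \<epsilon>0 \<Longrightarrow> 1/2 \<le> a \<Longrightarrow> a \<le> 1 \<Longrightarrow> local_operator \<epsilon> (K * \<bar>\<epsilon>\<bar> powr ((\<beta>-1)/4)) (qpow \<beta> \<epsilon> a)"
proof -
  define c where "c = \<beta> * (\<beta>+1) * (\<beta>+2) * (\<beta>+3)"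
  define C where "C = \<beta> * (\<beta>+1) * (1/2) powr (-\<beta>-2) + \<beta> * (\<beta>+1) * (\<beta>+2) * (1/2) powr (-\<beta>-3)"
  have b0: "\<beta> > 0" using b by simp
  have ph: "phase (\<lambda>t. t powr (-\<beta>)) (\<lambda>t. -\<beta> * t powr (-\<beta>-1)) (\<lambda>t. \<beta> * (\<beta>+1) * t powr (-\<beta>-2))
    (\<lambda>t. - (\<beta> * (\<beta>+1) * (\<beta>+2)) * t powr (-\<beta>-3)) (\<lambda>t. \<beta> * (\<beta>+1) * (\<beta>+2) * (\<beta>+3) * t powr (-\<beta>-4)) C c"
    unfolding c_def C_def by (rule phase_powr[OF b0])
  interpret ph: phase "\<lambda>t. t powr (-\<beta>)" "\<lambda>t. -\<beta> * t powr (-\<beta>-1)" "\<lambda>t. \<beta> * (\<beta>+1) * t powr (-\<beta>-2)"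
    "\<lambda>t. - (\<beta> * (\<beta>+1) * (\<beta>+2)) * t powr (-\<beta>-3)" "\<lambda>t. \<beta> * (\<beta>+1) * (\<beta>+2) * (\<beta>+3) * t powr (-\<beta>-4)" C c by (rule ph)
  define \<epsilon>0 where "\<epsilon>0 = min (1/100) (c / (1200 * C))"
  define W where "W = 12 * (3 * 2176 * sqrt (80 / c))"
  have W: "W > 0" using ph.c by (simp add: W_def)
  show thesis
  proof
    show "\<epsilon>0 > 0" "\<epsilon>0 \<le> 1" using ph.c ph.C by (auto simp: \<epsilon>0_def)
    show "12 * sqrt W > 0" using W by simp
    fix \<epsilon> a :: real assume e: "\<epsilon> \<noteq> 0" "\<bar>\<epsilon>\<bar> \<le> \<epsilon>0" and a: "1/2 \<le> a" "a \<le> 1"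
    define lm where "lm = \<bar>\<epsilon>\<bar> powr (-\<beta>)"
    have lm: "lm > 0" using e by (simp add: lm_def)
    show "local_operator \<epsilon> (12 * sqrt W * \<bar>\<epsilon>\<bar> powr ((\<beta>-1)/4)) (qpow \<beta> \<epsilon> a)"
    proof
      show "qpow \<beta> \<epsilon> a \<in> borel_measurable borel" unfolding qpow_def by measurable
      show "norm (qpow \<beta> \<epsilon> a t) \<le> 2" for t using a by (auto simp: qpow_def norm_divide divide_simps)
      show "qpow \<beta> \<epsilon> a t \<noteq> 0 \<Longrightarrow> 1/2 \<le> t \<and> t \<le> 1" for t using a by (auto simp: qpow_def split: if_splits)
      show "0 < 12 * sqrt W * \<bar>\<epsilon>\<bar> powr ((\<beta>-1)/4)" using W e by simp
      fix f g :: "real \<Rightarrow> complex"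
      assume f: "f \<in> borel_measurable borel" "\<And>x. norm (f x) \<le> 1" and g: "g \<in> borel_measurable borel" "\<And>x. norm (g x) \<le> 1"
        and gs: "\<And>x. g x \<noteq> 0 \<Longrightarrow> \<bar>x\<bar> \<le> 1"
      interpret fo: core_form "\<lambda>t. t powr (-\<beta>)" "\<lambda>t. -\<beta> * t powr (-\<beta>-1)" "\<lambda>t. \<beta> * (\<beta>+1) * t powr (-\<beta>-2)"
        "\<lambda>t. - (\<beta> * (\<beta>+1) * (\<beta>+2)) * t powr (-\<beta>-3)" "\<lambda>t. \<beta> * (\<beta>+1) * (\<beta>+2) * (\<beta>+3) * t powr (-\<beta>-4)" C c \<epsilon> a lm g
        by unfold_locales (use e a lm g gs in \<open>auto simp: \<epsilon>0_def\<close>)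
      have q: "fo.q t = qpow \<beta> \<epsilon> a t" for t unfolding fo.q_def unfolding qpow_def lm_def by simp
      have "lm * \<bar>\<epsilon>\<bar> = \<bar>\<epsilon>\<bar> powr (-\<beta>) * \<bar>\<epsilon>\<bar> powr 1" using e by (simp add: lm_def)
      also have "\<dots> = \<bar>\<epsilon>\<bar> powr (-\<beta> + 1)" by (rule powr_add[symmetric])
      finally have "1 / (lm * \<bar>\<epsilon>\<bar>) = \<bar>\<epsilon>\<bar> powr (\<beta> - 1)" by (simp add: powr_minus_divide[of _ "\<beta> - 1", symmetric] powr_minus_divide inverse_eq_divide[symmetric] powr_minus[symmetric])
      then have "fo.Wc = 3 * 2176 * sqrt (80 / c) * sqrt (\<bar>\<epsilon>\<bar> powr (\<beta> - 1))" by (simp add: fo.Wc_def)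
      then have "12 * fo.Wc = W * sqrt (\<bar>\<epsilon>\<bar> powr (\<beta> - 1))" by (simp add: W_def)
      then have "sqrt (12 * fo.Wc) = sqrt W * sqrt (sqrt (\<bar>\<epsilon>\<bar> powr (\<beta> - 1)))" by (simp add: real_sqrt_mult)
      also have "sqrt (sqrt (\<bar>\<epsilon>\<bar> powr (\<beta> - 1))) = \<bar>\<epsilon>\<bar> powr ((\<beta> - 1) / 4)"
        by (simp add: powr_half_sqrt[symmetric] powr_powr)
      finally show "(LINT x|lborel. (norm (LINT t|lborel. f (\<epsilon> * x - t) * (qpow \<beta> \<epsilon> a t * g (x - t\<^sup>2))))\<^sup>2) \<le> 12 * sqrt W * \<bar>\<epsilon>\<bar> powr ((\<beta>-1)/4)"
        using fo.core_bound[OF f] unfolding q by (simp add: mult.assoc)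
    qed
  qed
qed

section \<open>One piece of the operator at its own scale\<close>

definition "osc_kernel \<beta> t = cis (\<bar>t\<bar> powr (-\<beta>)) / complex_of_real \<bar>t\<bar>"
text \<open>The variable \<open>t\<close> is positive and \<sigma> selects the half line:
  \<open>g (x - t\<^sup>2)\<close> and the kernel are even in \<open>t\<close>, so the sign matters
  for \<open>f\<close> only.\<close>

definition "piece_op \<beta> f g r1 r2 \<sigma> x = (LINT t|lborel. (if r1 \<le> t \<and> t \<le> r2 then f (x - \<sigma> * t) * g (x - t\<^sup>2) * osc_kernel \<beta> t else 0))"

lemma osc_kernel_meas[measurable]: "osc_kernel \<beta> \<in> borel_measurable borel" unfolding osc_kernel_def by measurable

lemma piece_op_meas[measurable]:
  assumes [measurable]: "f \<in> borel_measurable borel" "g \<in> borel_measurable borel"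
  shows "piece_op \<beta> f g r1 r2 \<sigma> \<in> borel_measurable borel"
  unfolding piece_op_def by measurable

text \<open>The scaling \<open>t \<mapsto> r2 t\<close>, \<open>x \<mapsto> r2\<^sup>2 x\<close> brings the piece to unit scale, with a dilate of \<open>f\<close> evaluated at \<open>\<sigma> r2 x - t\<close>
  and the phase multiplied by \<open>r2 powr (-\<beta>)\<close>.\<close>

lemma piece_op_scaled:
  assumes loc: "\<And>\<epsilon> a. \<epsilon> \<noteq> 0 \<Longrightarrow> \<bar>\<epsilon>\<bar> \<le> \<epsilon>0 \<Longrightarrow> 1/2 \<le> a \<Longrightarrow> a \<le> 1 \<Longrightarrow> local_operator \<epsilon> (K * \<bar>\<epsilon>\<bar> powr ((\<beta>-1)/4)) (qpow \<beta> \<epsilon> a)"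
    and f[measurable]: "f \<in> borel_measurable borel" and f1: "\<And>x. norm (f x) \<le> 1" and g[measurable]: "g \<in> borel_measurable borel"
    and r: "0 < r1" "r1 \<le> r2" "r2 \<le> 2 * r1" "r2 \<le> \<epsilon>0" and \<sigma>: "\<sigma> = 1 \<or> \<sigma> = -1" and K: "K > 0"
  shows "(\<integral>\<^sup>+x. ennreal ((norm (piece_op \<beta> f g r1 r2 \<sigma> x))\<^sup>2) \<partial>lborel) \<le> ennreal (20 * sqrt K * r2 powr ((\<beta>-1)/8)) * (\<integral>\<^sup>+z. ennreal ((norm (g z))\<^sup>2) \<partial>lborel)"
proof -
  have r2: "r2 > 0" using r by simp
  define \<epsilon> where "\<epsilon> = \<sigma> * r2"
  have \<epsilon>: "\<epsilon> \<noteq> 0" "\<bar>\<epsilon>\<bar> = r2" using \<sigma> r2 by (auto simp: \<epsilon>_def abs_mult)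
  define a where "a = r1 / r2"
  have a: "1/2 \<le> a" "a \<le> 1" using r r2 by (auto simp: a_def divide_simps)
  interpret local_operator \<epsilon> "K * r2 powr ((\<beta>-1)/4)" "qpow \<beta> \<epsilon> a"
    using loc[OF \<epsilon>(1) _ a] \<epsilon> r by simp
  define F where "F z = f (\<epsilon> * z)" for z
  define G where "G z = g (r2\<^sup>2 * z)" for z
  have [measurable]: "F \<in> borel_measurable borel" "G \<in> borel_measurable borel" unfolding F_def G_def by measurable
  have PA: "piece_op \<beta> f g r1 r2 \<sigma> (0 + r2\<^sup>2 * x) = A F G x" for x
  proof -
    have "piece_op \<beta> f g r1 r2 \<sigma> (0 + r2\<^sup>2 * x) = \<bar>r2\<bar> *\<^sub>R (LINT t|lborel. (if r1 \<le> 0 + r2 * t \<and> 0 + r2 * t \<le> r2 then f (0 + r2\<^sup>2 * x - \<sigma> * (0 + r2 * t)) * g (0 + r2\<^sup>2 * x - (0 + r2 * t)\<^sup>2) * osc_kernel \<beta> (0 + r2 * t) else 0))"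
      unfolding piece_op_def by (rule lborel_integral_real_affine) (use r2 in auto)
    also have "\<dots> = (LINT t|lborel. r2 *\<^sub>R (if r1 \<le> 0 + r2 * t \<and> 0 + r2 * t \<le> r2 then f (0 + r2\<^sup>2 * x - \<sigma> * (0 + r2 * t)) * g (0 + r2\<^sup>2 * x - (0 + r2 * t)\<^sup>2) * osc_kernel \<beta> (0 + r2 * t) else 0))"
      using r2 by simp
    also have "\<dots> = A F G x" unfolding A_def
    proof (rule Bochner_Integration.integral_cong[OF refl])
      fix t
      have iff: "r1 \<le> 0 + r2 * t \<and> 0 + r2 * t \<le> r2 \<longleftrightarrow> a \<le> t \<and> t \<le> 1"
        using r2 by (auto simp: a_def divide_le_eq mult.commute)
      show "r2 *\<^sub>R (if r1 \<le> 0 + r2 * t \<and> 0 + r2 * t \<le> r2 then f (0 + r2\<^sup>2 * x - \<sigma> * (0 + r2 * t)) * g (0 + r2\<^sup>2 * x - (0 + r2 * t)\<^sup>2) * osc_kernel \<beta> (0 + r2 * t) else 0)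
        = F (\<epsilon> * x - t) * (qpow \<beta> \<epsilon> a t * G (x - t\<^sup>2))"
      proof (cases "a \<le> t \<and> t \<le> 1")
        case True
        then have t: "t > 0" using a by linarith
        have e1: "0 + r2\<^sup>2 * x - \<sigma> * (0 + r2 * t) = \<epsilon> * (\<epsilon> * x - t)" using \<sigma> by (auto simp: \<epsilon>_def power2_eq_square algebra_simps)
        have e2: "0 + r2\<^sup>2 * x - (0 + r2 * t)\<^sup>2 = r2\<^sup>2 * (x - t\<^sup>2)" by (simp add: power_mult_distrib algebra_simps)
        have e3: "r2 *\<^sub>R osc_kernel \<beta> (0 + r2 * t) = qpow \<beta> \<epsilon> a t"
          using True r2 t \<epsilon> by (simp add: osc_kernel_def qpow_def powr_mult scaleR_conv_of_real)
        show ?thesis unfolding iff using True unfolding e1 e2 F_def G_def e3[symmetric] by (simp add: scaleR_conv_of_real)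
      next
        case False
        then show ?thesis unfolding iff by (auto simp: qpow_def)
      qed
    qed
    finally show ?thesis .
  qed
  have "(\<integral>\<^sup>+x. ennreal ((norm (piece_op \<beta> f g r1 r2 \<sigma> x))\<^sup>2) \<partial>lborel) = ennreal \<bar>r2\<^sup>2\<bar> * (\<integral>\<^sup>+x. ennreal ((norm (piece_op \<beta> f g r1 r2 \<sigma> (0 + r2\<^sup>2 * x)))\<^sup>2) \<partial>lborel)"
    by (rule nn_integral_real_affine) (use r2 in auto)
  also have "\<dots> \<le> ennreal \<bar>r2\<^sup>2\<bar> * (ennreal (20 * sqrt (K * r2 powr ((\<beta>-1)/4))) * (\<integral>\<^sup>+z. ennreal ((norm (G z))\<^sup>2) \<partial>lborel))"
    unfolding PA by (intro mult_left_mono bound_line) (use f1 in \<open>auto simp: F_def\<close>)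
  also have "\<dots> = ennreal (20 * sqrt (K * r2 powr ((\<beta>-1)/4))) * (ennreal \<bar>r2\<^sup>2\<bar> * (\<integral>\<^sup>+z. ennreal ((norm (g (0 + r2\<^sup>2 * z)))\<^sup>2) \<partial>lborel))"
    by (simp add: G_def mult_ac)
  also have "ennreal \<bar>r2\<^sup>2\<bar> * (\<integral>\<^sup>+z. ennreal ((norm (g (0 + r2\<^sup>2 * z)))\<^sup>2) \<partial>lborel) = (\<integral>\<^sup>+z. ennreal ((norm (g z))\<^sup>2) \<partial>lborel)"
    by (rule nn_integral_real_affine[symmetric]) (use r2 in auto)
  also have "sqrt (K * r2 powr ((\<beta>-1)/4)) = sqrt K * r2 powr ((\<beta>-1)/8)"
    by (simp add: real_sqrt_mult powr_half_sqrt[symmetric] powr_powr)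
  finally show ?thesis by (simp add: mult.assoc)
qed

section \<open>Bounds by absolute values\<close>

definition "abs_piece g r1 r2 x = (\<integral>\<^sup>+t. (if r1 \<le> t \<and> t \<le> r2 then ennreal (norm (g (x - t\<^sup>2)) / t) else 0) \<partial>lborel)"

lemma abs_piece_meas[measurable]:
  assumes [measurable]: "g \<in> borel_measurable borel"
  shows "abs_piece g r1 r2 \<in> borel_measurable borel"
  unfolding abs_piece_def by measurable

text \<open>Cauchy--Schwarz in \<open>t\<close>, followed by an exchange of integrals. The factor is
  the squared relative length of the interval, so short cells are controlled without any
  cancellation.\<close>

lemma abs_piece_bound:
  assumes g[measurable]: "g \<in> borel_measurable borel" and r: "0 < r1" "r1 \<le> r2"
  shows "(\<integral>\<^sup>+x. (abs_piece g r1 r2 x)\<^sup>2 \<partial>lborel) \<le> ennreal (((r2 - r1) / r1)\<^sup>2) * (\<integral>\<^sup>+z. ennreal ((norm (g z))\<^sup>2) \<partial>lborel)"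
proof -
  have "(abs_piece g r1 r2 x)\<^sup>2 \<le> ennreal ((r2 - r1) / r1\<^sup>2) * (\<integral>\<^sup>+t. ennreal ((norm (g (x - t\<^sup>2)))\<^sup>2) * indicator {r1..r2} t \<partial>lborel)" for x
  proof -
    define u where "u t = (if r1 \<le> t \<and> t \<le> r2 then ennreal (norm (g (x - t\<^sup>2)) / t) else 0)" for t
    have [measurable]: "u \<in> borel_measurable borel" unfolding u_def by measurable
    have "abs_piece g r1 r2 x = (\<integral>\<^sup>+t. indicator {r1..r2} t * u t \<partial>lborel)"
      unfolding abs_piece_def u_def by (intro nn_integral_cong) (auto simp: indicator_def)
    then have "(abs_piece g r1 r2 x)\<^sup>2 \<le> (\<integral>\<^sup>+t. (indicator {r1..r2} t)\<^sup>2 \<partial>lborel) * (\<integral>\<^sup>+t. (u t)\<^sup>2 \<partial>lborel)"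
      using Cauchy_Schwarz_nn_integral[of "indicator {r1..r2}" lborel u] by simp
    also have "(\<integral>\<^sup>+t. (indicator {r1..r2} t)\<^sup>2 \<partial>lborel) = (\<integral>\<^sup>+t. indicator {r1..r2} (t::real) \<partial>lborel)"
      by (intro nn_integral_cong) (auto simp: indicator_def)
    also have "\<dots> = ennreal (r2 - r1)" using r by simp
    also have "(\<integral>\<^sup>+t. (u t)\<^sup>2 \<partial>lborel) \<le> (\<integral>\<^sup>+t. ennreal (1 / r1\<^sup>2) * (ennreal ((norm (g (x - t\<^sup>2)))\<^sup>2) * indicator {r1..r2} t) \<partial>lborel)"
    proof (rule nn_integral_mono)
      fix t
      show "(u t)\<^sup>2 \<le> ennreal (1 / r1\<^sup>2) * (ennreal ((norm (g (x - t\<^sup>2)))\<^sup>2) * indicator {r1..r2} t)"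
      proof (cases "r1 \<le> t \<and> t \<le> r2")
        case True
        have "(norm (g (x - t\<^sup>2)) / t)\<^sup>2 \<le> (norm (g (x - t\<^sup>2)) / r1)\<^sup>2" using True r by (intro power_mono frac_le) auto
        also have "\<dots> = 1 / r1\<^sup>2 * (norm (g (x - t\<^sup>2)))\<^sup>2" by (simp add: power_divide)
        finally have "ennreal ((norm (g (x - t\<^sup>2)) / t)\<^sup>2) \<le> ennreal (1 / r1\<^sup>2 * (norm (g (x - t\<^sup>2)))\<^sup>2)" by (rule ennreal_leI)
        also have "\<dots> = ennreal (1 / r1\<^sup>2) * ennreal ((norm (g (x - t\<^sup>2)))\<^sup>2)" by (rule ennreal_mult) auto
        finally have "ennreal ((norm (g (x - t\<^sup>2)) / t)\<^sup>2) \<le> ennreal (1 / r1\<^sup>2) * ennreal ((norm (g (x - t\<^sup>2)))\<^sup>2)" .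
        moreover have "(u t)\<^sup>2 = ennreal ((norm (g (x - t\<^sup>2)) / t)\<^sup>2)" using True r by (simp add: u_def ennreal_power)
        moreover have "(indicator {r1..r2} t :: ennreal) = 1" using True by simp
        ultimately show ?thesis by (simp only: mult_1_right)
      qed (auto simp: u_def)
    qed
    also have "\<dots> = ennreal (1 / r1\<^sup>2) * (\<integral>\<^sup>+t. ennreal ((norm (g (x - t\<^sup>2)))\<^sup>2) * indicator {r1..r2} t \<partial>lborel)"
      by (rule nn_integral_cmult) measurable
    finally show ?thesis using r by (simp add: mult.assoc[symmetric] ennreal_mult[symmetric] mult_left_mono)
  qed
  then have "(\<integral>\<^sup>+x. (abs_piece g r1 r2 x)\<^sup>2 \<partial>lborel) \<le> (\<integral>\<^sup>+x. ennreal ((r2 - r1) / r1\<^sup>2) * (\<integral>\<^sup>+t. ennreal ((norm (g (x - t\<^sup>2)))\<^sup>2) * indicator {r1..r2} t \<partial>lborel) \<partial>lborel)"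
    by (intro nn_integral_mono)
  also have "\<dots> = ennreal ((r2 - r1) / r1\<^sup>2) * (\<integral>\<^sup>+x. (\<integral>\<^sup>+t. ennreal ((norm (g (x - t\<^sup>2)))\<^sup>2) * indicator {r1..r2} t \<partial>lborel) \<partial>lborel)"
    by (rule nn_integral_cmult) measurable
  also have "(\<integral>\<^sup>+x. (\<integral>\<^sup>+t. ennreal ((norm (g (x - t\<^sup>2)))\<^sup>2) * indicator {r1..r2} t \<partial>lborel) \<partial>lborel) =
     (\<integral>\<^sup>+t. (\<integral>\<^sup>+x. ennreal ((norm (g (x - t\<^sup>2)))\<^sup>2) * indicator {r1..r2} t \<partial>lborel) \<partial>lborel)"
    by (rule lborel_pair.Fubini'[symmetric]) measurable
  also have "\<dots> = (\<integral>\<^sup>+t. (\<integral>\<^sup>+z. ennreal ((norm (g z))\<^sup>2) \<partial>lborel) * indicator {r1..r2} t \<partial>lborel)"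
  proof (rule nn_integral_cong)
    fix t
    have "(\<integral>\<^sup>+x. ennreal ((norm (g (x - t\<^sup>2)))\<^sup>2) \<partial>lborel) = (\<integral>\<^sup>+z. ennreal ((norm (g z))\<^sup>2) \<partial>lborel)"
      using nn_integral_real_affine[of "\<lambda>z. ennreal ((norm (g z))\<^sup>2)" 1 "- t\<^sup>2"] by simp
    then show "(\<integral>\<^sup>+x. ennreal ((norm (g (x - t\<^sup>2)))\<^sup>2) * indicator {r1..r2} t \<partial>lborel) = (\<integral>\<^sup>+z. ennreal ((norm (g z))\<^sup>2) \<partial>lborel) * indicator {r1..r2} t"
      by (subst nn_integral_multc) auto
  qed
  also have "\<dots> = (\<integral>\<^sup>+z. ennreal ((norm (g z))\<^sup>2) \<partial>lborel) * ennreal (r2 - r1)"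
    using r by (subst nn_integral_cmult_indicator) auto
  also have "ennreal ((r2 - r1) / r1\<^sup>2) * ((\<integral>\<^sup>+z. ennreal ((norm (g z))\<^sup>2) \<partial>lborel) * ennreal (r2 - r1)) =
     ennreal (((r2 - r1) / r1)\<^sup>2) * (\<integral>\<^sup>+z. ennreal ((norm (g z))\<^sup>2) \<partial>lborel)"
  proof -
    have "ennreal (((r2 - r1) / r1)\<^sup>2) = ennreal ((r2 - r1) / r1\<^sup>2) * ennreal (r2 - r1)"
      using r by (subst ennreal_mult[symmetric]) (auto simp: power2_eq_square)
    then show ?thesis by (simp add: mult_ac)
  qed
  finally show ?thesis .
qed

lemma piece_op_le_abs_piece:
  assumes f1: "\<And>x. norm (f x) \<le> 1" and r: "0 < r1"
  shows "ennreal (norm (piece_op \<beta> f g r1 r2 \<sigma> x)) \<le> abs_piece g r1 r2 x"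
proof (cases "integrable lborel (\<lambda>t. (if r1 \<le> t \<and> t \<le> r2 then f (x - \<sigma> * t) * g (x - t\<^sup>2) * osc_kernel \<beta> t else 0))")
  case True
  have "ennreal (norm (piece_op \<beta> f g r1 r2 \<sigma> x)) \<le> (\<integral>\<^sup>+t. ennreal (norm (if r1 \<le> t \<and> t \<le> r2 then f (x - \<sigma> * t) * g (x - t\<^sup>2) * osc_kernel \<beta> t else 0)) \<partial>lborel)"
    unfolding piece_op_def by (rule integral_norm_bound_ennreal[OF True])
  also have "\<dots> \<le> abs_piece g r1 r2 x" unfolding abs_piece_def
  proof (rule nn_integral_mono)
    fix t
    have "norm (f (x - \<sigma> * t) * g (x - t\<^sup>2) * osc_kernel \<beta> t) \<le> norm (g (x - t\<^sup>2)) / t" if "r1 \<le> t"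
    proof -
      have "norm (f (x - \<sigma> * t) * g (x - t\<^sup>2) * osc_kernel \<beta> t) = norm (f (x - \<sigma> * t)) * (norm (g (x - t\<^sup>2)) / t)"
        using that r by (simp add: norm_mult osc_kernel_def norm_divide)
      also have "\<dots> \<le> 1 * (norm (g (x - t\<^sup>2)) / t)" using f1 that r by (intro mult_right_mono) auto
      finally show ?thesis by simp
    qed
    then show "ennreal (norm (if r1 \<le> t \<and> t \<le> r2 then f (x - \<sigma> * t) * g (x - t\<^sup>2) * osc_kernel \<beta> t else 0)) \<le> (if r1 \<le> t \<and> t \<le> r2 then ennreal (norm (g (x - t\<^sup>2)) / t) else 0)"
      by (auto intro: ennreal_leI)
  qed
  finally show ?thesis .
next
  case False
  \<comment> \<open>A non-integrable integrand has Bochner integral 0, and the inequality holds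
    trivially.\<close>
  then show ?thesis unfolding piece_op_def by (simp add: not_integrable_integral_eq)
qed

text \<open>The oscillatory estimate covers \<open>r2 \<le> \<epsilon>0\<close>. For larger
  \<open>r2\<close> the trivial bound 1 suffices, since \<open>r2 powr c'\<close> is then at least
  \<open>\<epsilon>0 powr c'\<close>, and the constant absorbs the quotient.\<close>

lemma piece_op_bound:
  assumes b: "\<beta> > 1"
  obtains K where "K > 0" "\<And>f g r1 r2 \<sigma>. f \<in> borel_measurable borel \<Longrightarrow> (\<And>x. norm (f x) \<le> 1) \<Longrightarrow> g \<in> borel_measurable borel \<Longrightarrow>
    0 < r1 \<Longrightarrow> r1 \<le> r2 \<Longrightarrow> r2 \<le> 2 * r1 \<Longrightarrow> r2 \<le> 1 \<Longrightarrow> \<sigma> = 1 \<or> \<sigma> = -1 \<Longrightarrow>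
    (\<integral>\<^sup>+x. ennreal ((norm (piece_op \<beta> f g r1 r2 \<sigma> x))\<^sup>2) \<partial>lborel) \<le> ennreal (K * r2 powr ((\<beta>-1)/8)) * (\<integral>\<^sup>+z. ennreal ((norm (g z))\<^sup>2) \<partial>lborel)"
proof -
  obtain \<epsilon>0 K where e0: "\<epsilon>0 > 0" "\<epsilon>0 \<le> 1" and K: "K > 0" and
    loc: "\<And>\<epsilon> a. \<epsilon> \<noteq> 0 \<Longrightarrow> \<bar>\<epsilon>\<bar> \<le> \<epsilon>0 \<Longrightarrow> 1/2 \<le> a \<Longrightarrow> a \<le> 1 \<Longrightarrow> local_operator \<epsilon> (K * \<bar>\<epsilon>\<bar> powr ((\<beta>-1)/4)) (qpow \<beta> \<epsilon> a)"
    using local_operator_powr[OF b] by metis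
  define c' where "c' = (\<beta>-1)/8"
  define K' where "K' = 20 * sqrt K + 1 / \<epsilon>0 powr c'"
  have "1 / \<epsilon>0 powr c' > 0" using e0 by simp
  then have K': "K' > 0" "20 * sqrt K \<le> K'" "1 / \<epsilon>0 powr c' \<le> K'" using K by (auto simp: K'_def add_nonneg_pos)
  show thesis
  proof
    show "K' > 0" by fact
    fix f g :: "real \<Rightarrow> complex" and r1 r2 \<sigma> :: real
    assume f[measurable]: "f \<in> borel_measurable borel" and f1: "\<And>x. norm (f x) \<le> 1" and g[measurable]: "g \<in> borel_measurable borel"
      and r: "0 < r1" "r1 \<le> r2" "r2 \<le> 2 * r1" "r2 \<le> 1" and \<sigma>: "\<sigma> = 1 \<or> \<sigma> = -1"
    define E where "E = (\<integral>\<^sup>+z. ennreal ((norm (g z))\<^sup>2) \<partial>lborel)"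
    show "(\<integral>\<^sup>+x. ennreal ((norm (piece_op \<beta> f g r1 r2 \<sigma> x))\<^sup>2) \<partial>lborel) \<le> ennreal (K' * r2 powr ((\<beta>-1)/8)) * (\<integral>\<^sup>+z. ennreal ((norm (g z))\<^sup>2) \<partial>lborel)"
      unfolding E_def[symmetric] c'_def[symmetric]
    proof (cases "r2 \<le> \<epsilon>0")
      case True
      have "(\<integral>\<^sup>+x. ennreal ((norm (piece_op \<beta> f g r1 r2 \<sigma> x))\<^sup>2) \<partial>lborel) \<le> ennreal (20 * sqrt K * r2 powr c') * E"
        unfolding E_def c'_def by (rule piece_op_scaled[OF loc f f1 g r(1-3) True \<sigma> K])
      also have "\<dots> \<le> ennreal (K' * r2 powr c') * E"
        using K' by (intro mult_right_mono ennreal_leI) auto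
      finally show "(\<integral>\<^sup>+x. ennreal ((norm (piece_op \<beta> f g r1 r2 \<sigma> x))\<^sup>2) \<partial>lborel) \<le> ennreal (K' * r2 powr c') * E" .
    next
      case False
      have "(\<integral>\<^sup>+x. ennreal ((norm (piece_op \<beta> f g r1 r2 \<sigma> x))\<^sup>2) \<partial>lborel) \<le> (\<integral>\<^sup>+x. (abs_piece g r1 r2 x)\<^sup>2 \<partial>lborel)"
      proof (rule nn_integral_mono)
        fix x
        show "ennreal ((norm (piece_op \<beta> f g r1 r2 \<sigma> x))\<^sup>2) \<le> (abs_piece g r1 r2 x)\<^sup>2"
          using power_mono[OF piece_op_le_abs_piece[of f r1 \<beta> g r2 \<sigma> x, OF f1 r(1)], of 2] by (simp add: ennreal_power)
      qed
      also have "\<dots> \<le> ennreal (((r2 - r1) / r1)\<^sup>2) * E" unfolding E_def by (rule abs_piece_bound[OF g r(1,2)])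
      also have "\<dots> \<le> ennreal (K' * r2 powr c') * E"
      proof (intro mult_right_mono ennreal_leI)
        have "(r2 - r1) / r1 \<le> 1" "0 \<le> (r2 - r1) / r1" using r by (auto simp: divide_simps)
        then have "((r2 - r1) / r1)\<^sup>2 \<le> 1" by (simp add: power_le_one)
        also have "1 = 1 / \<epsilon>0 powr c' * \<epsilon>0 powr c'" using e0 by simp
        also have "\<dots> \<le> K' * r2 powr c'" using False e0 K' b by (intro mult_mono powr_mono2) (auto simp: c'_def)
        finally show "((r2 - r1) / r1)\<^sup>2 \<le> K' * r2 powr c'" .
      qed auto
      finally show "(\<integral>\<^sup>+x. ennreal ((norm (piece_op \<beta> f g r1 r2 \<sigma> x))\<^sup>2) \<partial>lborel) \<le> ennreal (K' * r2 powr c') * E" .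
    qed
  qed
qed

section \<open>Summation over scales\<close>

locale truncations =
  fixes \<beta> K :: real and f g :: "real \<Rightarrow> complex"
  assumes b: "\<beta> > 1" and K: "K > 0"
    and f[measurable]: "f \<in> borel_measurable borel" and f1: "\<And>x. norm (f x) \<le> 1"
    and g[measurable]: "g \<in> borel_measurable borel" and E: "(\<integral>\<^sup>+z. ennreal ((norm (g z))\<^sup>2) \<partial>lborel) < \<infinity>"
    and piece: "\<And>r1 r2 \<sigma>. 0 < r1 \<Longrightarrow> r1 \<le> r2 \<Longrightarrow> r2 \<le> 2 * r1 \<Longrightarrow> r2 \<le> 1 \<Longrightarrow> \<sigma> = 1 \<or> \<sigma> = -1 \<Longrightarrow>
      (\<integral>\<^sup>+x. ennreal ((norm (piece_op \<beta> f g r1 r2 \<sigma> x))\<^sup>2) \<partial>lborel) \<le> ennreal (K * r2 powr ((\<beta>-1)/8)) * (\<integral>\<^sup>+z. ennreal ((norm (g z))\<^sup>2) \<partial>lborel)"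
begin

section \<open>Truncated integrals as sums of pieces\<close>

definition "EE = (\<integral>\<^sup>+z. ennreal ((norm (g z))\<^sup>2) \<partial>lborel)"

definition "T e x = (LINT t|lborel. (if e \<le> \<bar>t\<bar> \<and> \<bar>t\<bar> \<le> 1 then f (x - t) * g (x - t\<^sup>2) * osc_kernel \<beta> t else 0))"

text \<open>At such points all truncated integrals converge absolutely. Countably many cut-offs are
  enough because \<open>abs_piece\<close> grows with the interval.\<close>

definition "good x \<longleftrightarrow> (\<forall>n::nat. abs_piece g (1 / (real n + 1)) 1 x < \<infinity>)"

lemma AE_good: "AE x in lborel. good x"
  unfolding good_def AE_all_countable
proof
  fix n :: nat
  have "(\<integral>\<^sup>+x. (abs_piece g (1 / (real n + 1)) 1 x)\<^sup>2 \<partial>lborel) \<le> ennreal (((1 - 1 / (real n + 1)) / (1 / (real n + 1)))\<^sup>2) * EE"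
    unfolding EE_def by (rule abs_piece_bound) auto
  also have "\<dots> < \<infinity>" using E by (simp add: EE_def ennreal_mult_less_top)
  finally have "AE x in lborel. (abs_piece g (1 / (real n + 1)) 1 x)\<^sup>2 \<noteq> \<infinity>"
    by (intro nn_integral_PInf_AE) auto
  then show "AE x in lborel. abs_piece g (1 / (real n + 1)) 1 x < \<infinity>"
    by eventually_elim (auto simp: less_top power2_eq_square ennreal_mult_eq_top_iff)
qed

lemma abs_piece_mono: "r1' \<le> r1 \<Longrightarrow> r2 \<le> r2' \<Longrightarrow> abs_piece g r1 r2 x \<le> abs_piece g r1' r2' x"
  unfolding abs_piece_def by (intro nn_integral_mono) auto

lemma good_fin: assumes x: "good x" and r: "0 < r1" "r2 \<le> 1" shows "abs_piece g r1 r2 x < \<infinity>"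
proof -
  obtain n where "inverse (real (Suc n)) < r1" using reals_Archimedean[OF r(1)] by blast
  then have "1 / (real n + 1) \<le> r1" by (simp add: inverse_eq_divide add.commute)
  then have "abs_piece g r1 r2 x \<le> abs_piece g (1 / (real n + 1)) 1 x" using r by (intro abs_piece_mono) auto
  also have "\<dots> < \<infinity>" using x by (simp add: good_def)
  finally show ?thesis .
qed

lemma integrand_bound:
  assumes "0 < r1" "\<sigma> = 1 \<or> \<sigma> = -1"
  shows "ennreal (norm (if r1 \<le> t \<and> t \<le> r2 then f (x - \<sigma> * t) * g (x - t\<^sup>2) * osc_kernel \<beta> t else 0)) \<le> (if r1 \<le> t \<and> t \<le> r2 then ennreal (norm (g (x - t\<^sup>2)) / t) else 0)"
proof (cases "r1 \<le> t \<and> t \<le> r2")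
  case True
  have "norm (f (x - \<sigma> * t) * g (x - t\<^sup>2) * osc_kernel \<beta> t) = norm (f (x - \<sigma> * t)) * (norm (g (x - t\<^sup>2)) / t)"
    using True assms by (simp add: norm_mult osc_kernel_def norm_divide)
  also have "\<dots> \<le> 1 * (norm (g (x - t\<^sup>2)) / t)" using f1 True assms by (intro mult_right_mono) auto
  finally show ?thesis using True by (simp add: ennreal_leI)
qed auto

lemma good_int: assumes x: "good x" and r: "0 < r1" "r2 \<le> 1" and \<sigma>: "\<sigma> = 1 \<or> \<sigma> = -1"
  shows "integrable lborel (\<lambda>t. (if r1 \<le> t \<and> t \<le> r2 then f (x - \<sigma> * t) * g (x - t\<^sup>2) * osc_kernel \<beta> t else 0))"
proof (rule integrableI_bounded)
  have "(\<integral>\<^sup>+t. ennreal (norm (if r1 \<le> t \<and> t \<le> r2 then f (x - \<sigma> * t) * g (x - t\<^sup>2) * osc_kernel \<beta> t else 0)) \<partial>lborel) \<le> abs_piece g r1 r2 x"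
    unfolding abs_piece_def by (intro nn_integral_mono integrand_bound r \<sigma>)
  then show "(\<integral>\<^sup>+t. ennreal (norm (if r1 \<le> t \<and> t \<le> r2 then f (x - \<sigma> * t) * g (x - t\<^sup>2) * osc_kernel \<beta> t else 0)) \<partial>lborel) < \<infinity>"
    using good_fin[OF x r] by (rule le_less_trans)
qed measurable

lemma piece_op_add:
  assumes x: "good x" and r: "0 < r1" "r1 \<le> r2" "r2 \<le> r3" "r3 \<le> 1" and \<sigma>: "\<sigma> = 1 \<or> \<sigma> = -1"
  shows "piece_op \<beta> f g r1 r3 \<sigma> x = piece_op \<beta> f g r1 r2 \<sigma> x + piece_op \<beta> f g r2 r3 \<sigma> x"
proof -
  define F where "F t = f (x - \<sigma> * t) * g (x - t\<^sup>2) * osc_kernel \<beta> t" for t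
  have [measurable]: "F \<in> borel_measurable borel" unfolding F_def by measurable
  have "piece_op \<beta> f g r1 r3 \<sigma> x = (LINT t|lborel. (if r1 \<le> t \<and> t \<le> r2 then F t else 0) + (if r2 \<le> t \<and> t \<le> r3 then F t else 0))"
    unfolding piece_op_def F_def[symmetric]
  proof (rule integral_cong_AE)
    \<comment> \<open>Both closed intervals contain \<open>r2\<close>, where the integrand would be
      counted twice; a single point is negligible.\<close>
    have "AE t in lborel. t \<noteq> r2" by (rule AE_lborel_singleton)
    then show "AE t in lborel. (if r1 \<le> t \<and> t \<le> r3 then F t else 0) = (if r1 \<le> t \<and> t \<le> r2 then F t else 0) + (if r2 \<le> t \<and> t \<le> r3 then F t else 0)"
      by eventually_elim (use r in auto)
  qed measurable
  also have "\<dots> = piece_op \<beta> f g r1 r2 \<sigma> x + piece_op \<beta> f g r2 r3 \<sigma> x"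
    unfolding piece_op_def F_def using r by (intro Bochner_Integration.integral_add good_int x \<sigma>) auto
  finally show ?thesis .
qed

lemma T_eq_pieces:
  assumes x: "good x" and e: "0 < e" "e \<le> 1"
  shows "T e x = piece_op \<beta> f g e 1 1 x + piece_op \<beta> f g e 1 (-1) x"
proof -
  have osc_kernel: "osc_kernel \<beta> (- t) = osc_kernel \<beta> t" for t by (simp add: osc_kernel_def)
  have m: "piece_op \<beta> f g e 1 (-1) x = (LINT t|lborel. (if e \<le> - t \<and> - t \<le> 1 then f (x - t) * g (x - t\<^sup>2) * osc_kernel \<beta> t else 0))"
    unfolding piece_op_def by (subst integral_reflect[where c=0], rule Bochner_Integration.integral_cong[OF refl]) (simp add: osc_kernel)
  have i2: "integrable lborel (\<lambda>t. (if e \<le> - t \<and> - t \<le> 1 then f (x - t) * g (x - t\<^sup>2) * osc_kernel \<beta> t else 0))"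
  proof -
    have "integrable lborel (\<lambda>t. (if e \<le> 0 + (-1) * t \<and> 0 + (-1) * t \<le> 1 then f (x - (-1) * (0 + (-1) * t)) * g (x - (0 + (-1) * t)\<^sup>2) * osc_kernel \<beta> (0 + (-1) * t) else 0))"
      by (rule lborel_integrable_real_affine[where f="\<lambda>t. (if e \<le> t \<and> t \<le> 1 then f (x - (-1) * t) * g (x - t\<^sup>2) * osc_kernel \<beta> t else 0)"])
         (use good_int[OF x e(1) order_refl, of "-1"] in auto)
    moreover have "(\<lambda>t. (if e \<le> 0 + (-1) * t \<and> 0 + (-1) * t \<le> 1 then f (x - (-1) * (0 + (-1) * t)) * g (x - (0 + (-1) * t)\<^sup>2) * osc_kernel \<beta> (0 + (-1) * t) else 0)) =
        (\<lambda>t. (if e \<le> - t \<and> - t \<le> 1 then f (x - t) * g (x - t\<^sup>2) * osc_kernel \<beta> t else 0))" by (rule ext) (simp add: osc_kernel)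
    ultimately show ?thesis by (simp only:)
  qed
  have "T e x = (LINT t|lborel. (if e \<le> t \<and> t \<le> 1 then f (x - 1 * t) * g (x - t\<^sup>2) * osc_kernel \<beta> t else 0) + (if e \<le> - t \<and> - t \<le> 1 then f (x - t) * g (x - t\<^sup>2) * osc_kernel \<beta> t else 0))"
    unfolding T_def by (rule Bochner_Integration.integral_cong[OF refl]) (use e in auto)
  also have "\<dots> = piece_op \<beta> f g e 1 1 x + piece_op \<beta> f g e 1 (-1) x"
    unfolding m piece_op_def[of _ _ _ _ _ 1] by (rule Bochner_Integration.integral_add[OF good_int[OF x e(1) order_refl] i2]) simp
  finally show ?thesis .
qed

text \<open>The cut points decay only polynomially, so that consecutive ones are close and the integrals of absolute values over the
  cells are square summable; this passes from the sequence \<open>e n\<close> to all truncations. The power \<open>k\<close> makes the piece bounds \<open>O(n\<^sup>-\<^sup>4)\<close>.\<close>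

definition "k = nat \<lceil>32 / (\<beta> - 1)\<rceil>"
text \<open>The offset gives \<open>e 0 = 1\<close> and keeps \<open>k / w n\<close> at most 1/2, so
  that consecutive cut points differ by a factor of at most 2, as the piece estimate
  requires.\<close>

definition "w n = real (2 * k) + real n"
definition "e n = (real (2 * k) / w n) ^ k"

lemma k: "k \<ge> 1" "real k * ((\<beta> - 1) / 8) \<ge> 4"
proof -
  have "32 / (\<beta> - 1) > 0" using b by simp
  then have k': "real k \<ge> 32 / (\<beta> - 1)" unfolding k_def by linarith
  then show "real k * ((\<beta> - 1) / 8) \<ge> 4" using b by (simp add: divide_simps mult.commute)
  have "real k > 0" using k' \<open>32 / (\<beta> - 1) > 0\<close> by linarith
  then show "k \<ge> 1" by simp
qed

lemma w: "w n \<ge> 2 * real k" "w n \<ge> real n + 1" "w n > 0" "w (Suc n) = w n + 1"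
  using k unfolding w_def by auto

lemma base: "0 < real (2 * k) / w n" "real (2 * k) / w n \<le> 1"
  using k w[of n] by auto

lemma e_props: "e 0 = 1" "0 < e n" "e (Suc n) \<le> e n" "e n \<le> 1" "e n \<le> real (2 * k) / w n"
proof -
  show "e 0 = 1" using k by (simp add: e_def w_def)
  show "0 < e n" "e n \<le> 1" unfolding e_def using base[of n] by (auto intro!: power_le_one)
  show "e (Suc n) \<le> e n" unfolding e_def w(4) using w(3)[of n] by (intro power_mono frac_le) auto
  show "e n \<le> real (2 * k) / w n" unfolding e_def using base[of n] k power_decreasing[of 1 k "real (2 * k) / w n"] by simp
qed

text \<open>The ratio is \<open>(1 + 1 / w n) ^ k\<close>, at most \<open>exp z\<close> with
  \<open>z = k / w n\<close>, and \<open>exp z \<le> 1 + z + z\<^sup>2 \<le> 1 + 2 * z\<close> for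
  \<open>z\<close> in [0,1].\<close>

lemma e_ratio: "e n \<le> (1 + 2 * (real k / w n)) * e (Suc n)" "real k / w n \<le> 1/2"
proof -
  have z: "0 \<le> real k / w n" "real k / w n \<le> 1/2" using w(1,3)[of n] by (auto simp: divide_simps)
  have "e n = (1 + 1 / w n) ^ k * e (Suc n)"
  proof -
    have "1 + 1 / w n = (w n + 1) / w n" "w n + 1 \<noteq> 0" using w(3)[of n] by (simp_all add: add_divide_distrib)
    then have "real (2 * k) / w n = (1 + 1 / w n) * (real (2 * k) / (w n + 1))" by simp
    then show ?thesis unfolding e_def w(4) power_mult_distrib[symmetric] by (rule arg_cong[where f="\<lambda>z. z ^ k"])
  qed
  moreover have "(1 + 1 / w n) ^ k \<le> 1 + 2 * (real k / w n)"
  proof -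
    have "(1 + 1 / w n) ^ k \<le> exp (1 / w n) ^ k" using w(3)[of n] by (intro power_mono exp_ge_add_one_self) auto
    also have "\<dots> = exp (real k / w n)" by (simp add: exp_of_nat_mult[symmetric])
    also have "\<dots> \<le> 1 + real k / w n + (real k / w n)\<^sup>2" using z by (intro exp_bound) linarith+
    also have "(real k / w n)\<^sup>2 \<le> real k / w n" using mult_left_le[OF _ z(1), of "real k / w n"] z(2) unfolding power2_eq_square by linarith
    finally show ?thesis by simp
  qed
  ultimately show "e n \<le> (1 + 2 * (real k / w n)) * e (Suc n)" using e_props(2)[of "Suc n"] by (simp add: mult_right_mono)
  show "real k / w n \<le> 1/2" by (rule z(2))
qed

lemma e_dbl: "e n \<le> 2 * e (Suc n)"
proof -
  have "(1 + 2 * (real k / w n)) * e (Suc n) \<le> 2 * e (Suc n)"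
  proof (rule mult_right_mono)
    show "1 + 2 * (real k / w n) \<le> 2" using e_ratio(2)[of n] by linarith
    show "0 \<le> e (Suc n)" using e_props(2)[of "Suc n"] by simp
  qed
  then show ?thesis using e_ratio(1)[of n] by simp
qed

lemma e_gap: "(e n - e (Suc n)) / e (Suc n) \<le> 2 * real k / w n"
  using e_ratio(1)[of n] e_props(2)[of "Suc n"] by (simp add: divide_le_eq algebra_simps)

lemma e_powr: "e n powr ((\<beta> - 1) / 8) \<le> (real (2 * k))^4 / (w n)^4"
proof -
  have "e n powr ((\<beta> - 1) / 8) = (real (2 * k) / w n) powr (real k * ((\<beta> - 1) / 8))"
    unfolding e_def using base[of n] by (simp add: powr_powr powr_realpow[symmetric])
  also have "\<dots> \<le> (real (2 * k) / w n) powr 4" using base[of n] k by (intro powr_mono') auto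
  also have "\<dots> = (real (2 * k) / w n) ^ 4" using base[of n] powr_realpow[of "real (2 * k) / w n" 4] by simp
  finally show ?thesis by (simp add: power_divide)
qed

lemma e_small: assumes "0 < \<delta>" obtains n where "e n < \<delta>"
proof -
  obtain n :: nat where n: "real (2 * k) / \<delta> < real n" using reals_Archimedean2 by blast
  have "real (2 * k) / \<delta> < w n" using n by (simp add: w_def)
  then have "real (2 * k) / w n < \<delta>" using assms w(3)[of n] by (simp add: divide_simps mult.commute)
  then show thesis using that e_props(5)[of n] by (meson le_less_trans)
qed

lemma e_antimono: "m \<le> n \<Longrightarrow> e n \<le> e m"
  by (rule lift_Suc_antimono_le[of e]) (auto intro: e_props)

section \<open>Weighted sums over the scales\<close>

definition "S = (\<Sum>n. 1 / (w n)\<^sup>2)"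

lemma S_summable: "summable (\<lambda>n. 1 / (w n)\<^sup>2)"
proof (rule summable_comparison_test'[where N=0])
  show "summable (\<lambda>n. 1 / (real n + 1)\<^sup>2)" using sums_summable[OF inverse_squares_sums] by (simp add: add.commute)
  show "norm (1 / (w n)\<^sup>2) \<le> 1 / (real n + 1)\<^sup>2" for n
    using w(2)[of n] by (simp, intro frac_le power_mono) auto
qed

lemma S_nonneg: "0 \<le> S" unfolding S_def by (rule suminf_nonneg[OF S_summable]) auto

definition "Q n x = piece_op \<beta> f g (e (Suc n)) (e n) 1 x + piece_op \<beta> f g (e (Suc n)) (e n) (-1) x"

lemma Q_meas[measurable]: "Q n \<in> borel_measurable borel" unfolding Q_def by measurable

definition "C1 = 4 * K * (real (2 * k))^4"
lemma C1: "0 \<le> C1" using K by (simp add: C1_def)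

lemma Q_bound: "(\<integral>\<^sup>+x. ennreal ((norm (Q n x))\<^sup>2) \<partial>lborel) \<le> ennreal (C1 / (w n)^4) * EE"
proof -
  define P1 P2 where "P1 = piece_op \<beta> f g (e (Suc n)) (e n) 1" and "P2 = piece_op \<beta> f g (e (Suc n)) (e n) (-1)"
  have [measurable]: "P1 \<in> borel_measurable borel" "P2 \<in> borel_measurable borel" unfolding P1_def P2_def by measurable
  have P: "(\<integral>\<^sup>+x. ennreal ((norm (P1 x))\<^sup>2) \<partial>lborel) \<le> ennreal (K * e n powr ((\<beta>-1)/8)) * EE"
    "(\<integral>\<^sup>+x. ennreal ((norm (P2 x))\<^sup>2) \<partial>lborel) \<le> ennreal (K * e n powr ((\<beta>-1)/8)) * EE"
    unfolding P1_def P2_def EE_def by (intro piece e_props e_dbl; simp)+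
  have "(\<integral>\<^sup>+x. ennreal ((norm (Q n x))\<^sup>2) \<partial>lborel) \<le> (\<integral>\<^sup>+x. 2 * ennreal ((norm (P1 x))\<^sup>2) + 2 * ennreal ((norm (P2 x))\<^sup>2) \<partial>lborel)"
  proof (rule nn_integral_mono)
    fix x
    define u v where "u = norm (P1 x)" and "v = norm (P2 x)"
    have "(norm (Q n x))\<^sup>2 \<le> (u + v)\<^sup>2" unfolding Q_def P1_def[symmetric] P2_def[symmetric] u_def v_def by (intro power_mono norm_triangle_ineq) auto
    also have "\<dots> \<le> 2 * u\<^sup>2 + 2 * v\<^sup>2" using sum_squares_bound[of u v] by (simp add: power2_eq_square algebra_simps)
    finally have "ennreal ((norm (Q n x))\<^sup>2) \<le> ennreal (2 * u\<^sup>2 + 2 * v\<^sup>2)" by (rule ennreal_leI)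
    also have "\<dots> = 2 * ennreal (u\<^sup>2) + 2 * ennreal (v\<^sup>2)" by (subst ennreal_plus) (auto simp: ennreal_mult)
    finally show "ennreal ((norm (Q n x))\<^sup>2) \<le> 2 * ennreal ((norm (P1 x))\<^sup>2) + 2 * ennreal ((norm (P2 x))\<^sup>2)" by (simp add: u_def v_def)
  qed
  also have "\<dots> = 2 * (\<integral>\<^sup>+x. ennreal ((norm (P1 x))\<^sup>2) \<partial>lborel) + 2 * (\<integral>\<^sup>+x. ennreal ((norm (P2 x))\<^sup>2) \<partial>lborel)"
    by (subst nn_integral_add) (auto simp: nn_integral_cmult)
  also have "\<dots> \<le> 2 * (ennreal (K * e n powr ((\<beta>-1)/8)) * EE) + 2 * (ennreal (K * e n powr ((\<beta>-1)/8)) * EE)"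
    by (intro add_mono mult_left_mono P) auto
  also have "\<dots> = ennreal (4 * (K * e n powr ((\<beta>-1)/8))) * EE"
  proof -
    have "ennreal (4 * (K * e n powr ((\<beta>-1)/8))) = 4 * ennreal (K * e n powr ((\<beta>-1)/8))" using K by (subst ennreal_mult) auto
    moreover have "2 * y + 2 * y = 4 * y" for y :: ennreal by (simp add: distrib_right[symmetric])
    ultimately show ?thesis by (simp add: mult.assoc)
  qed
  also have "\<dots> \<le> ennreal (C1 / (w n)^4) * EE"
  proof (intro mult_right_mono ennreal_leI)
    have "K * e n powr ((\<beta>-1)/8) \<le> K * ((real (2 * k))^4 / (w n)^4)" using K by (intro mult_left_mono e_powr) auto
    then show "4 * (K * e n powr ((\<beta>-1)/8)) \<le> C1 / (w n)^4" by (simp add: C1_def)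
  qed auto
  finally show ?thesis .
qed

text \<open>The weight \<open>(w n)\<^sup>2\<close> is placed between two decays: the squared norms
  of \<open>Q n\<close> are of order \<open>(w n) powr (-4)\<close>, so the integral of
  \<open>V\<close> is finite, while the reciprocal weights are summable, so a finite
  \<open>V x\<close> controls the sum of the \<open>Q n x\<close>.\<close>

definition "V x = (\<Sum>n. ennreal ((w n)\<^sup>2 * (norm (Q n x))\<^sup>2))"
definition "U x = (\<Sum>n. (abs_piece g (e (Suc n)) (e n) x)\<^sup>2)"

lemma V_meas[measurable]: "V \<in> borel_measurable borel" unfolding V_def by measurable

lemma sum_bound: "(\<Sum>n. ennreal (c / (w n)\<^sup>2) * EE) = ennreal (c * S) * EE" if "0 \<le> c"
proof -
  have "(\<Sum>n. ennreal (c / (w n)\<^sup>2) * EE) = (\<Sum>n. ennreal (c / (w n)\<^sup>2)) * EE" by simp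
  also have "(\<Sum>n. ennreal (c / (w n)\<^sup>2)) = ennreal (\<Sum>n. c * (1 / (w n)\<^sup>2))"
    using that summable_mult[OF S_summable, of c] by (subst suminf_ennreal2) auto
  also have "(\<Sum>n. c * (1 / (w n)\<^sup>2)) = c * S" unfolding S_def by (rule suminf_mult[OF S_summable])
  finally show ?thesis .
qed

lemma V_bound: "(\<integral>\<^sup>+x. V x \<partial>lborel) \<le> ennreal (C1 * S) * EE"
proof -
  have "(\<integral>\<^sup>+x. V x \<partial>lborel) = (\<Sum>n. (\<integral>\<^sup>+x. ennreal ((w n)\<^sup>2 * (norm (Q n x))\<^sup>2) \<partial>lborel))"
    unfolding V_def by (rule nn_integral_suminf) measurable
  also have "\<dots> \<le> (\<Sum>n. ennreal (C1 / (w n)\<^sup>2) * EE)"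
  proof (rule suminf_le)
    fix n
    have "(\<integral>\<^sup>+x. ennreal ((w n)\<^sup>2 * (norm (Q n x))\<^sup>2) \<partial>lborel) = ennreal ((w n)\<^sup>2) * (\<integral>\<^sup>+x. ennreal ((norm (Q n x))\<^sup>2) \<partial>lborel)"
      by (subst nn_integral_cmult[symmetric]) (auto simp: ennreal_mult)
    also have "\<dots> \<le> ennreal ((w n)\<^sup>2) * (ennreal (C1 / (w n)^4) * EE)" by (intro mult_left_mono Q_bound) auto
    also have "\<dots> = ennreal ((w n)\<^sup>2 * (C1 / (w n)^4)) * EE"
    proof -
      have "ennreal ((w n)\<^sup>2 * (C1 / (w n)^4)) = ennreal ((w n)\<^sup>2) * ennreal (C1 / (w n)^4)" using C1 by (intro ennreal_mult) auto
      then show ?thesis by (simp only: mult.assoc)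
    qed
    also have "(w n)\<^sup>2 * (C1 / (w n)^4) = C1 / (w n)\<^sup>2" using w(3)[of n] by (simp add: divide_simps power2_eq_square power4_eq_xxxx)
    finally show "(\<integral>\<^sup>+x. ennreal ((w n)\<^sup>2 * (norm (Q n x))\<^sup>2) \<partial>lborel) \<le> ennreal (C1 / (w n)\<^sup>2) * EE" .
  qed auto
  also have "\<dots> = ennreal (C1 * S) * EE" by (rule sum_bound[OF C1])
  finally show ?thesis .
qed

lemma U_bound: "(\<integral>\<^sup>+x. U x \<partial>lborel) < \<infinity>"
proof -
  have "(\<integral>\<^sup>+x. U x \<partial>lborel) = (\<Sum>n. (\<integral>\<^sup>+x. (abs_piece g (e (Suc n)) (e n) x)\<^sup>2 \<partial>lborel))"
    unfolding U_def by (rule nn_integral_suminf) measurable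
  also have "\<dots> \<le> (\<Sum>n. ennreal ((2 * real k)\<^sup>2 / (w n)\<^sup>2) * EE)"
  proof (rule suminf_le)
    fix n
    have "(\<integral>\<^sup>+x. (abs_piece g (e (Suc n)) (e n) x)\<^sup>2 \<partial>lborel) \<le> ennreal (((e n - e (Suc n)) / e (Suc n))\<^sup>2) * EE"
      unfolding EE_def by (rule abs_piece_bound) (use e_props in auto)
    also have "\<dots> \<le> ennreal ((2 * real k)\<^sup>2 / (w n)\<^sup>2) * EE"
    proof (intro mult_right_mono ennreal_leI)
      have "((e n - e (Suc n)) / e (Suc n))\<^sup>2 \<le> (2 * real k / w n)\<^sup>2"
        using e_props(3)[of n] e_props(2)[of "Suc n"] by (intro power_mono e_gap) auto
      then show "((e n - e (Suc n)) / e (Suc n))\<^sup>2 \<le> (2 * real k)\<^sup>2 / (w n)\<^sup>2" by (simp add: power_divide)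
    qed auto
    finally show "(\<integral>\<^sup>+x. (abs_piece g (e (Suc n)) (e n) x)\<^sup>2 \<partial>lborel) \<le> ennreal ((2 * real k)\<^sup>2 / (w n)\<^sup>2) * EE" .
  qed auto
  also have "\<dots> = ennreal ((2 * real k)\<^sup>2 * S) * EE" by (rule sum_bound) auto
  also have "\<dots> < \<infinity>" using E by (simp add: EE_def ennreal_mult_less_top)
  finally show ?thesis .
qed

definition "ok x \<longleftrightarrow> good x \<and> V x \<noteq> \<infinity> \<and> U x \<noteq> \<infinity>"

lemma AE_ok: "AE x in lborel. ok x"
proof -
  have [measurable]: "U \<in> borel_measurable borel" unfolding U_def by measurable
  have "AE x in lborel. V x \<noteq> \<infinity>"
  proof (rule nn_integral_PInf_AE)
    have "ennreal (C1 * S) * EE < \<infinity>" using E by (simp add: EE_def ennreal_mult_less_top)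
    with V_bound have "(\<integral>\<^sup>+x. V x \<partial>lborel) < \<infinity>" by (rule le_less_trans)
    then show "(\<integral>\<^sup>+x. V x \<partial>lborel) \<noteq> \<infinity>" by simp
  qed auto
  moreover have "AE x in lborel. U x \<noteq> \<infinity>" by (rule nn_integral_PInf_AE) (use U_bound in auto)
  ultimately show ?thesis using AE_good unfolding ok_def by eventually_elim auto
qed

definition "Lx x = (\<Sum>n. Q n x)"

text \<open>Write \<open>Q n x\<close> as \<open>1 / w n\<close> times \<open>w n * Q n x\<close>.
  The inequality between the means gives absolute summability, and Cauchy--Schwarz for the partial
  sums gives the bound by \<open>S\<close> times \<open>V x\<close>.\<close>

lemma ok_sum:
  assumes x: "ok x"
  shows "summable (\<lambda>n. Q n x)" "ennreal ((norm (Lx x))\<^sup>2) \<le> ennreal S * V x"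
proof -
  have s2: "summable (\<lambda>n. (w n)\<^sup>2 * (norm (Q n x))\<^sup>2)"
    by (rule summable_suminf_not_top) (use x in \<open>auto simp: ok_def V_def\<close>)
  have Vr: "V x = ennreal (\<Sum>n. (w n)\<^sup>2 * (norm (Q n x))\<^sup>2)"
    unfolding V_def by (rule suminf_ennreal2[OF _ s2]) auto
  have sn: "summable (\<lambda>n. norm (Q n x))"
  proof (rule summable_comparison_test'[where N=0])
    show "summable (\<lambda>n. 1 / (w n)\<^sup>2 + (w n)\<^sup>2 * (norm (Q n x))\<^sup>2)" by (intro summable_add S_summable s2)
    fix n
    define y where "y = norm (Q n x)"
    have "2 * (1 / w n) * (w n * y) \<le> (1 / w n)\<^sup>2 + (w n * y)\<^sup>2" by (rule sum_squares_bound)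
    then have "2 * y \<le> 1 / (w n)\<^sup>2 + (w n)\<^sup>2 * y\<^sup>2" using w(3)[of n] by (simp add: power_divide power_mult_distrib)
    moreover have "0 \<le> y" by (simp add: y_def)
    ultimately have "y \<le> 1 / (w n)\<^sup>2 + (w n)\<^sup>2 * y\<^sup>2" by linarith
    then show "norm (norm (Q n x)) \<le> 1 / (w n)\<^sup>2 + (w n)\<^sup>2 * (norm (Q n x))\<^sup>2" by (simp add: y_def)
  qed
  show s: "summable (\<lambda>n. Q n x)" by (rule summable_norm_cancel[OF sn])
  have part: "(norm (\<Sum>n<m. Q n x))\<^sup>2 \<le> S * (\<Sum>n. (w n)\<^sup>2 * (norm (Q n x))\<^sup>2)" for m
  proof -
    have "(norm (\<Sum>n<m. Q n x))\<^sup>2 \<le> (\<Sum>n<m. (1 / w n) * (w n * norm (Q n x)))\<^sup>2"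
    proof (intro power_mono)
      have "norm (\<Sum>n<m. Q n x) \<le> (\<Sum>n<m. norm (Q n x))" by (rule norm_sum)
      also have "\<dots> = (\<Sum>n<m. (1 / w n) * (w n * norm (Q n x)))" using w(3) by (intro sum.cong) (auto simp: less_imp_neq[symmetric])
      finally show "norm (\<Sum>n<m. Q n x) \<le> (\<Sum>n<m. (1 / w n) * (w n * norm (Q n x)))" .
    qed auto
    also have "\<dots> \<le> (\<Sum>n<m. (1 / w n)\<^sup>2) * (\<Sum>n<m. (w n * norm (Q n x))\<^sup>2)" by (rule Cauchy_Schwarz_ineq_sum)
    also have "\<dots> \<le> S * (\<Sum>n. (w n)\<^sup>2 * (norm (Q n x))\<^sup>2)"
    proof (intro mult_mono)
      show "(\<Sum>n<m. (1 / w n)\<^sup>2) \<le> S" unfolding S_def using sum_le_suminf[OF S_summable, of "{..<m}"] by (simp add: power_divide)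
      show "(\<Sum>n<m. (w n * norm (Q n x))\<^sup>2) \<le> (\<Sum>n. (w n)\<^sup>2 * (norm (Q n x))\<^sup>2)"
        using sum_le_suminf[OF s2, of "{..<m}"] by (simp add: power_mult_distrib)
    qed (auto simp: S_nonneg sum_nonneg)
    finally show ?thesis .
  qed
  have "(\<lambda>m. (norm (\<Sum>n<m. Q n x))\<^sup>2) \<longlonglongrightarrow> (norm (Lx x))\<^sup>2"
    unfolding Lx_def by (intro tendsto_intros summable_LIMSEQ s)
  then have "(norm (Lx x))\<^sup>2 \<le> S * (\<Sum>n. (w n)\<^sup>2 * (norm (Q n x))\<^sup>2)" by (rule LIMSEQ_le_const2) (use part in auto)
  then have "ennreal ((norm (Lx x))\<^sup>2) \<le> ennreal (S * (\<Sum>n. (w n)\<^sup>2 * (norm (Q n x))\<^sup>2))" by (rule ennreal_leI)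
  also have "\<dots> = ennreal S * V x" unfolding Vr using S_nonneg by (subst ennreal_mult) (auto intro!: suminf_nonneg s2)
  finally show "ennreal ((norm (Lx x))\<^sup>2) \<le> ennreal S * V x" .
qed

lemma T_sum: assumes x: "good x" shows "T (e m) x = (\<Sum>n<m. Q n x)"
proof -
  have P: "piece_op \<beta> f g (e m) 1 \<sigma> x = (\<Sum>n<m. piece_op \<beta> f g (e (Suc n)) (e n) \<sigma> x)" if \<sigma>: "\<sigma> = 1 \<or> \<sigma> = -1" for \<sigma>
  proof (induction m)
    case 0
    have "piece_op \<beta> f g 1 1 \<sigma> x = (LINT (t::real)|lborel. 0)"
      unfolding piece_op_def
    proof (rule integral_cong_AE)
      have "AE t in lborel. t \<noteq> (1::real)" by (rule AE_lborel_singleton)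
      then show "AE t in lborel. (if 1 \<le> t \<and> t \<le> 1 then f (x - \<sigma> * t) * g (x - t\<^sup>2) * osc_kernel \<beta> t else 0) = 0" by eventually_elim auto
    qed measurable
    then show ?case by (simp add: e_props)
  next
    case (Suc m)
    then show ?case using piece_op_add[OF x e_props(2)[of "Suc m"] e_props(3)[of m] e_props(4)[of m] order_refl \<sigma>] by simp
  qed
  show ?thesis unfolding T_eq_pieces[OF x e_props(2) e_props(4)] Q_def using P[of 1] P[of "-1"] by (simp add: sum.distrib)
qed

lemma T_gap:
  assumes x: "good x" and e: "e (Suc n) \<le> \<delta>" "\<delta> \<le> e n"
  shows "ennreal (norm (T \<delta> x - T (e n) x)) \<le> 2 * abs_piece g (e (Suc n)) (e n) x"
proof -
  have \<delta>: "0 < \<delta>" "\<delta> \<le> 1" using e e_props(2)[of "Suc n"] e_props(4)[of n] by auto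
  have "T \<delta> x - T (e n) x = piece_op \<beta> f g \<delta> (e n) 1 x + piece_op \<beta> f g \<delta> (e n) (-1) x"
    unfolding T_eq_pieces[OF x \<delta>] T_eq_pieces[OF x e_props(2) e_props(4)]
    using piece_op_add[OF x \<delta>(1) e(2) e_props(4)[of n] order_refl, of 1] piece_op_add[OF x \<delta>(1) e(2) e_props(4)[of n] order_refl, of "-1"] by simp
  then have "ennreal (norm (T \<delta> x - T (e n) x)) \<le> ennreal (norm (piece_op \<beta> f g \<delta> (e n) 1 x) + norm (piece_op \<beta> f g \<delta> (e n) (-1) x))"
    by (intro ennreal_leI) (simp add: norm_triangle_ineq)
  also have "\<dots> = ennreal (norm (piece_op \<beta> f g \<delta> (e n) 1 x)) + ennreal (norm (piece_op \<beta> f g \<delta> (e n) (-1) x))" by simp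
  also have "\<dots> \<le> abs_piece g (e (Suc n)) (e n) x + abs_piece g (e (Suc n)) (e n) x"
    by (intro add_mono order_trans[OF piece_op_le_abs_piece abs_piece_mono] f1 \<delta> e order_refl)
  finally show ?thesis by (simp add: mult_2)
qed

text \<open>At the cut points the truncated integral is a partial sum of the \<open>Q n x\<close>.
  Between two of them it deviates by at most twice the absolute integral over the cell, and these
  tend to 0 because finiteness of \<open>U x\<close> makes their squares summable.\<close>

lemma T_tendsto:
  assumes x: "ok x"
  shows "((\<lambda>\<delta>. T \<delta> x) \<longlongrightarrow> Lx x) (at_right 0)"
proof (rule tendstoI)
  fix \<eta> :: real assume \<eta>: "\<eta> > 0"
  have gx: "good x" using x by (simp add: ok_def)
  define G where "G n = enn2real (abs_piece g (e (Suc n)) (e n) x)" for n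
  have Gf: "abs_piece g (e (Suc n)) (e n) x = ennreal (G n)" for n
    unfolding G_def using good_fin[OF gx e_props(2) e_props(4)] by (simp add: less_top)
  have G0: "0 \<le> G n" for n by (simp add: G_def)
  have "summable (\<lambda>n. (G n)\<^sup>2)"
    by (rule summable_suminf_not_top) (use x in \<open>auto simp: ok_def U_def Gf ennreal_power G0\<close>)
  then have "(\<lambda>n. (G n)\<^sup>2) \<longlonglongrightarrow> 0" by (rule summable_LIMSEQ_zero)
  then have "(\<lambda>n. sqrt ((G n)\<^sup>2)) \<longlonglongrightarrow> sqrt 0" by (rule tendsto_real_sqrt)
  then have "G \<longlonglongrightarrow> 0" using G0 by simp
  then have ev1: "\<forall>\<^sub>F n in sequentially. G n < \<eta> / 4" using \<eta> by (intro order_tendstoD(2)) auto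
  have "(\<lambda>m. T (e m) x) \<longlonglongrightarrow> Lx x"
    unfolding T_sum[OF gx] Lx_def by (rule summable_LIMSEQ[OF ok_sum(1)[OF x]])
  then have ev2: "\<forall>\<^sub>F n in sequentially. dist (T (e n) x) (Lx x) < \<eta> / 2" using \<eta> by (intro tendstoD) auto
  obtain n0 where n0: "\<And>n. n \<ge> n0 \<Longrightarrow> G n < \<eta> / 4 \<and> dist (T (e n) x) (Lx x) < \<eta> / 2"
    using eventually_conj[OF ev1 ev2] unfolding eventually_sequentially by blast
  have "dist (T \<delta> x) (Lx x) < \<eta>" if \<delta>: "0 < \<delta>" "\<delta> < e n0" for \<delta>
  proof -
    obtain m where m: "e m < \<delta>" using e_small[OF \<delta>(1)] .
    \<comment> \<open>The first cut point \<open>e (Suc n)\<close> not exceeding \<delta>; by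
      minimality \<delta> lies in the cell below \<open>e n\<close>. For \<open>n = 0\<close>
      minimality says nothing, and \<open>e 0 = 1\<close> is used instead.\<close>
    define n where "n = (LEAST n. e (Suc n) \<le> \<delta>)"
    have ex: "e (Suc m) \<le> \<delta>" using m e_props(3)[of m] by simp
    have n1: "e (Suc n) \<le> \<delta>" unfolding n_def by (rule LeastI[of "\<lambda>n. e (Suc n) \<le> \<delta>", OF ex])
    have nn0: "n0 \<le> n"
    proof (rule ccontr)
      assume "\<not> n0 \<le> n"
      then have "e n0 \<le> e (Suc n)" by (intro e_antimono) auto
      then show False using n1 \<delta> by simp
    qed
    have n2: "\<delta> \<le> e n"
    proof (cases n)
      case 0
      then show ?thesis using \<delta> e_props(4)[of n0] e_props(1) by simp
    next
      case (Suc j)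
      then have "\<not> e (Suc j) \<le> \<delta>" using not_less_Least[of j "\<lambda>n. e (Suc n) \<le> \<delta>"] unfolding n_def by simp
      then show ?thesis using Suc by simp
    qed
    have "ennreal (norm (T \<delta> x - T (e n) x)) \<le> 2 * ennreal (G n)" using T_gap[OF gx n1 n2] unfolding Gf .
    also have "\<dots> = ennreal (2 * G n)" using G0 by (subst ennreal_mult) auto
    finally have "norm (T \<delta> x - T (e n) x) \<le> 2 * G n" using G0[of n] by (subst (asm) ennreal_le_iff) auto
    then have "dist (T \<delta> x) (T (e n) x) < \<eta> / 2" using n0[OF nn0] by (simp add: dist_norm)
    then show ?thesis using n0[OF nn0] dist_triangle[of "T \<delta> x" "Lx x" "T (e n) x"] by linarith
  qed
  then show "\<forall>\<^sub>F \<delta> in at_right 0. dist (T \<delta> x) (Lx x) < \<eta>"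
    unfolding eventually_at_right_field using e_props(2)[of n0] by (intro exI[of _ "e n0"]) auto
qed

lemma Lx_meas[measurable]: "Lx \<in> borel_measurable borel" unfolding Lx_def by measurable

lemma Lx_bound: "(\<integral>\<^sup>+x. ennreal ((norm (Lx x))\<^sup>2) \<partial>lborel) \<le> ennreal (S * (C1 * S)) * EE"
proof -
  have "(\<integral>\<^sup>+x. ennreal ((norm (Lx x))\<^sup>2) \<partial>lborel) \<le> (\<integral>\<^sup>+x. ennreal S * V x \<partial>lborel)"
    using AE_ok by (intro nn_integral_mono_AE) (auto elim!: eventually_mono intro: ok_sum)
  also have "\<dots> = ennreal S * (\<integral>\<^sup>+x. V x \<partial>lborel)" by (rule nn_integral_cmult) measurable
  also have "\<dots> \<le> ennreal S * (ennreal (C1 * S) * EE)" by (intro mult_left_mono V_bound) auto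
  also have "\<dots> = ennreal (S * (C1 * S)) * EE" using S_nonneg C1 by (simp add: ennreal_mult mult.assoc)
  finally show ?thesis .
qed

end

section \<open>Borel representatives and the theorem\<close>

text \<open>Completeness of Lebesgue measure. It is needed for \<open>T_op\<close> itself, whose
  values are unspecified where no limit exists and which is known only to agree almost everywhere
  with a Borel function.\<close>

lemma lebesgue_measurable_AE_cong:
  fixes f h :: "'a::euclidean_space \<Rightarrow> 'b::topological_space"
  assumes f: "f \<in> borel_measurable lebesgue" and ae: "AE x in lborel. f x = h x"
  shows "h \<in> borel_measurable lebesgue"
proof (rule measurableI)
  fix B :: "'b set" assume B: "B \<in> sets borel"
  show "h -` B \<inter> space lebesgue \<in> sets lebesgue"
  proof (rule completion.in_sets_AE)
    show "AE x in lebesgue. (x \<in> f -` B \<inter> space lebesgue) = (x \<in> h -` B \<inter> space lebesgue)"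
      using AE_completion[OF ae] by eventually_elim simp
  qed (use measurable_sets[OF f B] in auto)
qed auto

lemma lebesgue_borel_rep:
  fixes f :: "real \<Rightarrow> complex"
  assumes f[measurable]: "f \<in> borel_measurable lebesgue"
  obtains f0 where "f0 \<in> borel_measurable borel" "AE x in lborel. f x = f0 x"
proof -
  have m: "(\<lambda>x. Re (f x)) \<in> borel_measurable lebesgue" "(\<lambda>x. Im (f x)) \<in> borel_measurable lebesgue" by measurable
  obtain a b where [measurable]: "a \<in> borel_measurable lborel" "b \<in> borel_measurable lborel"
    and ab: "AE x in lborel. Re (f x) = a x" "AE x in lborel. Im (f x) = b x"
    using completion_ex_borel_measurable_real[OF m(1)] completion_ex_borel_measurable_real[OF m(2)] by blast
  show thesis
  proof (rule that)
    show "(\<lambda>x. complex_of_real (a x) + \<i> * complex_of_real (b x)) \<in> borel_measurable borel" by measurable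
    show "AE x in lborel. f x = complex_of_real (a x) + \<i> * complex_of_real (b x)"
      using ab by eventually_elim (simp add: complex_eq_iff)
  qed
qed

text \<open>By Fubini, for almost every \<open>x\<close> the points \<open>t\<close> with
  \<open>x - p t\<close> in a given null set form a null set. With \<open>p t = t\<close> and
  \<open>p t = t\<^sup>2\<close> this permits Borel representatives of \<open>f\<close> and
  \<open>g\<close> inside the integral.\<close>

lemma AE_lborel_shift:
  assumes ae: "AE x in lborel. P (x::real)" and p[measurable]: "p \<in> borel_measurable borel"
  shows "AE x in lborel. AE t in lborel. P (x - p (t::real))"
proof -
  obtain N where N: "{x \<in> space lborel. \<not> P x} \<subseteq> N" "emeasure lborel N = 0" "N \<in> sets lborel"
    using AE_E[OF ae] by blast
  have [measurable]: "N \<in> sets borel" using N(3) by simp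
  have "(\<integral>\<^sup>+x. (\<integral>\<^sup>+t. indicator N (x - p t) \<partial>lborel) \<partial>lborel) = (\<integral>\<^sup>+t. (\<integral>\<^sup>+x. indicator N (x - p t) \<partial>lborel) \<partial>lborel)"
    by (rule lborel_pair.Fubini') measurable
  also have "(\<integral>\<^sup>+x. indicator N (x - c) \<partial>lborel) = 0" for c :: real
    using nn_integral_real_affine[of "indicator N" 1 "-c"] N(2) by simp
  then have "(\<integral>\<^sup>+t. (\<integral>\<^sup>+x. indicator N (x - p t) \<partial>lborel) \<partial>lborel) = (0::ennreal)" by simp
  finally have "AE x in lborel. (\<integral>\<^sup>+t. indicator N (x - p t) \<partial>lborel) = (0::ennreal)"
    by (subst (asm) nn_integral_0_iff_AE) measurable
  then show ?thesis
  proof eventually_elim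
    case (elim x)
    then have "AE t in lborel. indicator N (x - p t) = (0::ennreal)"
      by (subst (asm) nn_integral_0_iff_AE) measurable
    then show ?case by eventually_elim (use N(1) in \<open>auto simp: indicator_def split: if_splits\<close>)
  qed
qed

text \<open>Only agreement for almost every \<open>t\<close> at one fixed \<open>x\<close> is
  assumed, and the cut-off is arbitrary. The integrand is first replaced by a Borel one, after which
  the completed measure may be dropped.\<close>

lemma T_trunc_lborel:
  assumes [measurable]: "f2 \<in> borel_measurable borel" "g0 \<in> borel_measurable borel"
    and f: "AE t in lborel. f (x - t) = c * f2 (x - t)" and g: "AE t in lborel. g (x - t\<^sup>2) = g0 (x - t\<^sup>2)"
  shows "T_trunc \<beta> e f g x = c * (LINT t|lborel. (if e \<le> \<bar>t\<bar> \<and> \<bar>t\<bar> \<le> 1 then f2 (x - t) * g0 (x - t\<^sup>2) * osc_kernel \<beta> t else 0))"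
proof -
  define F where "F t = c * (if e \<le> \<bar>t\<bar> \<and> \<bar>t\<bar> \<le> 1 then f2 (x - t) * g0 (x - t\<^sup>2) * osc_kernel \<beta> t else 0)" for t
  define H where "H t = indicator {t. e \<le> \<bar>t\<bar> \<and> \<bar>t\<bar> \<le> 1} t *\<^sub>R (f (x - t) * g (x - t\<^sup>2) * exp (\<i> * complex_of_real (\<bar>t\<bar> powr (- \<beta>))) / complex_of_real \<bar>t\<bar>)" for t
  have F[measurable]: "F \<in> borel_measurable borel" unfolding F_def by measurable
  have eq: "AE t in lborel. F t = H t"
    using f g by eventually_elim (auto simp: F_def H_def osc_kernel_def cis_conv_exp)
  have Fl: "F \<in> borel_measurable lebesgue" using measurable_completion[of F lborel borel] by simp
  have "T_trunc \<beta> e f g x = (LINT t|lebesgue. H t)"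
    unfolding T_trunc_def set_lebesgue_integral_def H_def ..
  also have "\<dots> = (LINT t|lebesgue. F t)"
    using AE_completion[OF eq] by (intro integral_cong_AE Fl lebesgue_measurable_AE_cong[OF Fl eq]) (auto elim: eventually_mono)
  also have "\<dots> = (LINT t|lborel. F t)" by (rule integral_completion) simp
  finally show ?thesis unfolding F_def by simp
qed

lemma Linf_space_rep:
  assumes f: "f \<in> Linf_space"
  obtains f2 where "f2 \<in> borel_measurable borel" "\<And>x. norm (f2 x) \<le> 1"
    "AE x in lborel. f x = complex_of_real (norm_Linf f) * f2 x" "norm_Linf f \<ge> 0"
proof -
  define s where "s = esssup lebesgue (\<lambda>x. ereal (cmod (f x)))"
  define M where "M = norm_Linf f"
  have fm: "f \<in> borel_measurable lebesgue" and s1: "s < \<infinity>" using f by (auto simp: Linf_space_def s_def)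
  obtain f0 where f0[measurable]: "f0 \<in> borel_measurable borel" and ae: "AE x in lborel. f x = f0 x"
    using lebesgue_borel_rep[OF fm] .
  have le: "AE x in lborel. ereal (cmod (f x)) \<le> s"
    using esssup_AE[of "\<lambda>x. ereal (cmod (f x))" lebesgue] unfolding s_def AE_completion_iff .
  \<comment> \<open>The essential supremum dominates a nonnegative function almost everywhere; as
    Lebesgue measure is not zero, the constant inequality must hold outright.\<close>
  have "AE x in (lborel::real measure). 0 \<le> s" using le
  proof eventually_elim
    case (elim x)
    show ?case by (rule order_trans[OF _ elim]) simp
  qed
  moreover have "ae_filter (lborel::real measure) \<noteq> bot" unfolding ae_filter_eq_bot_iff by simp
  ultimately have s0: "0 \<le> s" by (simp add: eventually_const)
  have sM: "s = ereal M" using s0 s1 unfolding M_def norm_Linf_def s_def[symmetric] by (cases s) auto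
  have M0: "0 \<le> M" using s0 sM by simp
  \<comment> \<open>Values exceeding \<open>M\<close> occur only on a null set and are cut off to
    make the bound hold everywhere. If \<open>M = 0\<close>, division by zero yields 0, consistent
    with \<open>f\<close> vanishing almost everywhere.\<close>
  define f2 where "f2 x = (if norm (f0 x) \<le> M then f0 x else 0) / complex_of_real M" for x
  show thesis
  proof (rule that[of f2])
    show "f2 \<in> borel_measurable borel" unfolding f2_def by measurable
    show "norm (f2 x) \<le> 1" for x using M0 by (auto simp: f2_def norm_divide divide_le_eq)
    show "AE x in lborel. f x = complex_of_real (norm_Linf f) * f2 x"
      using ae le by eventually_elim (auto simp: f2_def sM M_def[symmetric])
    show "norm_Linf f \<ge> 0" using M0 by (simp add: M_def)
  qed
qed

theorem theorem1:
  fixes \<beta> :: real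
  assumes "\<beta> > 1"
  shows "\<exists>C::real. \<forall>f \<in> Linf_space. \<forall>g \<in> L2_space.
           (AE x in lebesgue. T_exists \<beta> f g x) \<and>
           T_op \<beta> f g \<in> L2_space \<and>
           norm_L2 (T_op \<beta> f g) \<le> C * norm_Linf f * norm_L2 g"
proof -
  obtain K where K: "K > 0" and piece: "\<And>f g r1 r2 \<sigma>. f \<in> borel_measurable borel \<Longrightarrow> (\<And>x. norm (f x) \<le> 1) \<Longrightarrow>
      g \<in> borel_measurable borel \<Longrightarrow> 0 < r1 \<Longrightarrow> r1 \<le> r2 \<Longrightarrow> r2 \<le> 2 * r1 \<Longrightarrow> r2 \<le> 1 \<Longrightarrow> \<sigma> = 1 \<or> \<sigma> = -1 \<Longrightarrow>
      (\<integral>\<^sup>+x. ennreal ((norm (piece_op \<beta> f g r1 r2 \<sigma> x))\<^sup>2) \<partial>lborel) \<le> ennreal (K * r2 powr ((\<beta>-1)/8)) * (\<integral>\<^sup>+z. ennreal ((norm (g z))\<^sup>2) \<partial>lborel)"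
    using piece_op_bound[OF assms] by metis
  \<comment> \<open>The locale constants \<open>S\<close> and \<open>C1\<close> depend only on
    \<beta> and \<open>K\<close>. This makes the bound independent of \<open>f\<close> and
    \<open>g\<close>, which are fixed afterwards.\<close>
  define D where "D = truncations.S \<beta> * (truncations.C1 \<beta> K * truncations.S \<beta>)"
  show ?thesis
  proof (intro exI[of _ "sqrt D"] ballI)
    fix f g assume f: "f \<in> Linf_space" and g: "g \<in> L2_space"
    define M where "M = norm_Linf f"
    obtain f2 where f2[measurable]: "f2 \<in> borel_measurable borel" and f2_1: "\<And>x. norm (f2 x) \<le> 1"
      and f_ae: "AE x in lborel. f x = complex_of_real M * f2 x" and M: "M \<ge> 0"
      by (rule Linf_space_rep[OF f, folded M_def]) (rule that)
    have gm: "g \<in> borel_measurable lebesgue" and gi: "integrable lebesgue (\<lambda>x. (cmod (g x))\<^sup>2)"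
      using g by (auto simp: L2_space_def)
    obtain g0 where g0[measurable]: "g0 \<in> borel_measurable borel" and g_ae: "AE x in lborel. g x = g0 x"
      using lebesgue_borel_rep[OF gm] .
    have Eg: "(\<integral>\<^sup>+x. ennreal ((norm (g0 x))\<^sup>2) \<partial>lborel) = ennreal ((norm_L2 g)\<^sup>2)"
    proof -
      have "(\<integral>\<^sup>+x. ennreal ((norm (g0 x))\<^sup>2) \<partial>lborel) = (\<integral>\<^sup>+x. ennreal ((norm (g x))\<^sup>2) \<partial>lborel)"
        by (rule nn_integral_cong_AE) (use g_ae in eventually_elim, auto)
      also have "\<dots> = (\<integral>\<^sup>+x. ennreal ((norm (g x))\<^sup>2) \<partial>lebesgue)" by (simp add: nn_integral_completion)
      also have "\<dots> = ennreal (LINT x|lebesgue. (cmod (g x))\<^sup>2)" by (rule nn_integral_eq_integral[OF gi]) auto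
      finally show ?thesis by (simp add: norm_L2_def)
    qed
    interpret truncations \<beta> K f2 g0
      by (rule truncations.intro; (rule assms K f2 f2_1 g0 | (rule piece[OF f2 f2_1 g0]; assumption) | simp add: Eg))
    have D0: "0 \<le> D" unfolding D_def using S_nonneg C1 by simp
    define L where "L x = complex_of_real M * Lx x" for x
    have [measurable]: "L \<in> borel_measurable borel" unfolding L_def by measurable
    have p: "(\<lambda>t::real. t) \<in> borel_measurable borel" "(\<lambda>t::real. t\<^sup>2) \<in> borel_measurable borel" by measurable
    \<comment> \<open>The exceptional sets come from the representatives of \<open>f\<close> and
      \<open>g\<close> and from \<open>ok\<close>; none depends on the truncation, so the limit may
      be taken at every remaining \<open>x\<close>.\<close>
    have lim: "AE x in lborel. ((\<lambda>e. T_trunc \<beta> e f g x) \<longlongrightarrow> L x) (at_right 0)"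
      using AE_lborel_shift[OF f_ae p(1)] AE_lborel_shift[OF g_ae p(2)] AE_ok
    proof eventually_elim
      case (elim x)
      have "T_trunc \<beta> e f g x = complex_of_real M * T e x" for e
        unfolding T_def by (rule T_trunc_lborel[OF f2 g0]) (use elim in auto)
      then show ?case unfolding L_def by (auto intro!: tendsto_intros T_tendsto elim)
    qed
    have op: "AE x in lborel. L x = T_op \<beta> f g x"
      using lim by eventually_elim (simp add: T_op_def tendsto_Lim)
    have Ll: "L \<in> borel_measurable lebesgue" using measurable_completion[of L lborel borel] by simp
    have Tm[measurable]: "T_op \<beta> f g \<in> borel_measurable lebesgue" by (rule lebesgue_measurable_AE_cong[OF Ll op])
    have B: "(\<integral>\<^sup>+x. ennreal ((cmod (T_op \<beta> f g x))\<^sup>2) \<partial>lebesgue) \<le> ennreal (D * (M * norm_L2 g)\<^sup>2)"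
    proof -
      have "(\<integral>\<^sup>+x. ennreal ((cmod (T_op \<beta> f g x))\<^sup>2) \<partial>lebesgue) = (\<integral>\<^sup>+x. ennreal ((cmod (T_op \<beta> f g x))\<^sup>2) \<partial>lborel)"
        by (rule nn_integral_completion)
      also have "\<dots> = (\<integral>\<^sup>+x. ennreal (M\<^sup>2) * ennreal ((norm (Lx x))\<^sup>2) \<partial>lborel)"
      proof (rule nn_integral_cong_AE)
        show "AE x in lborel. ennreal ((cmod (T_op \<beta> f g x))\<^sup>2) = ennreal (M\<^sup>2) * ennreal ((norm (Lx x))\<^sup>2)"
          using op by eventually_elim (simp add: L_def norm_mult power_mult_distrib flip: ennreal_mult, metis norm_mult norm_of_real power2_abs power_mult_distrib)
      qed
      also have "\<dots> = ennreal (M\<^sup>2) * (\<integral>\<^sup>+x. ennreal ((norm (Lx x))\<^sup>2) \<partial>lborel)" by (rule nn_integral_cmult) measurable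
      also have "\<dots> \<le> ennreal (M\<^sup>2) * (ennreal D * EE)" unfolding D_def by (intro mult_left_mono Lx_bound) auto
      also have "\<dots> = ennreal (M\<^sup>2 * (D * (norm_L2 g)\<^sup>2))" unfolding EE_def Eg using D0 by (simp add: ennreal_mult)
      also have "M\<^sup>2 * (D * (norm_L2 g)\<^sup>2) = D * (M * norm_L2 g)\<^sup>2" by (simp add: power_mult_distrib)
      finally show ?thesis .
    qed
    have int: "integrable lebesgue (\<lambda>x. (cmod (T_op \<beta> f g x))\<^sup>2)"
    proof (rule integrableI_bounded)
      show "(\<integral>\<^sup>+x. ennreal (norm ((cmod (T_op \<beta> f g x))\<^sup>2)) \<partial>lebesgue) < \<infinity>"
        using le_less_trans[OF B ennreal_less_top] by simp
    qed measurable
    have "ennreal (LINT x|lebesgue. (cmod (T_op \<beta> f g x))\<^sup>2) \<le> ennreal (D * (M * norm_L2 g)\<^sup>2)"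
      using B nn_integral_eq_integral[OF int] by simp
    then have "(LINT x|lebesgue. (cmod (T_op \<beta> f g x))\<^sup>2) \<le> D * (M * norm_L2 g)\<^sup>2"
      using D0 by (subst (asm) ennreal_le_iff) auto
    then have "norm_L2 (T_op \<beta> f g) \<le> sqrt (D * (M * norm_L2 g)\<^sup>2)" unfolding norm_L2_def[of "T_op \<beta> f g"] by (rule real_sqrt_le_mono)
    also have "\<dots> = sqrt D * (M * norm_L2 g)" using M by (simp add: real_sqrt_mult norm_L2_def)
    finally have "norm_L2 (T_op \<beta> f g) \<le> sqrt D * norm_Linf f * norm_L2 g" by (simp add: M_def mult.assoc)
    moreover have "AE x in lebesgue. T_exists \<beta> f g x"
      using AE_completion[OF lim] by eventually_elim (auto simp: T_exists_def)
    ultimately show "(AE x in lebesgue. T_exists \<beta> f g x) \<and> T_op \<beta> f g \<in> L2_space \<and>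
        norm_L2 (T_op \<beta> f g) \<le> sqrt D * norm_Linf f * norm_L2 g"
      using int Tm by (simp add: L2_space_def)
  qed
qed

end
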